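(* Let $(X,r)$ be a finite bijective left non-degenerate solution of the Yang--Baxter equation. Let $A=A(X,r)$ and $\mathcal Z_0=\mathcal Z\cup\{\varnothing\}$, where $$\mathcal Z=\{Z\subseteq X:\varnothing\ne Z\ne X\text{ and }\sigma_x(Z)=Z\text{ for all }x\in X\setminus Z\}.$$ If $K$ is a field then $$\operatorname{clKdim}K[A]=\max\{s(Z):Z\in\mathcal Z_0\},$$ where $s(Z)$ is the number of orbits of $X\setminus Z$ with respect to the action of the subgroup $\Sigma_Z$ of $\operatorname{Sym}(X)$ generated by all $\sigma_x$ with $x\in X\setminus Z$.
   Context: Let $X$ be a non-empty set. A (set-theoretic) solution of the Yang--Baxter equation is a pair $(X,r)$ with $r\colon X\times X\to X\times X$, written $r(x,y)=(\lambda_x(y),\rho_y(x))$, such that $(r\times\mathrm{id})(\mathrm{id}\times r)(r\times\mathrm{id})=(\mathrm{id}\times r)(r\times\mathrm{id})(\mathrm{id}\times r)$. It is finite if $X$ is finite, bijective if $r$ is bijective, left non-degenerate if every $\lambda_x\colon X\to X$ is bijective. For a left non-degenerate solution put $\sigma_z(x)=\lambda_z(\rho_{\lambda_x^{-1}(z)}(x))$ for $x,z\in X$; the derived structure monoid is $A(X,r)=\langle X\mid xz=z\sigma_z(x)\text{ for all }x,z\in X\rangle$. (If $(X,r)$ is bijective then each $\sigma_z\in\operatorname{Sym}(X)$.) $K[A]$ is the monoid algebra and $\operatorname{clKdim}$ is the classical Krull dimension (supremum of lengths of chains of prime ideals). *)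

theory Defs
  imports "HOL-Algebra.Ideal_Product" "HOL-Algebra.Generated_Groups" "HOL-Algebra.Group_Action" "HOL-Library.Extended_Nat"
begin

section \<open>Set-theoretic solutions of the Yang--Baxter equation\<close>

text \<open>The underlying set is called \<open>S\<close> throughout, because HOL-Algebra's polynomial theories
  reserve the letter X as notation for a polynomial variable.\<close>

definition lam :: "('x \<times> 'x \<Rightarrow> 'x \<times> 'x) \<Rightarrow> 'x \<Rightarrow> 'x \<Rightarrow> 'x"
  where "lam r x y = fst (r (x, y))"

text \<open>The subscript comes first: \<open>rho r y x\<close> is $\rho_y(x)$.\<close>

definition rho :: "('x \<times> 'x \<Rightarrow> 'x \<times> 'x) \<Rightarrow> 'x \<Rightarrow> 'x \<Rightarrow> 'x"
  where "rho r y x = snd (r (x, y))"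

text \<open>The triple product is \<open>S \<times> (S \<times> S)\<close>, so \<open>id \<times> r\<close> is \<open>map_prod id r\<close>,
  whereas \<open>r \<times> id\<close> needs reassociation.\<close>

definition r_times_id :: "('x \<times> 'x \<Rightarrow> 'x \<times> 'x) \<Rightarrow> 'x \<times> 'x \<times> 'x \<Rightarrow> 'x \<times> 'x \<times> 'x"
  where "r_times_id r = (\<lambda>(x, y, z). case r (x, y) of (u, v) \<Rightarrow> (u, v, z))"

definition id_times_r :: "('x \<times> 'x \<Rightarrow> 'x \<times> 'x) \<Rightarrow> 'x \<times> 'x \<times> 'x \<Rightarrow> 'x \<times> 'x \<times> 'x"
  where "id_times_r r = map_prod id r"

definition ybe_solution :: "'x set \<Rightarrow> ('x \<times> 'x \<Rightarrow> 'x \<times> 'x) \<Rightarrow> bool"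
  where "ybe_solution S r \<longleftrightarrow>
    S \<noteq> {} \<and> r \<in> S \<times> S \<rightarrow> S \<times> S \<and>
    (\<forall>t \<in> S \<times> S \<times> S.
      (r_times_id r \<circ> id_times_r r \<circ> r_times_id r) t =
      (id_times_r r \<circ> r_times_id r \<circ> id_times_r r) t)"

definition bijective_solution :: "'x set \<Rightarrow> ('x \<times> 'x \<Rightarrow> 'x \<times> 'x) \<Rightarrow> bool"
  where "bijective_solution S r \<longleftrightarrow> ybe_solution S r \<and> bij_betw r (S \<times> S) (S \<times> S)"

definition left_nondegenerate :: "'x set \<Rightarrow> ('x \<times> 'x \<Rightarrow> 'x \<times> 'x) \<Rightarrow> bool"
  where "left_nondegenerate S r \<longleftrightarrow> (\<forall>x \<in> S. bij_betw (lam r x) S S)"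

definition sigma :: "'x set \<Rightarrow> ('x \<times> 'x \<Rightarrow> 'x \<times> 'x) \<Rightarrow> 'x \<Rightarrow> 'x \<Rightarrow> 'x"
  where "sigma S r z x = lam r z (rho r (inv_into S (lam r x) z) x)"

lemma sigma_closed:
  assumes "r \<in> S \<times> S \<rightarrow> S \<times> S" "left_nondegenerate S r" "x \<in> S" "z \<in> S"
  shows "sigma S r z x \<in> S"
proof -
  have bij: "bij_betw (lam r u) S S" if "u \<in> S" for u
    using assms(2) that by (simp add: left_nondegenerate_def)
  have "inv_into S (lam r x) z \<in> S"
    using bij_betw_imp_surj_on[OF bij[OF assms(3)]] assms(4) by (intro inv_into_into) simp
  then have "r (x, inv_into S (lam r x) z) \<in> S \<times> S"
    using assms(1,3) by (intro funcset_mem[OF assms(1)]) simp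
  then have "rho r (inv_into S (lam r x) z) x \<in> S"
    by (simp add: rho_def mem_Times_iff)
  then show ?thesis
    unfolding sigma_def by (rule bij_betw_apply[OF bij[OF assms(4)]])
qed

lemma sigma_bij:
  assumes "finite S" "bijective_solution S r" "left_nondegenerate S r" "z \<in> S"
  shows "bij_betw (sigma S r z) S S"
proof -
  have r: "r \<in> S \<times> S \<rightarrow> S \<times> S" and bij: "bij_betw r (S \<times> S) (S \<times> S)"
    using assms(2) by (auto simp: bijective_solution_def ybe_solution_def)
  have inv: "inv_into S (lam r x) z \<in> S \<and> lam r x (inv_into S (lam r x) z) = z" if "x \<in> S" for x
  proof -
    have "lam r x ` S = S"
      using assms(3) that by (simp add: left_nondegenerate_def bij_betw_def)
    then show ?thesis using assms(4) by (simp add: inv_into_into f_inv_into_f)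
  qed
  have "inj_on (sigma S r z) S"
  proof (rule inj_onI)
    fix x y assume x: "x \<in> S" and y: "y \<in> S" and eq: "sigma S r z x = sigma S r z y"
    let ?u = "inv_into S (lam r x) z" and ?v = "inv_into S (lam r y) z"
    have u: "(x, ?u) \<in> S \<times> S" and v: "(y, ?v) \<in> S \<times> S" using inv x y by auto
    have "rho r ?u x \<in> S" "rho r ?v y \<in> S"
      using funcset_mem[OF r u] funcset_mem[OF r v] by (auto simp: rho_def mem_Times_iff)
    moreover have "inj_on (lam r z) S"
      using assms by (auto simp: left_nondegenerate_def bij_betw_def)
    ultimately have "rho r ?u x = rho r ?v y"
      using eq by (auto simp: sigma_def dest: inj_onD)
    moreover have "lam r x ?u = lam r y ?v" using inv x y by simp
    ultimately have "r (x, ?u) = r (y, ?v)" by (simp add: rho_def lam_def prod_eq_iff)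
    then have "(x, ?u) = (y, ?v)"
      using inj_onD[OF bij_betw_imp_inj_on[OF bij]] u v by blast
    then show "x = y" by simp
  qed
  moreover have "sigma S r z ` S \<subseteq> S" using sigma_closed[OF r assms(3)] assms(4) by blast
  ultimately show ?thesis
    using assms(1) by (simp add: bij_betw_def endo_inj_surj)
qed


section \<open>Monoids given by generators and relations\<close>

text \<open>\<open>pres_cong S R\<close> is the least congruence on the free monoid \<open>lists S\<close> containing the
  relations \<open>R\<close>; relations involving letters outside \<open>S\<close> are ignored.\<close>

inductive_set pres_cong :: "'x set \<Rightarrow> ('x list \<times> 'x list) set \<Rightarrow> ('x list \<times> 'x list) set"
  for S :: "'x set" and R :: "('x list \<times> 'x list) set" where
  rel: "(u, v) \<in> R \<Longrightarrow> u \<in> lists S \<Longrightarrow> v \<in> lists S \<Longrightarrow> (u, v) \<in> pres_cong S R"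
| refl: "u \<in> lists S \<Longrightarrow> (u, u) \<in> pres_cong S R"
| sym: "(u, v) \<in> pres_cong S R \<Longrightarrow> (v, u) \<in> pres_cong S R"
| trans: "(u, v) \<in> pres_cong S R \<Longrightarrow> (v, w) \<in> pres_cong S R \<Longrightarrow> (u, w) \<in> pres_cong S R"
| append: "(u, v) \<in> pres_cong S R \<Longrightarrow> (u', v') \<in> pres_cong S R \<Longrightarrow>
    (u @ u', v @ v') \<in> pres_cong S R"

definition presented_monoid :: "'x set \<Rightarrow> ('x list \<times> 'x list) set \<Rightarrow> 'x list set monoid"
  where "presented_monoid S R =
    \<lparr>carrier = lists S // pres_cong S R,
     mult = \<lambda>U V. \<Union>u \<in> U. \<Union>v \<in> V. pres_cong S R `` {u @ v},
     one = pres_cong S R `` {[]}\<rparr>"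

lemma pres_cong_lists: "(u, v) \<in> pres_cong S R \<Longrightarrow> u \<in> lists S \<and> v \<in> lists S"
  by (induction rule: pres_cong.induct) auto

lemma equiv_pres_cong: "equiv (lists S) (pres_cong S R)"
proof (rule equivI)
  show "pres_cong S R \<subseteq> lists S \<times> lists S" by (auto dest: pres_cong_lists)
  show "refl_on (lists S) (pres_cong S R)" by (simp add: refl_on_def pres_cong.refl)
  show "Relation.sym (pres_cong S R)" by (meson symI pres_cong.sym)
  show "Relation.trans (pres_cong S R)" by (meson transI pres_cong.trans)
qed

lemma pres_class_mult:
  assumes "u \<in> lists S" "v \<in> lists S"
  shows "pres_cong S R `` {u} \<otimes>\<^bsub>presented_monoid S R\<^esub> pres_cong S R `` {v} = pres_cong S R `` {u @ v}"
proof -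
  have "congruent2 (pres_cong S R) (pres_cong S R) (\<lambda>u v. pres_cong S R `` {u @ v})"
    by (rule congruent2I') (meson equiv_class_eq equiv_pres_cong pres_cong.append)
  from UN_equiv_class2[OF equiv_pres_cong equiv_pres_cong this assms]
  show ?thesis by (simp add: presented_monoid_def)
qed

lemma monoid_presented_monoid: "monoid (presented_monoid S R)"
proof -
  let ?M = "presented_monoid S R" and ?c = "\<lambda>u. pres_cong S R `` {u}"
  have car: "U \<in> carrier ?M \<longleftrightarrow> (\<exists>u. u \<in> lists S \<and> U = ?c u)" for U
    by (simp add: presented_monoid_def quotient_def Bex_def del: in_lists_conv_set)
  have one: "\<one>\<^bsub>?M\<^esub> = ?c []" by (simp add: presented_monoid_def)
  note m = pres_class_mult[where S = S and R = R]
  show ?thesis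
  proof (rule monoidI)
    fix U V assume "U \<in> carrier ?M" "V \<in> carrier ?M"
    then obtain u v where "u \<in> lists S" "v \<in> lists S" "U = ?c u" "V = ?c v"
      unfolding car by (elim exE conjE)
    then have "U \<otimes>\<^bsub>?M\<^esub> V = ?c (u @ v)" "u @ v \<in> lists S" by (simp_all add: m)
    then show "U \<otimes>\<^bsub>?M\<^esub> V \<in> carrier ?M" unfolding car by (intro exI conjI)
  next
    show "\<one>\<^bsub>?M\<^esub> \<in> carrier ?M" unfolding car one by (intro exI[of _ "[]"]) simp
  next
    fix U V W assume "U \<in> carrier ?M" "V \<in> carrier ?M" "W \<in> carrier ?M"
    then obtain u v w where "u \<in> lists S" "v \<in> lists S" "w \<in> lists S"
      "U = ?c u" "V = ?c v" "W = ?c w"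
      unfolding car by (elim exE conjE)
    then show "U \<otimes>\<^bsub>?M\<^esub> V \<otimes>\<^bsub>?M\<^esub> W = U \<otimes>\<^bsub>?M\<^esub> (V \<otimes>\<^bsub>?M\<^esub> W)"
      by (simp add: m del: in_lists_conv_set)
  next
    fix U assume "U \<in> carrier ?M"
    then obtain u where u: "u \<in> lists S" "U = ?c u" unfolding car by (elim exE conjE)
    show "\<one>\<^bsub>?M\<^esub> \<otimes>\<^bsub>?M\<^esub> U = U" using m[of "[]" u] u one by simp
    show "U \<otimes>\<^bsub>?M\<^esub> \<one>\<^bsub>?M\<^esub> = U" using m[of u "[]"] u one by simp
  qed
qed

definition derived_monoid :: "'x set \<Rightarrow> ('x \<times> 'x \<Rightarrow> 'x \<times> 'x) \<Rightarrow> 'x list set monoid"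
  where "derived_monoid S r =
    presented_monoid S {([x, z], [z, sigma S r z x]) | x z. x \<in> S \<and> z \<in> S}"


section \<open>Monoid algebras\<close>

text \<open>Elements are the finitely supported functions from the carrier of \<open>M\<close> to \<open>K\<close>,
  extended by zero outside the carrier so that equality is extensional.\<close>

definition monoid_algebra ::
    "('k, 'c) ring_scheme \<Rightarrow> ('m, 'd) monoid_scheme \<Rightarrow> ('m \<Rightarrow> 'k) ring"
  where "monoid_algebra K M =
    \<lparr>carrier = {f. f \<in> carrier M \<rightarrow> carrier K \<and> (\<forall>a. a \<notin> carrier M \<longrightarrow> f a = \<zero>\<^bsub>K\<^esub>) \<and>
                   finite {a. f a \<noteq> \<zero>\<^bsub>K\<^esub>}},
     mult = \<lambda>f g c. finsum K (\<lambda>(a, b). f a \<otimes>\<^bsub>K\<^esub> g b)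
              {(a, b). f a \<noteq> \<zero>\<^bsub>K\<^esub> \<and> g b \<noteq> \<zero>\<^bsub>K\<^esub> \<and> a \<otimes>\<^bsub>M\<^esub> b = c},
     one = \<lambda>a. if a = \<one>\<^bsub>M\<^esub> then \<one>\<^bsub>K\<^esub> else \<zero>\<^bsub>K\<^esub>,
     zero = \<lambda>_. \<zero>\<^bsub>K\<^esub>,
     add = \<lambda>f g a. f a \<oplus>\<^bsub>K\<^esub> g a\<rparr>"


lemma (in abelian_monoid) finsum_Times:
  assumes "finite A" "finite B" "\<And>a b. a \<in> A \<Longrightarrow> b \<in> B \<Longrightarrow> h a b \<in> carrier G"
  shows "finsum G (\<lambda>(a, b). h a b) (A \<times> B) = (\<Oplus>a\<in>A. \<Oplus>b\<in>B. h a b)"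
  using assms
proof (induction A rule: finite_induct)
  case (insert x A)
  have im: "Pair x ` B = {x} \<times> B" by auto
  have "finsum G (\<lambda>(a, b). h a b) (Pair x ` B) = (\<Oplus>b\<in>B. h x b)"
    using insert.prems by (subst finsum_reindex) (auto simp: inj_on_def)
  moreover have "insert x A \<times> B = Pair x ` B \<union> A \<times> B" by auto
  moreover have "finsum G (\<lambda>(a, b). h a b) (Pair x ` B \<union> A \<times> B) =
      finsum G (\<lambda>(a, b). h a b) (Pair x ` B) \<oplus> finsum G (\<lambda>(a, b). h a b) (A \<times> B)"
    using insert by (intro finsum_Un_disjoint) auto
  ultimately show ?case
    using insert by (subst finsum_insert) (auto intro!: finsum_closed)
qed simp

lemma (in abelian_monoid) finsum_swap:
  assumes "finite A" "finite B" "\<And>a b. a \<in> A \<Longrightarrow> b \<in> B \<Longrightarrow> h a b \<in> carrier G"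
  shows "(\<Oplus>a\<in>A. \<Oplus>b\<in>B. h a b) = (\<Oplus>b\<in>B. \<Oplus>a\<in>A. h a b)"
  using assms
proof (induction A rule: finite_induct)
  case (insert x A)
  have "(\<Oplus>a\<in>insert x A. \<Oplus>b\<in>B. h a b) = (\<Oplus>b\<in>B. h x b) \<oplus> (\<Oplus>a\<in>A. \<Oplus>b\<in>B. h a b)"
    using insert by (intro finsum_insert) (auto intro!: finsum_closed)
  also have "\<dots> = (\<Oplus>b\<in>B. h x b) \<oplus> (\<Oplus>b\<in>B. \<Oplus>a\<in>A. h a b)"
    using insert by simp
  also have "\<dots> = (\<Oplus>b\<in>B. h x b \<oplus> (\<Oplus>a\<in>A. h a b))"
    using insert by (intro finsum_addf[symmetric]) (auto intro!: finsum_closed)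
  also have "\<dots> = (\<Oplus>b\<in>B. \<Oplus>a\<in>insert x A. h a b)"
  proof (rule finsum_cong')
    fix b assume "b \<in> B"
    then show "h x b \<oplus> (\<Oplus>a\<in>A. h a b) = (\<Oplus>a\<in>insert x A. h a b)"
      using insert by (intro finsum_insert[symmetric]) auto
  qed (use insert in \<open>auto intro!: finsum_closed\<close>)
  finally show ?case .
qed simp

lemma monoid_algebra_carrierD:
  assumes "f \<in> carrier (monoid_algebra K M)"
  shows "f a \<noteq> \<zero>\<^bsub>K\<^esub> \<Longrightarrow> a \<in> carrier M" "a \<in> carrier M \<Longrightarrow> f a \<in> carrier K"
    "finite {a. f a \<noteq> \<zero>\<^bsub>K\<^esub>}"
  using assms by (auto simp: monoid_algebra_def)

lemma (in ring) monoid_algebra_closed: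
  "f \<in> carrier (monoid_algebra R M) \<Longrightarrow> f a \<in> carrier R"
  by (cases "a \<in> carrier M") (auto simp: monoid_algebra_def)

lemma (in ring) monoid_algebra_mult:
  assumes f: "f \<in> carrier (monoid_algebra R M)" and g: "g \<in> carrier (monoid_algebra R M)"
    and A: "finite A" "{a. f a \<noteq> \<zero>} \<subseteq> A" and B: "finite B" "{b. g b \<noteq> \<zero>} \<subseteq> B"
  shows "(f \<otimes>\<^bsub>monoid_algebra R M\<^esub> g) c =
    (\<Oplus>a\<in>A. f a \<otimes> (\<Oplus>b\<in>B. g b \<otimes> (if a \<otimes>\<^bsub>M\<^esub> b = c then \<one> else \<zero>)))"
proof -
  note cl [simp] = monoid_algebra_closed[OF f] monoid_algebra_closed[OF g]
  let ?P = "{(a, b). f a \<noteq> \<zero> \<and> g b \<noteq> \<zero> \<and> a \<otimes>\<^bsub>M\<^esub> b = c}"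
  let ?h = "\<lambda>a b. f a \<otimes> (g b \<otimes> (if a \<otimes>\<^bsub>M\<^esub> b = c then \<one> else \<zero>))"
  have "(f \<otimes>\<^bsub>monoid_algebra R M\<^esub> g) c = finsum R (\<lambda>(a, b). f a \<otimes> g b) ?P"
    by (simp add: monoid_algebra_def)
  also have "\<dots> = finsum R (\<lambda>(a, b). ?h a b) (A \<times> B)"
    using A B by (intro add.finprod_mono_neutral_cong_left) (auto split: if_splits)
  also have "\<dots> = (\<Oplus>a\<in>A. \<Oplus>b\<in>B. ?h a b)"
    using A B by (intro finsum_Times) auto
  also have "\<dots> = (\<Oplus>a\<in>A. f a \<otimes> (\<Oplus>b\<in>B. g b \<otimes> (if a \<otimes>\<^bsub>M\<^esub> b = c then \<one> else \<zero>)))"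
    using A B by (intro finsum_cong' refl) (auto intro!: finsum_rdistr[symmetric] finsum_closed)
  finally show ?thesis .
qed

lemma (in ring) monoid_algebra_mult_closed:
  assumes M: "monoid M"
    and f: "f \<in> carrier (monoid_algebra R M)" and g: "g \<in> carrier (monoid_algebra R M)"
  shows "f \<otimes>\<^bsub>monoid_algebra R M\<^esub> g \<in> carrier (monoid_algebra R M)"
    and "{c. (f \<otimes>\<^bsub>monoid_algebra R M\<^esub> g) c \<noteq> \<zero>} \<subseteq>
      (\<lambda>(a, b). a \<otimes>\<^bsub>M\<^esub> b) ` ({a. f a \<noteq> \<zero>} \<times> {b. g b \<noteq> \<zero>})" (is "?S \<subseteq> ?T")
proof -
  note cl [simp] = monoid_algebra_closed[OF f] monoid_algebra_closed[OF g]
  show sub: "?S \<subseteq> ?T"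
  proof (rule subsetI, rule ccontr)
    fix c assume c: "c \<in> ?S" "c \<notin> ?T"
    then have "{(a, b). f a \<noteq> \<zero> \<and> g b \<noteq> \<zero> \<and> a \<otimes>\<^bsub>M\<^esub> b = c} = {}" by (auto simp: image_iff)
    then have "(f \<otimes>\<^bsub>monoid_algebra R M\<^esub> g) c = finsum R (\<lambda>(a, b). f a \<otimes> g b) {}"
      unfolding monoid_algebra_def by (simp only: monoid.simps)
    then have "(f \<otimes>\<^bsub>monoid_algebra R M\<^esub> g) c = \<zero>" by simp
    with c(1) show False by simp
  qed
  have fin: "finite ?T"
    using monoid_algebra_carrierD(3)[OF f] monoid_algebra_carrierD(3)[OF g] by simp
  have "?T \<subseteq> carrier M"
    using M monoid_algebra_carrierD(1)[OF f] monoid_algebra_carrierD(1)[OF g]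
    by (auto simp: monoid.m_closed)
  then have "\<forall>a. a \<notin> carrier M \<longrightarrow> (f \<otimes>\<^bsub>monoid_algebra R M\<^esub> g) a = \<zero>"
    using sub by blast
  moreover have "(f \<otimes>\<^bsub>monoid_algebra R M\<^esub> g) c \<in> carrier R" for c
    by (auto simp: monoid_algebra_def intro!: finsum_closed)
  ultimately show "f \<otimes>\<^bsub>monoid_algebra R M\<^esub> g \<in> carrier (monoid_algebra R M)"
    using finite_subset[OF sub fin] by (simp add: monoid_algebra_def)
qed

lemma (in ring) monoid_algebra_mult_weighted:
  assumes f: "f \<in> carrier (monoid_algebra R M)" and g: "g \<in> carrier (monoid_algebra R M)"
    and A: "finite A" "{a. f a \<noteq> \<zero>} \<subseteq> A" and B: "finite B" "{b. g b \<noteq> \<zero>} \<subseteq> B"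
    and D: "finite D" "\<And>a b. a \<in> A \<Longrightarrow> b \<in> B \<Longrightarrow> a \<otimes>\<^bsub>M\<^esub> b \<in> D"
    and \<phi> [simp]: "\<And>d. \<phi> d \<in> carrier R"
  shows "(\<Oplus>d\<in>D. (f \<otimes>\<^bsub>monoid_algebra R M\<^esub> g) d \<otimes> \<phi> d) =
    (\<Oplus>a\<in>A. f a \<otimes> (\<Oplus>b\<in>B. g b \<otimes> \<phi> (a \<otimes>\<^bsub>M\<^esub> b)))"
proof -
  note cl [simp] = monoid_algebra_closed[OF f] monoid_algebra_closed[OF g]
  let ?\<delta> = "\<lambda>a b d. if a \<otimes>\<^bsub>M\<^esub> b = d then \<one> else \<zero>"
  let ?i = "\<lambda>a d. \<Oplus>b\<in>B. g b \<otimes> ?\<delta> a b d"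
  have ic [simp]: "?i a d \<in> carrier R" for a d by (auto intro!: finsum_closed)
  have "(\<Oplus>d\<in>D. (f \<otimes>\<^bsub>monoid_algebra R M\<^esub> g) d \<otimes> \<phi> d) = (\<Oplus>d\<in>D. (\<Oplus>a\<in>A. f a \<otimes> ?i a d) \<otimes> \<phi> d)"
    by (rule finsum_cong') (auto simp: monoid_algebra_mult[OF f g A B] intro!: finsum_closed m_closed)
  also have "\<dots> = (\<Oplus>d\<in>D. \<Oplus>a\<in>A. f a \<otimes> (?i a d \<otimes> \<phi> d))"
    using A by (intro finsum_cong' refl) (auto simp: finsum_ldistr m_assoc Pi_def intro!: finsum_closed m_closed)
  also have "\<dots> = (\<Oplus>a\<in>A. \<Oplus>d\<in>D. f a \<otimes> (?i a d \<otimes> \<phi> d))"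
    using A D by (intro finsum_swap) (auto intro!: m_closed)
  also have "\<dots> = (\<Oplus>a\<in>A. f a \<otimes> (\<Oplus>d\<in>D. ?i a d \<otimes> \<phi> d))"
    using D by (intro finsum_cong' refl) (auto intro!: finsum_rdistr[symmetric] finsum_closed m_closed)
  also have "\<dots> = (\<Oplus>a\<in>A. f a \<otimes> (\<Oplus>b\<in>B. g b \<otimes> \<phi> (a \<otimes>\<^bsub>M\<^esub> b)))"
  proof (rule finsum_cong')
    fix a assume a: "a \<in> A"
    have "(\<Oplus>d\<in>D. ?i a d \<otimes> \<phi> d) = (\<Oplus>d\<in>D. \<Oplus>b\<in>B. g b \<otimes> (?\<delta> a b d \<otimes> \<phi> d))"
    proof (rule finsum_cong')
      fix d
      have "?i a d \<otimes> \<phi> d = (\<Oplus>b\<in>B. (g b \<otimes> ?\<delta> a b d) \<otimes> \<phi> d)"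
        using B by (intro finsum_ldistr) (auto simp del: r_one r_null)
      also have "\<dots> = (\<Oplus>b\<in>B. g b \<otimes> (?\<delta> a b d \<otimes> \<phi> d))"
        by (rule finsum_cong') (auto simp: m_assoc)
      finally show "?i a d \<otimes> \<phi> d = (\<Oplus>b\<in>B. g b \<otimes> (?\<delta> a b d \<otimes> \<phi> d))" .
    qed (auto intro!: finsum_closed)
    also have "\<dots> = (\<Oplus>b\<in>B. \<Oplus>d\<in>D. g b \<otimes> (?\<delta> a b d \<otimes> \<phi> d))"
      using B D by (intro finsum_swap) auto
    also have "\<dots> = (\<Oplus>b\<in>B. g b \<otimes> \<phi> (a \<otimes>\<^bsub>M\<^esub> b))"
    proof (rule finsum_cong')
      fix b assume b: "b \<in> B"
      have "(\<Oplus>d\<in>D. g b \<otimes> (?\<delta> a b d \<otimes> \<phi> d)) =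
          (\<Oplus>d\<in>D. if a \<otimes>\<^bsub>M\<^esub> b = d then g b \<otimes> \<phi> d else \<zero>)"
        by (rule finsum_cong') auto
      also have "\<dots> = g b \<otimes> \<phi> (a \<otimes>\<^bsub>M\<^esub> b)"
        using D a b by (intro add.finprod_singleton) auto
      finally show "(\<Oplus>d\<in>D. g b \<otimes> (?\<delta> a b d \<otimes> \<phi> d)) = g b \<otimes> \<phi> (a \<otimes>\<^bsub>M\<^esub> b)" .
    qed auto
    finally show "f a \<otimes> (\<Oplus>d\<in>D. ?i a d \<otimes> \<phi> d) = f a \<otimes> (\<Oplus>b\<in>B. g b \<otimes> \<phi> (a \<otimes>\<^bsub>M\<^esub> b))"
      by simp
  qed (auto intro!: finsum_closed m_closed)
  finally show ?thesis .
qed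

lemma (in ring) ring_monoid_algebra:
  assumes M: "monoid M"
  shows "ring (monoid_algebra R M)"
proof -
  let ?A = "monoid_algebra R M"
  interpret M: monoid M by fact
  note cl = monoid_algebra_closed[where M = M]
  have fin: "finite {a. f a \<noteq> \<zero>}" if "f \<in> carrier ?A" for f
    using monoid_algebra_carrierD(3) that .
  have add: "(f \<oplus>\<^bsub>?A\<^esub> g) = (\<lambda>a. f a \<oplus> g a)" for f g by (simp add: monoid_algebra_def)
  have zero: "\<zero>\<^bsub>?A\<^esub> = (\<lambda>_. \<zero>)" by (simp add: monoid_algebra_def)
  have one: "\<one>\<^bsub>?A\<^esub> = (\<lambda>a. if a = \<one>\<^bsub>M\<^esub> then \<one> else \<zero>)" by (simp add: monoid_algebra_def)
  have one_fin: "finite {a. (if a = \<one>\<^bsub>M\<^esub> then \<one> else \<zero>) \<noteq> \<zero>}"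
    by (rule finite_subset[of _ "{\<one>\<^bsub>M\<^esub>}"]) auto
  have one_c: "\<one>\<^bsub>?A\<^esub> \<in> carrier ?A" using one_fin by (auto simp: monoid_algebra_def)
  have add_c: "f \<oplus>\<^bsub>?A\<^esub> g \<in> carrier ?A" if f: "f \<in> carrier ?A" and g: "g \<in> carrier ?A" for f g
  proof -
    note [simp] = cl[OF f] cl[OF g] fin[OF f] fin[OF g]
    have "finite {a. f a \<oplus> g a \<noteq> \<zero>}"
      by (rule finite_subset[of _ "{a. f a \<noteq> \<zero>} \<union> {a. g a \<noteq> \<zero>}"]) (use f g in auto)
    then show ?thesis using f g by (auto simp: monoid_algebra_def)
  qed
  note mc = monoid_algebra_mult_closed[OF M]
  show ?thesis
  proof (rule ringI)
    show "abelian_group ?A"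
    proof (rule abelian_groupI)
      fix f assume f: "f \<in> carrier ?A"
      note [simp] = cl[OF f] fin[OF f]
      have "finite {a. \<ominus> f a \<noteq> \<zero>}"
        by (rule finite_subset[of _ "{a. f a \<noteq> \<zero>}"]) (use f in auto)
      then have "(\<lambda>a. \<ominus> f a) \<in> carrier ?A" using f by (auto simp: monoid_algebra_def)
      moreover have "(\<lambda>a. \<ominus> f a) \<oplus>\<^bsub>?A\<^esub> f = \<zero>\<^bsub>?A\<^esub>" using f by (simp add: add zero l_neg)
      ultimately show "\<exists>g \<in> carrier ?A. g \<oplus>\<^bsub>?A\<^esub> f = \<zero>\<^bsub>?A\<^esub>" by blast
    next
      show "\<zero>\<^bsub>?A\<^esub> \<in> carrier ?A" by (simp add: monoid_algebra_def)
    qed (simp_all add: add_c, simp_all add: add zero a_ac cl)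
    show "monoid ?A"
    proof (rule monoidI)
      fix f g h assume f: "f \<in> carrier ?A" and g: "g \<in> carrier ?A" and h: "h \<in> carrier ?A"
      note [simp] = cl[OF f] cl[OF g] cl[OF h] fin[OF f] fin[OF g] fin[OF h]
        cl[OF mc(1)[OF f g]] cl[OF mc(1)[OF g h]]
      let ?F = "{a. f a \<noteq> \<zero>}" and ?G = "{a. g a \<noteq> \<zero>}" and ?H = "{a. h a \<noteq> \<zero>}"
      let ?D = "(\<lambda>(a, b). a \<otimes>\<^bsub>M\<^esub> b) ` (?F \<times> ?G)"
      let ?E = "(\<lambda>(a, b). a \<otimes>\<^bsub>M\<^esub> b) ` (?G \<times> ?H)"
      show "f \<otimes>\<^bsub>?A\<^esub> g \<otimes>\<^bsub>?A\<^esub> h = f \<otimes>\<^bsub>?A\<^esub> (g \<otimes>\<^bsub>?A\<^esub> h)"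
      proof
        fix c
        have fD: "finite ?D" and fE: "finite ?E" using f g h by auto
        have "(f \<otimes>\<^bsub>?A\<^esub> g \<otimes>\<^bsub>?A\<^esub> h) c = (\<Oplus>d\<in>?D. (f \<otimes>\<^bsub>?A\<^esub> g) d \<otimes>
            (\<Oplus>b\<in>?H. h b \<otimes> (if d \<otimes>\<^bsub>M\<^esub> b = c then \<one> else \<zero>)))"
          using h by (intro monoid_algebra_mult mc[OF f g] fD) auto
        also have "\<dots> = (\<Oplus>a\<in>?F. f a \<otimes> (\<Oplus>b\<in>?G. g b \<otimes>
            (\<Oplus>k\<in>?H. h k \<otimes> (if a \<otimes>\<^bsub>M\<^esub> b \<otimes>\<^bsub>M\<^esub> k = c then \<one> else \<zero>))))"
          using f g h fD by (intro monoid_algebra_mult_weighted) (auto intro!: finsum_closed)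
        also have "\<dots> = (\<Oplus>a\<in>?F. f a \<otimes>
            (\<Oplus>e\<in>?E. (g \<otimes>\<^bsub>?A\<^esub> h) e \<otimes> (if a \<otimes>\<^bsub>M\<^esub> e = c then \<one> else \<zero>)))"
        proof (rule finsum_cong')
          fix a assume a: "a \<in> ?F"
          have "(\<Oplus>e\<in>?E. (g \<otimes>\<^bsub>?A\<^esub> h) e \<otimes> (if a \<otimes>\<^bsub>M\<^esub> e = c then \<one> else \<zero>)) =
              (\<Oplus>b\<in>?G. g b \<otimes> (\<Oplus>k\<in>?H. h k \<otimes> (if a \<otimes>\<^bsub>M\<^esub> (b \<otimes>\<^bsub>M\<^esub> k) = c then \<one> else \<zero>)))"
            using g h fE by (intro monoid_algebra_mult_weighted) auto
          also have "\<dots> =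
              (\<Oplus>b\<in>?G. g b \<otimes> (\<Oplus>k\<in>?H. h k \<otimes> (if a \<otimes>\<^bsub>M\<^esub> b \<otimes>\<^bsub>M\<^esub> k = c then \<one> else \<zero>)))"
          proof (rule finsum_cong')
            fix b assume b: "b \<in> ?G"
            have "(\<Oplus>k\<in>?H. h k \<otimes> (if a \<otimes>\<^bsub>M\<^esub> (b \<otimes>\<^bsub>M\<^esub> k) = c then \<one> else \<zero>)) =
                (\<Oplus>k\<in>?H. h k \<otimes> (if a \<otimes>\<^bsub>M\<^esub> b \<otimes>\<^bsub>M\<^esub> k = c then \<one> else \<zero>))"
            proof (rule finsum_cong')
              fix k assume k: "k \<in> ?H"
              have "a \<in> carrier M" "b \<in> carrier M" "k \<in> carrier M"
                using a b k monoid_algebra_carrierD(1)[OF f] monoid_algebra_carrierD(1)[OF g]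
                  monoid_algebra_carrierD(1)[OF h] by auto
              then show "h k \<otimes> (if a \<otimes>\<^bsub>M\<^esub> (b \<otimes>\<^bsub>M\<^esub> k) = c then \<one> else \<zero>) =
                  h k \<otimes> (if a \<otimes>\<^bsub>M\<^esub> b \<otimes>\<^bsub>M\<^esub> k = c then \<one> else \<zero>)"
                by (simp add: M.m_assoc)
            qed auto
            then show "g b \<otimes> (\<Oplus>k\<in>?H. h k \<otimes> (if a \<otimes>\<^bsub>M\<^esub> (b \<otimes>\<^bsub>M\<^esub> k) = c then \<one> else \<zero>)) =
                g b \<otimes> (\<Oplus>k\<in>?H. h k \<otimes> (if a \<otimes>\<^bsub>M\<^esub> b \<otimes>\<^bsub>M\<^esub> k = c then \<one> else \<zero>))"
              by simp
          qed (use g h in \<open>auto intro!: finsum_closed m_closed\<close>)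
          finally show "f a \<otimes> (\<Oplus>b\<in>?G. g b \<otimes>
              (\<Oplus>k\<in>?H. h k \<otimes> (if a \<otimes>\<^bsub>M\<^esub> b \<otimes>\<^bsub>M\<^esub> k = c then \<one> else \<zero>))) =
            f a \<otimes> (\<Oplus>e\<in>?E. (g \<otimes>\<^bsub>?A\<^esub> h) e \<otimes> (if a \<otimes>\<^bsub>M\<^esub> e = c then \<one> else \<zero>))"
            by simp
        qed (use f in \<open>auto intro!: finsum_closed m_closed\<close>)
        also have "\<dots> = (f \<otimes>\<^bsub>?A\<^esub> (g \<otimes>\<^bsub>?A\<^esub> h)) c"
          using f by (intro monoid_algebra_mult[symmetric] mc[OF g h] fE) auto
        finally show "(f \<otimes>\<^bsub>?A\<^esub> g \<otimes>\<^bsub>?A\<^esub> h) c = (f \<otimes>\<^bsub>?A\<^esub> (g \<otimes>\<^bsub>?A\<^esub> h)) c" .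
      qed
    next
      fix f assume f: "f \<in> carrier ?A"
      note [simp] = cl[OF f] fin[OF f]
      let ?F = "{a. f a \<noteq> \<zero>}"
      have car: "a \<in> carrier M" if "a \<in> ?F" for a
        using that monoid_algebra_carrierD(1)[OF f] by auto
      have sel: "(\<Oplus>b\<in>?F. f b \<otimes> (if b = c then \<one> else \<zero>)) = f c" for c
      proof -
        have "(\<Oplus>b\<in>?F. f b \<otimes> (if b = c then \<one> else \<zero>)) =
            (\<Oplus>b\<in>insert c ?F. if b = c then f b else \<zero>)"
          using f by (intro add.finprod_mono_neutral_cong_left) auto
        also have "\<dots> = f c"
          using f by (intro add.finprod_singleton_swap) auto
        finally show ?thesis .
      qed
      show "\<one>\<^bsub>?A\<^esub> \<otimes>\<^bsub>?A\<^esub> f = f"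
      proof
        fix c
        have "(\<one>\<^bsub>?A\<^esub> \<otimes>\<^bsub>?A\<^esub> f) c = (\<Oplus>a\<in>{\<one>\<^bsub>M\<^esub>}. \<one>\<^bsub>?A\<^esub> a \<otimes>
            (\<Oplus>b\<in>?F. f b \<otimes> (if a \<otimes>\<^bsub>M\<^esub> b = c then \<one> else \<zero>)))"
          using f by (intro monoid_algebra_mult one_c) (auto simp: one)
        also have "\<dots> = (\<Oplus>b\<in>?F. f b \<otimes> (if \<one>\<^bsub>M\<^esub> \<otimes>\<^bsub>M\<^esub> b = c then \<one> else \<zero>))"
          using f by (subst finsum_insert) (auto simp: one intro!: finsum_closed)
        also have "\<dots> = (\<Oplus>b\<in>?F. f b \<otimes> (if b = c then \<one> else \<zero>))"
          using f car by (intro finsum_cong') auto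
        finally show "(\<one>\<^bsub>?A\<^esub> \<otimes>\<^bsub>?A\<^esub> f) c = f c" using sel by simp
      qed
      show "f \<otimes>\<^bsub>?A\<^esub> \<one>\<^bsub>?A\<^esub> = f"
      proof
        fix c
        have "(f \<otimes>\<^bsub>?A\<^esub> \<one>\<^bsub>?A\<^esub>) c = (\<Oplus>a\<in>?F. f a \<otimes>
            (\<Oplus>b\<in>{\<one>\<^bsub>M\<^esub>}. \<one>\<^bsub>?A\<^esub> b \<otimes> (if a \<otimes>\<^bsub>M\<^esub> b = c then \<one> else \<zero>)))"
          using f by (intro monoid_algebra_mult one_c) (auto simp: one)
        also have "\<dots> = (\<Oplus>b\<in>?F. f b \<otimes> (if b = c then \<one> else \<zero>))"
          using f car by (intro finsum_cong') (auto simp: one)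
        finally show "(f \<otimes>\<^bsub>?A\<^esub> \<one>\<^bsub>?A\<^esub>) c = f c" using sel by simp
      qed
    qed (simp_all add: mc(1) one_c)
  next
    fix f g h assume f: "f \<in> carrier ?A" and g: "g \<in> carrier ?A" and h: "h \<in> carrier ?A"
    note [simp] = cl[OF f] cl[OF g] cl[OF h] fin[OF f] fin[OF g] fin[OF h]
    let ?F = "{a. f a \<noteq> \<zero>}" and ?G = "{a. g a \<noteq> \<zero>}" and ?H = "{a. h a \<noteq> \<zero>}"
    let ?U = "?F \<union> ?G \<union> ?H"
    note fg = add_c[OF f g]
    have U: "finite ?U" "?F \<subseteq> ?U" "?G \<subseteq> ?U" "?H \<subseteq> ?U" "{a. (f \<oplus>\<^bsub>?A\<^esub> g) a \<noteq> \<zero>} \<subseteq> ?U"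
      using f g h by (auto simp: add)
    let ?\<delta> = "\<lambda>a b c. if a \<otimes>\<^bsub>M\<^esub> b = c then \<one> else \<zero>"
    let ?i = "\<lambda>h a c. \<Oplus>b\<in>?U. h b \<otimes> ?\<delta> a b c"
    have ic: "?i h a c \<in> carrier R" if "h \<in> carrier ?A" for h a c
      using cl[OF that] by (auto intro!: finsum_closed)
    show "(f \<oplus>\<^bsub>?A\<^esub> g) \<otimes>\<^bsub>?A\<^esub> h = f \<otimes>\<^bsub>?A\<^esub> h \<oplus>\<^bsub>?A\<^esub> g \<otimes>\<^bsub>?A\<^esub> h"
    proof
      fix c
      have "((f \<oplus>\<^bsub>?A\<^esub> g) \<otimes>\<^bsub>?A\<^esub> h) c = (\<Oplus>a\<in>?U. (f \<oplus>\<^bsub>?A\<^esub> g) a \<otimes> ?i h a c)"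
        using U by (intro monoid_algebra_mult fg h)
      also have "\<dots> = (\<Oplus>a\<in>?U. f a \<otimes> ?i h a c \<oplus> g a \<otimes> ?i h a c)"
        by (rule finsum_cong') (use f g h ic[OF h] in \<open>auto simp: add l_distr simp del: Un_iff\<close>)
      also have "\<dots> = (\<Oplus>a\<in>?U. f a \<otimes> ?i h a c) \<oplus> (\<Oplus>a\<in>?U. g a \<otimes> ?i h a c)"
        by (rule finsum_addf) (use f g h ic[OF h] in \<open>auto simp del: Un_iff\<close>)
      also have "\<dots> = (f \<otimes>\<^bsub>?A\<^esub> h) c \<oplus> (g \<otimes>\<^bsub>?A\<^esub> h) c"
        using monoid_algebra_mult[OF f h U(1,2) U(1,4)] monoid_algebra_mult[OF g h U(1,3) U(1,4)]
        by simp
      finally show "((f \<oplus>\<^bsub>?A\<^esub> g) \<otimes>\<^bsub>?A\<^esub> h) c = (f \<otimes>\<^bsub>?A\<^esub> h \<oplus>\<^bsub>?A\<^esub> g \<otimes>\<^bsub>?A\<^esub> h) c"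
        by (simp add: add)
    qed
    show "h \<otimes>\<^bsub>?A\<^esub> (f \<oplus>\<^bsub>?A\<^esub> g) = h \<otimes>\<^bsub>?A\<^esub> f \<oplus>\<^bsub>?A\<^esub> h \<otimes>\<^bsub>?A\<^esub> g"
    proof
      fix c
      have i_add: "?i (f \<oplus>\<^bsub>?A\<^esub> g) a c = ?i f a c \<oplus> ?i g a c" for a
      proof -
        have "?i (f \<oplus>\<^bsub>?A\<^esub> g) a c = (\<Oplus>b\<in>?U. f b \<otimes> ?\<delta> a b c \<oplus> g b \<otimes> ?\<delta> a b c)"
          by (rule finsum_cong') (use f g in \<open>auto simp: add\<close>)
        also have "\<dots> = ?i f a c \<oplus> ?i g a c"
          by (rule finsum_addf) (use f g in auto)
        finally show ?thesis .
      qed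
      have "(h \<otimes>\<^bsub>?A\<^esub> (f \<oplus>\<^bsub>?A\<^esub> g)) c = (\<Oplus>a\<in>?U. h a \<otimes> ?i (f \<oplus>\<^bsub>?A\<^esub> g) a c)"
        using U by (intro monoid_algebra_mult fg h)
      also have "\<dots> = (\<Oplus>a\<in>?U. h a \<otimes> ?i f a c \<oplus> h a \<otimes> ?i g a c)"
        unfolding i_add
        by (rule finsum_cong') (use h ic[OF f] ic[OF g] in \<open>auto simp: r_distr simp del: Un_iff\<close>)
      also have "\<dots> = (\<Oplus>a\<in>?U. h a \<otimes> ?i f a c) \<oplus> (\<Oplus>a\<in>?U. h a \<otimes> ?i g a c)"
        by (rule finsum_addf) (use h ic[OF f] ic[OF g] in \<open>auto simp del: Un_iff\<close>)
      also have "\<dots> = (h \<otimes>\<^bsub>?A\<^esub> f) c \<oplus> (h \<otimes>\<^bsub>?A\<^esub> g) c"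
        using monoid_algebra_mult[OF h f U(1,4) U(1,2)] monoid_algebra_mult[OF h g U(1,4) U(1,3)]
        by simp
      finally show "(h \<otimes>\<^bsub>?A\<^esub> (f \<oplus>\<^bsub>?A\<^esub> g)) c = (h \<otimes>\<^bsub>?A\<^esub> f \<oplus>\<^bsub>?A\<^esub> h \<otimes>\<^bsub>?A\<^esub> g) c"
        by (simp add: add)
    qed
  qed
qed


section \<open>Prime ideals and classical Krull dimension of noncommutative rings\<close>

text \<open>The library's \<open>primeideal\<close> is restricted to commutative rings (and is the completely
  prime condition), so primeness is defined here by products of two-sided ideals.\<close>

definition nc_prime_ideal :: "'a set \<Rightarrow> ('a, 'b) ring_scheme \<Rightarrow> bool"
  where "nc_prime_ideal P R \<longleftrightarrow>
    ideal P R \<and> P \<noteq> carrier R \<and>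
    (\<forall>I J. ideal I R \<longrightarrow> ideal J R \<longrightarrow> I \<cdot>\<^bsub>R\<^esub> J \<subseteq> P \<longrightarrow> I \<subseteq> P \<or> J \<subseteq> P)"

text \<open>A chain $P_0 \subset \dots \subset P_n$ has length $n$.\<close>

definition clKdim :: "('a, 'b) ring_scheme \<Rightarrow> enat"
  where "clKdim R = Sup {enat n | n. \<exists>P :: nat \<Rightarrow> 'a set.
    (\<forall>i \<le> n. nc_prime_ideal (P i) R) \<and> (\<forall>i < n. P i \<subset> P (Suc i))}"


section \<open>Invariant subsets and orbit counts\<close>

definition inv_subsets :: "'x set \<Rightarrow> ('x \<times> 'x \<Rightarrow> 'x \<times> 'x) \<Rightarrow> 'x set set"
  where "inv_subsets S r =
    {Z. Z \<subseteq> S \<and> Z \<noteq> {} \<and> Z \<noteq> S \<and> (\<forall>x \<in> S - Z. sigma S r x ` Z = Z)}"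

text \<open>\<open>BijGroup S\<close> consists of extensional functions, hence the \<open>restrict\<close>.\<close>

definition Sigma_group :: "'x set \<Rightarrow> ('x \<times> 'x \<Rightarrow> 'x \<times> 'x) \<Rightarrow> 'x set \<Rightarrow> ('x \<Rightarrow> 'x) monoid"
  where "Sigma_group S r Z = (BijGroup S)
    \<lparr>carrier := generate (BijGroup S) ((\<lambda>x. restrict (sigma S r x) S) ` (S - Z))\<rparr>"

definition orbit_count :: "'x set \<Rightarrow> ('x \<times> 'x \<Rightarrow> 'x \<times> 'x) \<Rightarrow> 'x set \<Rightarrow> nat"
  where "orbit_count S r Z = card (orbits (Sigma_group S r Z) (S - Z) (\<lambda>g. g))"

end

theory Submission
  imports Defs "HOL-Algebra.Subrings" "HOL-Combinatorics.Cycles" "HOL-Library.Multiset_Order"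
begin

text \<open>
  Write \<open>A\<close> for the monoid and \<open>d\<close> for a common exponent of the permutations \<open>\<sigma>\<^sub>z\<close>, so that each
  \<open>z\<^sup>d\<close> is central in \<open>A\<close>.

  Upper bound. Let \<open>P\<^sub>0 \<subset> \<dots> \<subset> P\<^sub>n\<close> be primes of \<open>K[A]\<close> and let \<open>Z\<close> be the set of letters in \<open>P\<^sub>0\<close>.
  Letters are normal, hence regular modulo \<open>P\<^sub>0\<close> outside \<open>Z\<close>; this forces \<open>\<sigma>\<^sub>x(Z) = Z\<close> for
  \<open>x \<notin> Z\<close> and identifies the powers \<open>x\<^sup>d\<close> within each orbit of \<open>X - Z\<close> modulo \<open>P\<^sub>0\<close>. A long word
  contains some letter \<open>d\<close> times, and these occurrences can be collected into a central factor, so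
  modulo \<open>P\<^sub>0\<close> the algebra is a finite module over its centre and the words of length at most \<open>L\<close>
  span a space of dimension \<open>O(L\<^sup>s)\<close>, where \<open>s = s(Z)\<close>. A prime ring that is a finite module over a
  central subring meets that subring in every nonzero ideal (clear denominators in the statement
  that a prime finite-dimensional algebra is simple), so there are central \<open>c\<^sub>i\<close> in
  \<open>P\<^sub>i\<^sub>+\<^sub>1 - P\<^sub>i\<close>. The monomials in \<open>c\<^sub>0, \<dots>, c\<^sub>n\<^sub>-\<^sub>1\<close> are linearly independent modulo \<open>P\<^sub>0\<close>, and
  counting those with bounded exponents gives \<open>n \<le> s\<close>.

  Lower bound. For an admissible \<open>Z\<close>, killing the letters of \<open>Z\<close> and sending every other letter
  to a variable indexed by its orbit maps \<open>K[A]\<close> onto a polynomial ring in \<open>s(Z)\<close> variables;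
  killing the variables one after the other gives a chain of primes of length \<open>s(Z)\<close>.
\<close>

section \<open>Saturated submodules over a central subring\<close>

text \<open>Two central subrings of the monoid algebra take the place of \<open>C\<close>: the
  centre, over which the quotient by a prime is a finite module, and the scalars, over which
  dimensions are counted.\<close>

locale central_subring = ring R for R (structure) +
  fixes C
  assumes sub: "subring C R"
    and central: "\<And>c x. c \<in> C \<Longrightarrow> x \<in> carrier R \<Longrightarrow> c \<otimes> x = x \<otimes> c"
begin

lemma C_carr: "c \<in> C \<Longrightarrow> c \<in> carrier R"
  using subringE(1)[OF sub] by blast

lemma C_one: "\<one> \<in> C" and C_neg: "c \<in> C \<Longrightarrow> \<ominus> c \<in> C"
  and C_mult: "c \<in> C \<Longrightarrow> d \<in> C \<Longrightarrow> c \<otimes> d \<in> C"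
  and C_add: "c \<in> C \<Longrightarrow> d \<in> C \<Longrightarrow> c \<oplus> d \<in> C"
  using subringE[OF sub] by blast+

lemma C_left: "c \<in> C \<Longrightarrow> x \<in> carrier R \<Longrightarrow> y \<in> carrier R \<Longrightarrow> x \<otimes> (c \<otimes> y) = c \<otimes> (x \<otimes> y)"
  using central[of c x] C_carr[of c] by (metis m_assoc)

end

section \<open>Closure properties of two-sided ideals\<close>

lemma (in ring) idealD:
  assumes "ideal P R"
  shows "P \<subseteq> carrier R" "\<zero> \<in> P" "\<And>x y. x \<in> P \<Longrightarrow> y \<in> P \<Longrightarrow> x \<oplus> y \<in> P"
    "\<And>x. x \<in> P \<Longrightarrow> \<ominus> x \<in> P" "\<And>x y. x \<in> P \<Longrightarrow> y \<in> P \<Longrightarrow> x \<ominus> y \<in> P"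
    "\<And>x a. x \<in> carrier R \<Longrightarrow> a \<in> P \<Longrightarrow> x \<otimes> a \<in> P"
    "\<And>x a. x \<in> carrier R \<Longrightarrow> a \<in> P \<Longrightarrow> a \<otimes> x \<in> P"
proof -
  interpret ideal P R by fact
  show "P \<subseteq> carrier R" by (rule a_subset)
  show "\<zero> \<in> P" by (rule zero_closed)
  show "x \<in> P \<Longrightarrow> y \<in> P \<Longrightarrow> x \<oplus> y \<in> P" for x y by (rule a_closed)
  show "x \<in> P \<Longrightarrow> \<ominus> x \<in> P" for x by (rule a_inv_closed)
  then show "x \<in> P \<Longrightarrow> y \<in> P \<Longrightarrow> x \<ominus> y \<in> P" for x y by (simp add: a_minus_def a_closed)
  show "x \<in> carrier R \<Longrightarrow> a \<in> P \<Longrightarrow> x \<otimes> a \<in> P" for x a by (rule I_l_closed)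
  show "x \<in> carrier R \<Longrightarrow> a \<in> P \<Longrightarrow> a \<otimes> x \<in> P" for x a by (rule I_r_closed)
qed

lemma (in ring) ideal_of_closed:
  assumes "P \<subseteq> carrier R" "\<zero> \<in> P" "\<And>x y. x \<in> P \<Longrightarrow> y \<in> P \<Longrightarrow> x \<oplus> y \<in> P"
    "\<And>x a. x \<in> carrier R \<Longrightarrow> a \<in> P \<Longrightarrow> x \<otimes> a \<in> P"
    "\<And>x a. x \<in> carrier R \<Longrightarrow> a \<in> P \<Longrightarrow> a \<otimes> x \<in> P"
  shows "ideal P R"
proof (rule idealI[OF ring_axioms])
  show "subgroup P (add_monoid R)"
  proof (rule add.subgroupI)
    fix a assume a: "a \<in> P"
    \<comment> \<open>Negation is multiplication by -1, so additive inverses come from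
      absorption.\<close>
    then have "(\<ominus> \<one>) \<otimes> a \<in> P" by (intro assms(4)) auto
    then show "\<ominus> a \<in> P" using a assms(1) by (metis l_minus l_one one_closed subsetD)
  qed (use assms in auto)
qed (use assms in auto)

section \<open>Spans modulo an ideal, torsion-free quotients and rank\<close>

context central_subring
begin

text \<open>Spans are taken modulo \<open>P\<close>, so they always contain it.\<close>

primrec cspan :: "'a set \<Rightarrow> 'a list \<Rightarrow> 'a set" where
  "cspan P [] = P"
| "cspan P (w # ws) = {c \<otimes> w \<oplus> x | c x. c \<in> C \<and> x \<in> cspan P ws}"

text \<open>Submodules containing \<open>P\<close> whose quotient is torsion-free for
  \<open>C - P\<close>. If \<open>P\<close> is prime, they are the preimages of the subspaces of the
  localisation of R/P at the image of \<open>C - P\<close>; this keeps the linear algebra over the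
  fraction field inside R.\<close>

definition saturated :: "'a set \<Rightarrow> 'a set \<Rightarrow> bool" where
  "saturated P M \<longleftrightarrow> P \<subseteq> M \<and> M \<subseteq> carrier R \<and> (\<forall>x\<in>M. \<forall>y\<in>M. x \<oplus> y \<in> M) \<and>
    (\<forall>c\<in>C. \<forall>x\<in>M. c \<otimes> x \<in> M) \<and> (\<forall>c\<in>C - P. \<forall>x\<in>carrier R. c \<otimes> x \<in> M \<longrightarrow> x \<in> M)"

text \<open>The number of pivots of \<open>M\<close> in an echelon form relative to the list.\<close>

primrec rk :: "'a set \<Rightarrow> 'a list \<Rightarrow> 'a set \<Rightarrow> nat" where
  "rk P [] M = 0"
| "rk P (w # ws) M = rk P ws M +
     (if \<exists>c\<in>C - P. \<exists>x\<in>cspan P ws. c \<otimes> w \<oplus> x \<in> M then 1 else 0)"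

lemma rk_le_length: "rk P ws M \<le> length ws"
  by (induction ws) auto

lemma rk_mono: "M \<subseteq> M' \<Longrightarrow> rk P ws M \<le> rk P ws M'"
  by (induction ws) (auto intro!: add_mono)

lemma minus_closed_of:
  assumes "M \<subseteq> carrier R" "\<And>x y. x \<in> M \<Longrightarrow> y \<in> M \<Longrightarrow> x \<oplus> y \<in> M"
    "\<And>c x. c \<in> C \<Longrightarrow> x \<in> M \<Longrightarrow> c \<otimes> x \<in> M" "x \<in> M" "y \<in> M"
  shows "x \<ominus> y \<in> M"
proof -
  have "(\<ominus> \<one>) \<otimes> y \<in> M" using assms C_neg[OF C_one] by blast
  moreover have "(\<ominus> \<one>) \<otimes> y = \<ominus> y" using assms by (metis l_minus l_one one_closed subsetD)
  ultimately show ?thesis using assms by (simp add: a_minus_def)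
qed

lemma saturatedD:
  assumes "saturated P M"
  shows "P \<subseteq> M" "M \<subseteq> carrier R" "\<And>x y. x \<in> M \<Longrightarrow> y \<in> M \<Longrightarrow> x \<oplus> y \<in> M"
    "\<And>c x. c \<in> C \<Longrightarrow> x \<in> M \<Longrightarrow> c \<otimes> x \<in> M"
    "\<And>c x. c \<in> C \<Longrightarrow> c \<notin> P \<Longrightarrow> x \<in> carrier R \<Longrightarrow> c \<otimes> x \<in> M \<Longrightarrow> x \<in> M"
    "\<And>x y. x \<in> M \<Longrightarrow> y \<in> M \<Longrightarrow> x \<ominus> y \<in> M"
proof -
  show *: "P \<subseteq> M" "M \<subseteq> carrier R" "\<And>x y. x \<in> M \<Longrightarrow> y \<in> M \<Longrightarrow> x \<oplus> y \<in> M"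
    "\<And>c x. c \<in> C \<Longrightarrow> x \<in> M \<Longrightarrow> c \<otimes> x \<in> M"
    "\<And>c x. c \<in> C \<Longrightarrow> c \<notin> P \<Longrightarrow> x \<in> carrier R \<Longrightarrow> c \<otimes> x \<in> M \<Longrightarrow> x \<in> M"
    using assms by (auto simp: saturated_def)
  show "\<And>x y. x \<in> M \<Longrightarrow> y \<in> M \<Longrightarrow> x \<ominus> y \<in> M"
    by (rule minus_closed_of) (use * in auto)
qed

lemma cspan_closed:
  assumes P: "ideal P R" and ws: "set ws \<subseteq> carrier R"
  shows cspan_carr: "cspan P ws \<subseteq> carrier R" and ideal_subset_cspan: "P \<subseteq> cspan P ws"
    and cspan_add: "\<And>x y. x \<in> cspan P ws \<Longrightarrow> y \<in> cspan P ws \<Longrightarrow> x \<oplus> y \<in> cspan P ws"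
    and cspan_mult: "\<And>c x. c \<in> C \<Longrightarrow> x \<in> cspan P ws \<Longrightarrow> c \<otimes> x \<in> cspan P ws"
proof -
  have "cspan P ws \<subseteq> carrier R \<and> P \<subseteq> cspan P ws \<and>
    (\<forall>x\<in>cspan P ws. \<forall>y\<in>cspan P ws. x \<oplus> y \<in> cspan P ws) \<and>
    (\<forall>c\<in>C. \<forall>x\<in>cspan P ws. c \<otimes> x \<in> cspan P ws)"
    using ws
  proof (induction ws)
    case Nil
    then show ?case using idealD[OF P] C_carr by auto
  next
    case (Cons w ws)
    then have IH: "cspan P ws \<subseteq> carrier R" "P \<subseteq> cspan P ws"
      "\<And>x y. x \<in> cspan P ws \<Longrightarrow> y \<in> cspan P ws \<Longrightarrow> x \<oplus> y \<in> cspan P ws"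
      "\<And>c x. c \<in> C \<Longrightarrow> x \<in> cspan P ws \<Longrightarrow> c \<otimes> x \<in> cspan P ws" and w: "w \<in> carrier R"
      by auto
    have 1: "cspan P (w # ws) \<subseteq> carrier R"
      using IH(1) C_carr w by auto
    have 2: "P \<subseteq> cspan P (w # ws)"
    proof
      fix p assume "p \<in> P"
      then have "p \<in> cspan P ws" "p \<in> carrier R" using IH by auto
      moreover have "p = \<zero> \<otimes> w \<oplus> p" using w calculation by simp
      moreover have "\<zero> \<in> C" using subringE(2)[OF sub] by simp
      ultimately show "p \<in> cspan P (w # ws)" by auto
    qed
    have 3: "x \<oplus> y \<in> cspan P (w # ws)" if xy: "x \<in> cspan P (w # ws)" "y \<in> cspan P (w # ws)" for x y
    proof -
      obtain c x' d y' where *: "x = c \<otimes> w \<oplus> x'" "y = d \<otimes> w \<oplus> y'" "c \<in> C" "d \<in> C"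
        "x' \<in> cspan P ws" "y' \<in> cspan P ws" using xy by auto
      have "x \<oplus> y = (c \<oplus> d) \<otimes> w \<oplus> (x' \<oplus> y')"
        using * C_carr w IH(1) by (auto simp: subset_iff l_distr a_ac)
      moreover have "c \<oplus> d \<in> C" "x' \<oplus> y' \<in> cspan P ws" using * C_add IH(3) by auto
      ultimately show ?thesis unfolding cspan.simps by blast
    qed
    have 4: "c \<otimes> x \<in> cspan P (w # ws)" if c: "c \<in> C" and x: "x \<in> cspan P (w # ws)" for c x
    proof -
      obtain d x' where *: "x = d \<otimes> w \<oplus> x'" "d \<in> C" "x' \<in> cspan P ws" using x by auto
      have "c \<otimes> x = (c \<otimes> d) \<otimes> w \<oplus> c \<otimes> x'"
        using * c C_carr w IH(1) by (auto simp: subset_iff r_distr m_assoc)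
      moreover have "c \<otimes> d \<in> C" "c \<otimes> x' \<in> cspan P ws" using * c C_mult IH(4) by auto
      ultimately show ?thesis unfolding cspan.simps by blast
    qed
    show ?case using 1 2 3 4 by blast
  qed
  then show "cspan P ws \<subseteq> carrier R" "P \<subseteq> cspan P ws"
    "\<And>x y. x \<in> cspan P ws \<Longrightarrow> y \<in> cspan P ws \<Longrightarrow> x \<oplus> y \<in> cspan P ws"
    "\<And>c x. c \<in> C \<Longrightarrow> x \<in> cspan P ws \<Longrightarrow> c \<otimes> x \<in> cspan P ws" by blast+
qed

lemma cspan_minus:
  assumes "ideal P R" "set ws \<subseteq> carrier R" "x \<in> cspan P ws" "y \<in> cspan P ws"
  shows "x \<ominus> y \<in> cspan P ws"
  by (rule minus_closed_of) (use cspan_closed[OF assms(1,2)] assms(3,4) in auto)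

lemma cspan_generator:
  assumes P: "ideal P R" and ws: "set ws \<subseteq> carrier R" and w: "w \<in> set ws" and c: "c \<in> C"
  shows "c \<otimes> w \<in> cspan P ws"
  using ws w
proof (induction ws)
  case (Cons v ws)
  have v: "v \<in> carrier R" "set ws \<subseteq> carrier R" using Cons by auto
  show ?case
  proof (cases "w = v")
    case True
    have "c \<otimes> w = c \<otimes> v \<oplus> \<zero>" using True c C_carr v by simp
    moreover have "\<zero> \<in> cspan P ws" using cspan_closed(2)[OF P v(2)] idealD(2)[OF P] by auto
    ultimately show ?thesis using c by auto
  next
    case False
    then have w: "c \<otimes> w \<in> cspan P ws" using Cons by auto
    then have "c \<otimes> w = \<zero> \<otimes> v \<oplus> c \<otimes> w" using v cspan_closed(1)[OF P v(2)] by auto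
    then show ?thesis using w subringE(2)[OF sub] by auto
  qed
qed simp

lemma cspan_subset:
  assumes "ideal P R" "set vs \<subseteq> carrier R" "set ws \<subseteq> cspan P vs"
  shows "cspan P ws \<subseteq> cspan P vs"
  using assms(3)
proof (induction ws)
  case Nil
  then show ?case using cspan_closed(2)[OF assms(1,2)] by simp
next
  case (Cons w ws)
  then show ?case using cspan_closed(3,4)[OF assms(1,2)] by auto
qed

text \<open>With equal ranks the smaller module has a pivot wherever the larger one has. Subtracting
  a multiple of the pivot element removes the leading term, induction puts the remainder into
  \<open>M\<close>, and saturation cancels the coefficient introduced on the way.\<close>

lemma saturated_eq_of_rk_eq:
  assumes P: "ideal P R" and M: "saturated P M" and M': "saturated P M'" "M \<subseteq> M'"
    and ws: "set ws \<subseteq> carrier R" and rk: "rk P ws M = rk P ws M'"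
  shows "M' \<inter> cspan P ws \<subseteq> M"
  using ws rk
proof (induction ws)
  case Nil
  then show ?case using saturatedD(1)[OF M] by auto
next
  case (Cons w ws)
  note sM = saturatedD[OF M] and sM' = saturatedD[OF M'(1)]
  let ?I = "\<lambda>M. \<exists>c\<in>C - P. \<exists>x\<in>cspan P ws. c \<otimes> w \<oplus> x \<in> M"
  have w: "w \<in> carrier R" and ws: "set ws \<subseteq> carrier R" using Cons.prems by auto
  have mono: "rk P ws M \<le> rk P ws M'" "?I M \<Longrightarrow> ?I M'" using rk_mono M'(2) by blast+
  then have eq: "rk P ws M = rk P ws M'" and I: "?I M' \<Longrightarrow> ?I M"
    using Cons.prems(2) by (auto split: if_splits)
  note IH = Cons.IH[OF ws eq]
  note cs = cspan_closed[OF P ws]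
  show ?case
  proof
    fix x assume x: "x \<in> M' \<inter> cspan P (w # ws)"
    then obtain c x0 where x0: "x = c \<otimes> w \<oplus> x0" "c \<in> C" "x0 \<in> cspan P ws" by auto
    have carr: "c \<in> carrier R" "x0 \<in> carrier R" "x \<in> carrier R"
      using x0 C_carr cs(1) x sM'(2) by auto
    show "x \<in> M"
    proof (cases "c \<in> P")
      case True
      \<comment> \<open>A leading coefficient in \<open>P\<close> contributes nothing modulo
        \<open>P\<close>; without its term the element lies in the shorter span.\<close>
      then have cw: "c \<otimes> w \<in> P" using idealD(7)[OF P] w by auto
      have "x \<ominus> c \<otimes> w \<in> M'" using cw sM' x by auto
      moreover have "x \<ominus> c \<otimes> w = x0" unfolding x0(1) using carr w by algebra
      ultimately have "x0 \<in> M" using IH x0 by auto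
      then show ?thesis using x0(1) cw sM by auto
    next
      case False
      then have "?I M'" using x x0 by auto
      then obtain d x1 where d: "d \<in> C" "d \<notin> P" "x1 \<in> cspan P ws" "d \<otimes> w \<oplus> x1 \<in> M"
        using I by auto
      have carr1: "d \<in> carrier R" "x1 \<in> carrier R" using d C_carr cs(1) by auto
      \<comment> \<open>Cross-multiplication eliminates \<open>w\<close>, since the leading
        coefficients \<open>c\<close> and \<open>d\<close> commute.\<close>
      have "d \<otimes> x \<ominus> c \<otimes> (d \<otimes> w \<oplus> x1) = d \<otimes> x0 \<ominus> c \<otimes> x1 \<oplus> (d \<otimes> c \<ominus> c \<otimes> d) \<otimes> w"
        unfolding x0(1) using carr carr1 w by algebra
      also have "\<dots> = d \<otimes> x0 \<ominus> c \<otimes> x1"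
        using central[OF d(1), of c] carr carr1 w by (simp add: a_minus_def r_neg)
      finally have eq: "d \<otimes> x \<ominus> c \<otimes> (d \<otimes> w \<oplus> x1) = d \<otimes> x0 \<ominus> c \<otimes> x1" .
      have "d \<otimes> x \<ominus> c \<otimes> (d \<otimes> w \<oplus> x1) \<in> M'" using d x x0 sM' M'(2) by auto
      moreover have "d \<otimes> x0 \<ominus> c \<otimes> x1 \<in> cspan P ws"
        using cspan_minus[OF P ws] cs x0 d by auto
      ultimately have "d \<otimes> x \<ominus> c \<otimes> (d \<otimes> w \<oplus> x1) \<in> M" using IH eq by auto
      moreover have "c \<otimes> (d \<otimes> w \<oplus> x1) \<in> M" using d x0 sM(4) by auto
      ultimately have "(d \<otimes> x \<ominus> c \<otimes> (d \<otimes> w \<oplus> x1)) \<oplus> c \<otimes> (d \<otimes> w \<oplus> x1) \<in> M" using sM(3) by blast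
      moreover have "(d \<otimes> x \<ominus> c \<otimes> (d \<otimes> w \<oplus> x1)) \<oplus> c \<otimes> (d \<otimes> w \<oplus> x1) = d \<otimes> x"
        using carr carr1 w by algebra
      ultimately have "d \<otimes> x \<in> M" by simp
      then show ?thesis using sM(5) d carr by blast
    qed
  qed
qed

text \<open>This lets \<open>rk\<close> act as a dimension: minimal and maximal saturated submodules
  can be selected by comparing natural numbers.\<close>

lemma rk_strict_mono:
  assumes "ideal P R" "saturated P M" "saturated P M'" "M \<subset> M'" "set ws \<subseteq> carrier R"
    "M' \<subseteq> cspan P ws"
  shows "rk P ws M < rk P ws M'"
proof -
  have "rk P ws M \<noteq> rk P ws M'"
    using saturated_eq_of_rk_eq[OF assms(1-3) _ assms(5)] assms(4,6) by blast
  then show ?thesis using rk_mono[of M M' P ws] assms(4) by auto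
qed

end


section \<open>Incomparability over the centre\<close>

lemma (in ring) nc_prime_idealD:
  assumes "nc_prime_ideal P R"
  shows "ideal P R" "\<one> \<notin> P"
proof -
  show P: "ideal P R" using assms by (simp add: nc_prime_ideal_def)
  show "\<one> \<notin> P" using assms ideal.one_imp_carrier[OF P] by (auto simp: nc_prime_ideal_def)
qed

text \<open>Let B consist of all y with a R y inside P, and let A be the left annihilator of B
  modulo P. Both are two-sided ideals, their product lies in P, and they contain b and a
  respectively.\<close>

lemma (in ring) nc_prime_ideal_elementwise:
  assumes P: "nc_prime_ideal P R" and ab: "a \<in> carrier R" "b \<in> carrier R"
    and sandwich: "\<And>r. r \<in> carrier R \<Longrightarrow> a \<otimes> (r \<otimes> b) \<in> P"
  shows "a \<in> P \<or> b \<in> P"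
proof -
  have iP: "ideal P R" using P by (simp add: nc_prime_ideal_def)
  note D = idealD[OF iP]
  define B where "B = {y \<in> carrier R. \<forall>r\<in>carrier R. a \<otimes> (r \<otimes> y) \<in> P}"
  define A where "A = {x \<in> carrier R. \<forall>y\<in>B. x \<otimes> y \<in> P}"
  have Bc: "B \<subseteq> carrier R" by (auto simp: B_def)
  have B: "ideal B R"
  proof (rule ideal_of_closed)
    fix x y assume "x \<in> B" "y \<in> B"
    then show "x \<oplus> y \<in> B" using ab D(3) by (auto simp: B_def r_distr)
  next
    fix t y assume t: "t \<in> carrier R" "y \<in> B"
    then have "a \<otimes> (r \<otimes> (t \<otimes> y)) = a \<otimes> ((r \<otimes> t) \<otimes> y)" if "r \<in> carrier R" for r
      using ab that by (auto simp: B_def m_assoc)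
    then show "t \<otimes> y \<in> B" using t by (auto simp: B_def)
    have "a \<otimes> (r \<otimes> (y \<otimes> t)) = a \<otimes> (r \<otimes> y) \<otimes> t" if "r \<in> carrier R" for r
      using ab that t by (auto simp: B_def m_assoc)
    then show "y \<otimes> t \<in> B" using t D(7) by (auto simp: B_def)
  qed (use ab D(2) in \<open>auto simp: B_def\<close>)
  have A: "ideal A R"
  proof (rule ideal_of_closed)
    fix x y assume "x \<in> A" "y \<in> A"
    then show "x \<oplus> y \<in> A" using Bc D(3) by (auto simp: A_def l_distr subset_iff)
  next
    fix t x assume t: "t \<in> carrier R" "x \<in> A"
    then show "t \<otimes> x \<in> A" using Bc D(6) by (auto simp: A_def m_assoc subset_iff)
    have "t \<otimes> y \<in> B" if "y \<in> B" for y using idealD(6)[OF B] t that by blast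
    then show "x \<otimes> t \<in> A" using t Bc by (auto simp: A_def m_assoc subset_iff)
  qed (use Bc D(2) in \<open>auto simp: A_def subset_iff\<close>)
  have "A \<cdot> B \<subseteq> P"
  proof
    fix x assume "x \<in> A \<cdot> B"
    then show "x \<in> P" by induction (use D(3) in \<open>auto simp: A_def\<close>)
  qed
  then have "A \<subseteq> P \<or> B \<subseteq> P" using P A B by (simp add: nc_prime_ideal_def)
  moreover have "a \<otimes> y \<in> P" if "y \<in> B" for y
    using that unfolding B_def by (metis (no_types, lifting) l_one mem_Collect_eq one_closed)
  then have "a \<in> A" using ab by (auto simp: A_def)
  moreover have "b \<in> B" using ab sandwich by (auto simp: B_def)
  ultimately show ?thesis by blast
qed

section \<open>Saturated left ideals modulo a prime\<close>

locale prime_over_central = central_subring +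
  fixes P
  assumes prime: "nc_prime_ideal P R"
begin

lemma P: "ideal P R" and one_notin_P: "\<one> \<notin> P"
  using nc_prime_idealD[OF prime] by blast+

lemmas PD = idealD[OF P]

lemma P_carr: "x \<in> P \<Longrightarrow> x \<in> carrier R" using PD(1) by blast

text \<open>A central c satisfies c r x = r c x, so c R x lies in \<open>P\<close> as soon as c x
  does, and primeness applies.\<close>

lemma regular: 
  assumes "c \<in> C" "c \<notin> P" "x \<in> carrier R" "c \<otimes> x \<in> P"
  shows "x \<in> P"
proof -
  have "c \<otimes> (r \<otimes> x) \<in> P" if "r \<in> carrier R" for r
    using PD(6)[OF that assms(4)] C_left[OF assms(1) that assms(3)] by simp
  then show ?thesis using nc_prime_ideal_elementwise[OF prime C_carr[OF assms(1)] assms(3)] assms(2) by blast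
qed

lemma C_minus_P_mult:
  assumes "c \<in> C" "c \<notin> P" "d \<in> C" "d \<notin> P"
  shows "c \<otimes> d \<in> C" "c \<otimes> d \<notin> P"
  using C_mult regular[OF assms(1,2)] assms C_carr by blast+

text \<open>These are the left ideals of R that correspond to left ideals of the localisation of R/P
  at the image of \<open>C - P\<close>; both containing \<open>P\<close> and saturation are part of
  the notion.\<close>

definition left_ideal :: "'a set \<Rightarrow> bool" where
  "left_ideal L \<longleftrightarrow> saturated P L \<and> (\<forall>r\<in>carrier R. \<forall>x\<in>L. r \<otimes> x \<in> L)"

lemma left_idealD:
  assumes "left_ideal L"
  shows "saturated P L" "\<And>r x. r \<in> carrier R \<Longrightarrow> x \<in> L \<Longrightarrow> r \<otimes> x \<in> L"
  using assms by (auto simp: left_ideal_def)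

lemma left_idealI:
  assumes "\<And>x. x \<in> P \<Longrightarrow> x \<in> M" "M \<subseteq> carrier R" "\<And>x y. x \<in> M \<Longrightarrow> y \<in> M \<Longrightarrow> x \<oplus> y \<in> M"
    "\<And>r x. r \<in> carrier R \<Longrightarrow> x \<in> M \<Longrightarrow> r \<otimes> x \<in> M"
    "\<And>c x. c \<in> C \<Longrightarrow> c \<notin> P \<Longrightarrow> x \<in> carrier R \<Longrightarrow> c \<otimes> x \<in> M \<Longrightarrow> x \<in> M"
  shows "left_ideal M"
  unfolding left_ideal_def saturated_def
proof (intro conjI ballI impI)
  fix c x assume "c \<in> C - P" "x \<in> carrier R" "c \<otimes> x \<in> M"
  then show "x \<in> M" using assms(5) by blast
qed (use assms C_carr in blast)+

text \<open>The kernel modulo \<open>P\<close> of right multiplication by \<open>a\<close> on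
  \<open>L\<close>. It inherits saturation because elements of \<open>C - P\<close> are regular
  modulo \<open>P\<close>.\<close>

lemma left_ideal_annihilator:
  assumes L: "left_ideal L" and a: "a \<in> carrier R"
  shows "left_ideal {x \<in> L. x \<otimes> a \<in> P}"
proof -
  note sL = saturatedD[OF left_idealD(1)[OF L]]
  have Lc: "x \<in> carrier R" if "x \<in> L" for x using sL(2) that by blast
  have 1: "r \<otimes> x \<in> L \<and> r \<otimes> x \<otimes> a \<in> P" if "r \<in> carrier R" "x \<in> L" "x \<otimes> a \<in> P" for r x
    using that left_idealD(2)[OF L] PD(6) Lc a by (simp add: m_assoc)
  have 2: "x \<in> L \<and> x \<otimes> a \<in> P" if "c \<in> C" "c \<notin> P" "x \<in> carrier R" "c \<otimes> x \<in> L" "c \<otimes> x \<otimes> a \<in> P" for c x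
    using that sL(5) regular[of c "x \<otimes> a"] C_carr a by (simp add: m_assoc)
  have 3: "x \<oplus> y \<in> L \<and> (x \<oplus> y) \<otimes> a \<in> P" if "x \<in> L" "x \<otimes> a \<in> P" "y \<in> L" "y \<otimes> a \<in> P" for x y
    using that sL(3) PD(3) Lc a by (simp add: l_distr)
  have 4: "x \<in> L \<and> x \<otimes> a \<in> P" if "x \<in> P" for x using that sL(1) PD(7) a by auto
  show ?thesis
  proof (rule left_idealI)
    show "{x \<in> L. x \<otimes> a \<in> P} \<subseteq> carrier R" using Lc by blast
    fix c x assume "c \<in> C" "c \<notin> P" "x \<in> carrier R" "c \<otimes> x \<in> {x \<in> L. x \<otimes> a \<in> P}"
    then show "x \<in> {x \<in> L. x \<otimes> a \<in> P}" using 2[of c x] by simp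
  qed (simp_all add: 1 3 4)
qed

text \<open>The set is the saturation of H a + P, that is, the preimage of the left ideal of
  fractions with numerators in H a.\<close>

lemma left_ideal_fractions:
  assumes H: "\<And>x y. x \<in> H \<Longrightarrow> y \<in> H \<Longrightarrow> x \<oplus> y \<in> H"
      "\<And>r x. r \<in> carrier R \<Longrightarrow> x \<in> H \<Longrightarrow> r \<otimes> x \<in> H" "H \<subseteq> carrier R" "\<zero> \<in> H"
    and a: "a \<in> carrier R"
  shows "left_ideal {x \<in> carrier R. \<exists>c\<in>C - P. \<exists>h\<in>H. c \<otimes> x \<ominus> h \<otimes> a \<in> P}" (is "left_ideal ?M")
proof -
  have Hc: "h \<in> carrier R" if "h \<in> H" for h using H(3) that by blast
  have 1: "r \<otimes> x \<in> ?M" if r: "r \<in> carrier R" and x: "x \<in> ?M" for r x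
  proof -
    obtain c h where ch: "c \<in> C" "c \<notin> P" "h \<in> H" "c \<otimes> x \<ominus> h \<otimes> a \<in> P" and xc: "x \<in> carrier R"
      using x by auto
    have "c \<otimes> (r \<otimes> x) \<ominus> (r \<otimes> h) \<otimes> a = r \<otimes> (c \<otimes> x) \<ominus> r \<otimes> (h \<otimes> a)"
      using C_left[OF ch(1) r xc] r xc a Hc[OF ch(3)] by (simp add: m_assoc)
    also have "\<dots> = r \<otimes> (c \<otimes> x \<ominus> h \<otimes> a)"
      using r xc a Hc[OF ch(3)] C_carr[OF ch(1)] by algebra
    finally have "c \<otimes> (r \<otimes> x) \<ominus> (r \<otimes> h) \<otimes> a \<in> P" using PD(6) r ch(4) by simp
    then show ?thesis using ch r xc H(2) by blast
  qed
  have 2: "x \<in> ?M" if c: "c \<in> C" "c \<notin> P" and x: "x \<in> carrier R" "c \<otimes> x \<in> ?M" for c x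
  proof -
    obtain d h where dh: "d \<in> C" "d \<notin> P" "h \<in> H" "d \<otimes> (c \<otimes> x) \<ominus> h \<otimes> a \<in> P"
      using x by auto
    have "d \<otimes> (c \<otimes> x) = (d \<otimes> c) \<otimes> x" using c dh C_carr x by (simp add: m_assoc)
    then show ?thesis using dh c x C_minus_P_mult[OF dh(1,2) c] by auto
  qed
  have 3: "x \<oplus> y \<in> ?M" if x: "x \<in> ?M" and y: "y \<in> ?M" for x y
  proof -
    obtain c h where ch: "c \<in> C" "c \<notin> P" "h \<in> H" "c \<otimes> x \<ominus> h \<otimes> a \<in> P" and xc: "x \<in> carrier R"
      using x by auto
    obtain d k where dk: "d \<in> C" "d \<notin> P" "k \<in> H" "d \<otimes> y \<ominus> k \<otimes> a \<in> P" and yc: "y \<in> carrier R"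
      using y by auto
    note carr = C_carr[OF ch(1)] C_carr[OF dk(1)] Hc[OF ch(3)] Hc[OF dk(3)] xc yc a
    have cd: "c \<otimes> d = d \<otimes> c" using central ch dk C_carr by blast
    \<comment> \<open>Addition of fractions: the common denominator is \<open>c \<otimes> d\<close>,
      the new numerator comes from \<open>d \<otimes> h \<oplus> c \<otimes> k\<close>.\<close>
    have "(c \<otimes> d) \<otimes> (x \<oplus> y) = d \<otimes> (c \<otimes> x) \<oplus> c \<otimes> (d \<otimes> y)"
      using carr by (simp add: r_distr cd) (simp flip: m_assoc add: cd)
    then have "(c \<otimes> d) \<otimes> (x \<oplus> y) \<ominus> (d \<otimes> h \<oplus> c \<otimes> k) \<otimes> a = 
        d \<otimes> (c \<otimes> x) \<oplus> c \<otimes> (d \<otimes> y) \<ominus> (d \<otimes> h \<oplus> c \<otimes> k) \<otimes> a" by simp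
    also have "\<dots> = d \<otimes> (c \<otimes> x \<ominus> h \<otimes> a) \<oplus> c \<otimes> (d \<otimes> y \<ominus> k \<otimes> a)"
      using carr by algebra
    finally have "(c \<otimes> d) \<otimes> (x \<oplus> y) \<ominus> (d \<otimes> h \<oplus> c \<otimes> k) \<otimes> a \<in> P"
      using PD(3,6) carr ch(4) dk(4) by simp
    moreover have "d \<otimes> h \<oplus> c \<otimes> k \<in> H" 
      using H(1)[OF H(2)[OF C_carr[OF dk(1)] ch(3)] H(2)[OF C_carr[OF ch(1)] dk(3)]] .
    ultimately show ?thesis using C_minus_P_mult[OF ch(1,2) dk(1,2)] carr by blast
  qed
  have 4: "x \<in> ?M" if x: "x \<in> P" for x
  proof -
    have "\<one> \<otimes> x \<ominus> \<zero> \<otimes> a = x" using P_carr[OF x] a by (simp add: a_minus_def)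
    then have "\<one> \<otimes> x \<ominus> \<zero> \<otimes> a \<in> P" using x by (simp only:)
    then show ?thesis using P_carr[OF x] C_one one_notin_P H(4) by blast
  qed
  show ?thesis
  proof (rule left_idealI)
    show "?M \<subseteq> carrier R" by (rule Collect_subset)
  qed (erule 4, erule (1) 3, erule (1) 1, erule (3) 2)
qed

lemma left_ideal_carrier: "left_ideal (carrier R)"
  unfolding left_ideal_def saturated_def using PD(1) C_carr by auto


text \<open>Over the field of fractions of the image of \<open>C\<close> in \<open>R/P\<close>, this says that a minimal left
  ideal inside \<open>N\<close> contains a nonzero idempotent \<open>f/c\<close> lying in the extension of \<open>I\<close>.\<close>

lemma ex_quasi_idempotent:
  assumes ws: "set ws \<subseteq> carrier R" "carrier R \<subseteq> cspan P ws"
    and I: "ideal I R" "\<not> I \<subseteq> P" and N: "left_ideal N" "\<not> N \<subseteq> P"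
  shows "\<exists>f\<in>N \<inter> I. \<exists>c\<in>C - P. f \<notin> P \<and> f \<otimes> f \<ominus> c \<otimes> f \<in> P"
proof -
  \<comment> \<open>\<open>Q\<close> singles out the saturated left ideals in \<open>N\<close> that
    are nonzero modulo \<open>P\<close>. One of least rank is minimal among them, as a strictly
    smaller one would have smaller rank.\<close>
  define Q where "Q = (\<lambda>L. left_ideal L \<and> \<not> L \<subseteq> P \<and> L \<subseteq> N)"
  have "Q N" using N by (simp add: Q_def)
  then have "Q (ARG_MIN (rk P ws) L. Q L)" "\<forall>M. Q M \<longrightarrow> rk P ws (ARG_MIN (rk P ws) L. Q L) \<le> rk P ws M"
    using arg_min_nat_lemma[of Q N "rk P ws"] by blast+
  then obtain L where L: "left_ideal L" "\<not> L \<subseteq> P" "L \<subseteq> N"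
    and Lmin: "\<And>M. Q M \<Longrightarrow> rk P ws L \<le> rk P ws M" by (auto simp: Q_def)
  note ID = idealD[OF I(1)]
  note sL = saturatedD[OF left_idealD(1)[OF L(1)]]
  have minimal: "M = L" if M: "left_ideal M" "\<not> M \<subseteq> P" "M \<subseteq> L" for M
  proof (rule ccontr)
    assume "M \<noteq> L"
    then have "rk P ws M < rk P ws L"
      using rk_strict_mono[OF P left_idealD(1)[OF M(1)] left_idealD(1)[OF L(1)] _ ws(1)] M(3) sL(2) ws(2) by blast
    then show False using Lmin[of M] M L(3) by (auto simp: Q_def)
  qed
  obtain l i where l: "l \<in> L" "l \<notin> P" and i: "i \<in> I" "i \<notin> P" using L(2) I(2) by blast
  have carr: "l \<in> carrier R" "i \<in> carrier R" using l i sL(2) ID(1) by auto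
  \<comment> \<open>A minimal left ideal of a prime ring is not nilpotent. Elementwise primeness,
    used twice, gives g = i r l and a = r' l with g a outside \<open>P\<close>, and the factor i
    keeps g inside \<open>I\<close>.\<close>
  obtain g a where g: "g \<in> L \<inter> I" and a: "a \<in> L" and ga: "g \<otimes> a \<notin> P"
  proof -
    obtain r where r: "r \<in> carrier R" "i \<otimes> (r \<otimes> l) \<notin> P"
      using nc_prime_ideal_elementwise[OF prime carr(2,1)] i l by blast
    obtain r' where r': "r' \<in> carrier R" "(i \<otimes> (r \<otimes> l)) \<otimes> (r' \<otimes> l) \<notin> P"
      using nc_prime_ideal_elementwise[OF prime _ carr(1), of "i \<otimes> (r \<otimes> l)"] r l carr by blast
    have "i \<otimes> (r \<otimes> l) \<in> L" "r' \<otimes> l \<in> L" using left_idealD(2)[OF L(1)] l r r' carr by auto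
    moreover have "i \<otimes> (r \<otimes> l) \<in> I" using ID(7) i r carr by simp
    ultimately show thesis using that r'(2) by blast
  qed
  have ac: "a \<in> carrier R" and gc: "g \<in> carrier R" using a g sL(2) by auto
  \<comment> \<open>\<open>M\<close> is the saturation of (L \<inter> I) a. It lies in
    \<open>L\<close> and contains g a, so minimality gives \<open>M = L\<close>; then a itself
    belongs to \<open>M\<close>, which yields c a congruent to f a.\<close>
  define M where "M = {x \<in> carrier R. \<exists>c\<in>C - P. \<exists>h\<in>L \<inter> I. c \<otimes> x \<ominus> h \<otimes> a \<in> P}"
  have "left_ideal M" unfolding M_def
    by (rule left_ideal_fractions) (use sL ID left_idealD(2)[OF L(1)] PD(2) ac in auto)
  moreover have "g \<otimes> a \<in> M"
  proof -
    have "\<one> \<otimes> (g \<otimes> a) \<ominus> g \<otimes> a = \<zero>" using gc ac by (simp add: a_minus_def r_neg)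
    then have "\<one> \<otimes> (g \<otimes> a) \<ominus> g \<otimes> a \<in> P" using PD(2) by (simp only:)
    then show ?thesis unfolding M_def using C_one one_notin_P g gc ac by blast
  qed
  moreover have "M \<subseteq> L"
  proof
    fix x assume "x \<in> M"
    then obtain c h where *: "x \<in> carrier R" "c \<in> C" "c \<notin> P" "h \<in> L" "c \<otimes> x \<ominus> h \<otimes> a \<in> P"
      by (auto simp: M_def)
    have hc: "h \<in> carrier R" "c \<in> carrier R" using * sL(2) C_carr by auto
    have "(c \<otimes> x \<ominus> h \<otimes> a) \<oplus> h \<otimes> a \<in> L"
      using * sL(1,3) left_idealD(2)[OF L(1) hc(1) a] by blast
    moreover have "(c \<otimes> x \<ominus> h \<otimes> a) \<oplus> h \<otimes> a = c \<otimes> x" using * hc ac by algebra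
    ultimately have "c \<otimes> x \<in> L" by simp
    then show "x \<in> L" using sL(5) * by blast
  qed
  ultimately have "M = L" using minimal ga by blast
  then obtain c f where c: "c \<in> C" "c \<notin> P" and f: "f \<in> L \<inter> I" and cf: "c \<otimes> a \<ominus> f \<otimes> a \<in> P"
    using a unfolding M_def by blast
  have cc: "c \<in> carrier R" and fc: "f \<in> carrier R" using c f C_carr sL(2) by auto
  \<comment> \<open>The annihilator of a in \<open>L\<close> is proper because of g, hence zero
    modulo \<open>P\<close> by minimality. The element f f - c f annihilates a, so it lies in
    \<open>P\<close>.\<close>
  define K where "K = {x \<in> L. x \<otimes> a \<in> P}"
  have K: "left_ideal K" unfolding K_def by (rule left_ideal_annihilator[OF L(1) ac])
  have "K \<subseteq> P"
  proof (rule ccontr)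
    assume "\<not> K \<subseteq> P"
    then have "K = L" using minimal[OF K] by (auto simp: K_def)
    then show False using g ga by (auto simp: K_def)
  qed
  moreover have "f \<otimes> f \<ominus> c \<otimes> f \<in> K"
  proof -
    have L: "f \<otimes> f \<ominus> c \<otimes> f \<in> L" using left_idealD(2)[OF L(1)] f fc cc sL(6) by auto
    have "(f \<otimes> f \<ominus> c \<otimes> f) \<otimes> a = (f \<otimes> f \<ominus> f \<otimes> c) \<otimes> a" using central[OF c(1) fc] by simp
    also have "\<dots> = \<ominus> (f \<otimes> (c \<otimes> a \<ominus> f \<otimes> a))" using fc cc ac by algebra
    finally have "(f \<otimes> f \<ominus> c \<otimes> f) \<otimes> a \<in> P" using PD(4,6) fc cf by simp
    with L show ?thesis by (simp add: K_def)
  qed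
  \<comment> \<open>If f were in \<open>P\<close>, then so would be c a, hence a and finally g
    a.\<close>
  moreover have "f \<notin> P"
  proof
    assume "f \<in> P"
    then have "(c \<otimes> a \<ominus> f \<otimes> a) \<oplus> f \<otimes> a \<in> P" using PD(3,7) cf ac by simp
    moreover have "(c \<otimes> a \<ominus> f \<otimes> a) \<oplus> f \<otimes> a = c \<otimes> a" using cc fc ac by algebra
    ultimately have "a \<in> P" using regular c ac by simp
    then show False using ga PD(6) gc by blast
  qed
  ultimately show ?thesis using f L(3) c by blast
qed

text \<open>After localisation R/P is a prime finite-dimensional algebra, where a nonzero ideal must
  contain 1. Concretely, among the elements y congruent modulo \<open>I\<close> to some c in
  \<open>C - P\<close>, one with largest left annihilator is shown to lie in \<open>P\<close>; this
  puts c into \<open>I\<close>. Otherwise a quasi-idempotent of \<open>I\<close> would enlarge the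
  annihilator.\<close>

theorem ex_central_in_larger_ideal:
  assumes ws: "set ws \<subseteq> carrier R" "carrier R \<subseteq> cspan P ws"
    and I: "ideal I R" "P \<subset> I"
  shows "\<exists>c\<in>C. c \<in> I \<and> c \<notin> P"
proof -
  note ID = idealD[OF I(1)]
  define Y where "Y = (\<lambda>y. y \<in> carrier R \<and> (\<exists>c\<in>C - P. c \<ominus> y \<in> I))"
  define Ann where "Ann = (\<lambda>y. {x \<in> carrier R. x \<otimes> y \<in> P})"
  have left_Ann: "left_ideal (Ann y)" if "y \<in> carrier R" for y
    unfolding Ann_def using left_ideal_annihilator[OF left_ideal_carrier that] by simp
  have Y1: "Y \<one>"
  proof -
    have "\<one> \<ominus> \<one> = \<zero>" by (simp add: a_minus_def r_neg)
    then have "\<one> \<ominus> \<one> \<in> I" using ID(2) by (simp only:)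
    then show ?thesis unfolding Y_def using C_one one_notin_P by blast
  qed
  \<comment> \<open>Ranks never exceed the length of \<open>ws\<close>, so the maximum
    exists.\<close>
  obtain y where y: "Y y" and max: "\<And>z. Y z \<Longrightarrow> rk P ws (Ann z) \<le> rk P ws (Ann y)"
    using ex_has_greatest_nat[of Y \<one> "\<lambda>y. rk P ws (Ann y)" "Suc (length ws)"] Y1 rk_le_length[of P ws]
    by (metis le_imp_less_Suc)
  obtain c where yc: "y \<in> carrier R" and c: "c \<in> C" "c \<notin> P" "c \<ominus> y \<in> I" using y by (auto simp: Y_def)
  have cc: "c \<in> carrier R" using c C_carr by blast
  have "y \<in> P"
  proof (rule ccontr)
    assume yP: "y \<notin> P"
    \<comment> \<open>The saturation of R y + P, which is nonzero modulo \<open>P\<close> because it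
      contains y.\<close>
    define N where "N = {x \<in> carrier R. \<exists>c\<in>C - P. \<exists>h\<in>carrier R. c \<otimes> x \<ominus> h \<otimes> y \<in> P}"
    have N: "left_ideal N" unfolding N_def by (rule left_ideal_fractions) (use yc in auto)
    have "\<one> \<otimes> y \<ominus> \<one> \<otimes> y = \<zero>" using yc by (simp add: a_minus_def r_neg)
    then have "\<one> \<otimes> y \<ominus> \<one> \<otimes> y \<in> P" using PD(2) by (simp only:)
    then have "y \<in> N" unfolding N_def using C_one one_notin_P yc by blast
    then obtain f d where f: "f \<in> N" "f \<in> I" "f \<notin> P" and d: "d \<in> C" "d \<notin> P"
      and ff: "f \<otimes> f \<ominus> d \<otimes> f \<in> P"
      using ex_quasi_idempotent[OF ws I(1) _ N] I(2) yP by blast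
    obtain e r where e: "e \<in> C" "e \<notin> P" and r: "r \<in> carrier R" and er: "e \<otimes> f \<ominus> r \<otimes> y \<in> P"
      and fc: "f \<in> carrier R"
      using f(1) by (auto simp: N_def)
    have dc: "d \<in> carrier R" and ec: "e \<in> carrier R" using d e C_carr by auto
    define z where "z = y \<otimes> (d \<ominus> f)"
    have zc: "z \<in> carrier R" using yc dc fc by (simp add: z_def)
    have "Y z"
    proof -
      \<comment> \<open>Both summands lie in \<open>I\<close>, one through c - y and one through f;
        hence z is an admissible element with \<open>c \<otimes> d\<close> in place of c.\<close>
      have "(c \<ominus> y) \<otimes> d \<oplus> y \<otimes> f \<in> I" using ID(3,6,7) c(3) dc yc f(2) by simp
      moreover have "(c \<ominus> y) \<otimes> d \<oplus> y \<otimes> f = c \<otimes> d \<ominus> z" unfolding z_def using cc yc dc fc by algebra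
      ultimately have "c \<otimes> d \<ominus> z \<in> I" by simp
      then show ?thesis unfolding Y_def using zc C_minus_P_mult[OF c(1,2) d] by blast
    qed
    moreover have "Ann y \<subset> Ann z"
    proof
      show "Ann y \<subseteq> Ann z"
      proof
        fix x assume "x \<in> Ann y"
        then have x: "x \<in> carrier R" "x \<otimes> y \<otimes> (d \<ominus> f) \<in> P" using PD(7) dc fc by (auto simp: Ann_def)
        moreover have "x \<otimes> y \<otimes> (d \<ominus> f) = x \<otimes> z" unfolding z_def using x yc dc fc by (simp add: m_assoc)
        ultimately show "x \<in> Ann z" by (simp add: Ann_def)
      qed
      \<comment> \<open>Modulo \<open>P\<close>, r y is e f, so r z is e f (d - f), which vanishes
        as f f is congruent to d f. Since e f is not in \<open>P\<close>, r belongs to the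
        annihilator of z but not to that of y.\<close>
      have "r \<otimes> z \<in> P"
      proof -
        have "\<ominus> (e \<otimes> (f \<otimes> f \<ominus> d \<otimes> f)) \<ominus> (e \<otimes> f \<ominus> r \<otimes> y) \<otimes> (d \<ominus> f) \<in> P"
          using PD ff er ec dc fc by simp
        moreover have "\<ominus> (e \<otimes> (f \<otimes> f \<ominus> f \<otimes> d)) \<ominus> (e \<otimes> f \<ominus> r \<otimes> y) \<otimes> (d \<ominus> f) = r \<otimes> z"
          unfolding z_def using r yc ec dc fc by algebra
        ultimately show ?thesis using central[OF d(1) fc] by simp
      qed
      moreover have "r \<otimes> y \<notin> P"
      proof
        assume "r \<otimes> y \<in> P"
        then have "(e \<otimes> f \<ominus> r \<otimes> y) \<oplus> r \<otimes> y \<in> P" using PD(3) er by blast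
        moreover have "(e \<otimes> f \<ominus> r \<otimes> y) \<oplus> r \<otimes> y = e \<otimes> f" using ec fc r yc by algebra
        ultimately show False using regular e fc f(3) by auto
      qed
      ultimately show "Ann y \<noteq> Ann z" using r by (auto simp: Ann_def)
    qed
    then have "rk P ws (Ann y) < rk P ws (Ann z)"
      using rk_strict_mono[OF P left_idealD(1)[OF left_Ann[OF yc]] left_idealD(1)[OF left_Ann[OF zc]]]
        ws saturatedD(2)[OF left_idealD(1)[OF left_Ann[OF zc]]] by blast
    ultimately show False using max[of z] by simp
  qed
  then have "(c \<ominus> y) \<oplus> y \<in> I" using ID(3) c(3) I(2) by blast
  moreover have "(c \<ominus> y) \<oplus> y = c" using cc yc by algebra
  ultimately show ?thesis using c by auto
qed

end


section \<open>Counting independent products along a chain of primes\<close>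

lemma nat_degree_le_of_powers_le:
  fixes n s N K :: nat
  assumes "\<And>b. (b + 1) ^ n \<le> N * (K * b + 1) ^ s"
  shows "n \<le> s"
proof (rule ccontr)
  assume "\<not> n \<le> s"
  then have n: "s + 1 \<le> n" by simp
  \<comment> \<open>This value of b absorbs the constant: the right-hand side becomes at most b (b +
    1)^s, against at least (b + 1)^(s + 1) on the left.\<close>
  define b where "b = N * (K + 1) ^ s"
  have "(b + 1) ^ s * (b + 1) = (b + 1) ^ (s + 1)" by simp
  also have "\<dots> \<le> (b + 1) ^ n" using n by (intro power_increasing) auto
  also have "\<dots> \<le> N * (K * b + 1) ^ s" by (rule assms)
  also have "\<dots> \<le> N * ((K + 1) * (b + 1)) ^ s" by (intro mult_left_mono power_mono) auto
  also have "\<dots> = b * (b + 1) ^ s" unfolding b_def by (simp only: power_mult_distrib mult.assoc)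
  finally have "(b + 1) * (b + 1) ^ s \<le> b * (b + 1) ^ s" by (simp only: mult.commute)
  then show False by simp
qed

definition (in ring) centre :: "'a set" where
  "centre = {c \<in> carrier R. \<forall>x\<in>carrier R. c \<otimes> x = x \<otimes> c}"

lemma (in ring) central_subring_centre: "central_subring R centre"
proof (intro central_subring.intro central_subring_axioms.intro ring_axioms)
  show "subring centre R"
  proof (rule subringI)
    fix c d assume cd: "c \<in> centre" "d \<in> centre"
    then have carr: "c \<in> carrier R" "d \<in> carrier R"
      and comm: "\<And>x. x \<in> carrier R \<Longrightarrow> c \<otimes> x = x \<otimes> c" "\<And>x. x \<in> carrier R \<Longrightarrow> d \<otimes> x = x \<otimes> d"
      by (auto simp: centre_def)
    have "c \<otimes> d \<otimes> x = x \<otimes> (c \<otimes> d)" if "x \<in> carrier R" for x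
    proof -
      have "c \<otimes> d \<otimes> x = c \<otimes> x \<otimes> d" using carr comm(2) that by (simp add: m_assoc)
      then show ?thesis using carr comm(1)[OF that] that by (simp add: m_assoc)
    qed
    then show "c \<otimes> d \<in> centre" using carr by (simp add: centre_def)
    show "c \<oplus> d \<in> centre" using cd by (auto simp: centre_def l_distr r_distr)
  qed (auto simp: centre_def l_minus r_minus)
qed (auto simp: centre_def)

section \<open>Independence modulo an ideal and monomials in central elements\<close>

context central_subring
begin

text \<open>Triangular form of linear independence modulo \<open>P\<close>. If \<open>C\<close> is a
  field meeting \<open>P\<close> only in zero, it is ordinary linear independence of the images in
  R/P.\<close>

primrec cindep :: "'a set \<Rightarrow> 'a list \<Rightarrow> bool" where
  "cindep P [] \<longleftrightarrow> True"
| "cindep P (v # vs) \<longleftrightarrow> cindep P vs \<and> (\<forall>k\<in>C - P. k \<otimes> v \<notin> cspan P vs)"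

text \<open>Serves to pass to a larger ideal \<open>Q\<close>: vectors that already lie in
  \<open>Q\<close> drop out of the span.\<close>

lemma cspan_mono:
  assumes "ideal Q R" "set vs \<subseteq> carrier R" "P \<subseteq> Q" "set us \<subseteq> Q \<union> cspan Q vs"
  shows "cspan P us \<subseteq> cspan Q vs"
  using assms(4)
proof (induction us)
  case Nil
  then show ?case using cspan_closed(2)[OF assms(1,2)] assms(3) by auto
next
  case (Cons u us)
  then have "u \<in> cspan Q vs" using cspan_closed(2)[OF assms(1,2)] by auto
  then show ?case using cspan_closed(3,4)[OF assms(1,2)] Cons by auto
qed

lemma cspan_map_mult:
  assumes P: "ideal P R" and c: "c \<in> carrier R" "\<And>x. x \<in> carrier R \<Longrightarrow> c \<otimes> x = x \<otimes> c"
    and vs: "set vs \<subseteq> carrier R"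
    and y: "y \<in> cspan P (map ((\<otimes>) c) vs)"
  shows "\<exists>z\<in>cspan P vs. \<exists>p\<in>P. y = c \<otimes> z \<oplus> p"
  using vs y
proof (induction vs arbitrary: y)
  case Nil
  then have "y = c \<otimes> \<zero> \<oplus> y" using c idealD(1)[OF P] by auto
  then show ?case using Nil idealD(2)[OF P] by auto
next
  case (Cons v vs)
  then have v: "v \<in> carrier R" "set vs \<subseteq> carrier R" by auto
  from Cons.prems obtain k x where k: "k \<in> C" and x: "x \<in> cspan P (map ((\<otimes>) c) vs)"
    and y: "y = k \<otimes> (c \<otimes> v) \<oplus> x" by auto
  obtain z p where z: "z \<in> cspan P vs" and p: "p \<in> P" and xz: "x = c \<otimes> z \<oplus> p"
    using Cons.IH[OF v(2) x] by blast
  have carr: "z \<in> carrier R" "p \<in> carrier R" "k \<in> carrier R"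
    using z p cspan_closed(1)[OF P v(2)] idealD(1)[OF P] C_carr[OF k] by auto
  have "y = c \<otimes> (k \<otimes> v \<oplus> z) \<oplus> p"
    unfolding y xz using carr c(1) v C_left[OF k c(1) v(1)] by (simp add: r_distr a_assoc)
  moreover have "k \<otimes> v \<oplus> z \<in> cspan P (v # vs)" using k z by auto
  ultimately show ?case using p by blast
qed

text \<open>Multiplication by a central element that is regular modulo \<open>P\<close> is an
  injective \<open>C\<close>-linear map of R/P.\<close>

lemma independent_map_mult:
  assumes P: "ideal P R" and c: "c \<in> carrier R" "\<And>x. x \<in> carrier R \<Longrightarrow> c \<otimes> x = x \<otimes> c"
    and reg: "\<And>x. x \<in> carrier R \<Longrightarrow> c \<otimes> x \<in> P \<Longrightarrow> x \<in> P"
    and vs: "set vs \<subseteq> carrier R" "cindep P vs"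
  shows "cindep P (map ((\<otimes>) c) vs)"
  using vs
proof (induction vs)
  case (Cons v vs)
  then have v: "v \<in> carrier R" "set vs \<subseteq> carrier R" by auto
  have "k \<otimes> (c \<otimes> v) \<notin> cspan P (map ((\<otimes>) c) vs)" if k: "k \<in> C" "k \<notin> P" for k
  proof
    assume "k \<otimes> (c \<otimes> v) \<in> cspan P (map ((\<otimes>) c) vs)"
    then obtain z p where z: "z \<in> cspan P vs" and p: "p \<in> P" and eq: "k \<otimes> (c \<otimes> v) = c \<otimes> z \<oplus> p"
      using cspan_map_mult[OF P c v(2)] by blast
    have carr: "z \<in> carrier R" "p \<in> carrier R" "k \<in> carrier R"
      using z p cspan_closed(1)[OF P v(2)] idealD(1)[OF P] C_carr[OF k(1)] by auto
    have "c \<otimes> (k \<otimes> v \<ominus> z) = c \<otimes> (k \<otimes> v) \<ominus> c \<otimes> z" using carr c(1) v(1) by algebra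
    also have "\<dots> = (c \<otimes> z \<oplus> p) \<ominus> c \<otimes> z" using eq C_left[OF k(1) c(1) v(1)] by simp
    also have "\<dots> = p" using carr c(1) by algebra
    finally have "k \<otimes> v \<ominus> z \<in> P" using reg[of "k \<otimes> v \<ominus> z"] p carr v by simp
    then have "(k \<otimes> v \<ominus> z) \<oplus> z \<in> cspan P vs" using cspan_closed(2,3)[OF P v(2)] z by blast
    moreover have "(k \<otimes> v \<ominus> z) \<oplus> z = k \<otimes> v" using carr v(1) by algebra
    ultimately show False using Cons.prems(2) k by auto
  qed
  then show ?case using Cons by auto
qed simp

text \<open>Modulo \<open>Q\<close> the block multiplied by c vanishes, so a relation headed by a
  vector of \<open>us\<close> would be a relation modulo \<open>Q\<close> among \<open>us\<close>
  alone; its coefficient stays outside \<open>Q\<close> because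
  \<open>C \<inter> Q \<subseteq> P\<close>.\<close>

lemma independent_append_mult:
  assumes P: "ideal P R" and Q: "ideal Q R" "P \<subseteq> Q" "C \<inter> Q \<subseteq> P"
    and c: "c \<in> Q" "\<And>x. x \<in> carrier R \<Longrightarrow> c \<otimes> x = x \<otimes> c"
    and reg: "\<And>x. x \<in> carrier R \<Longrightarrow> c \<otimes> x \<in> P \<Longrightarrow> x \<in> P"
    and us: "set us \<subseteq> carrier R" "cindep Q us"
    and vs: "set vs \<subseteq> carrier R" "cindep P vs"
  shows "cindep P (us @ map ((\<otimes>) c) vs)"
  using us
proof (induction us)
  case Nil
  then show ?case using independent_map_mult[OF P _ c(2) reg vs] c(1) idealD(1)[OF Q(1)] by auto
next
  case (Cons u us)
  then have us: "u \<in> carrier R" "set us \<subseteq> carrier R" by auto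
  have "set us \<subseteq> cspan Q us"
    using cspan_generator[OF Q(1) us(2) _ C_one] us(2) by (force simp: subset_iff)
  moreover have "c \<otimes> v \<in> Q" if "v \<in> set vs" for v using idealD(7)[OF Q(1)] c(1) vs(1) that by blast
  ultimately have "cspan P (us @ map ((\<otimes>) c) vs) \<subseteq> cspan Q us"
    by (intro cspan_mono Q us(2)) auto
  then show ?case using Cons Q(3) by auto
qed

text \<open>Each vector of an independent list strictly enlarges the span of the later ones. The
  spans are saturated, so the rank grows by at least one each time, and \<open>length ts\<close>
  bounds it.\<close>

lemma length_le_of_independent:
  assumes P: "ideal P R" and sat: "\<And>vs. set vs \<subseteq> carrier R \<Longrightarrow> saturated P (cspan P vs)"
    and ts: "set ts \<subseteq> carrier R" and vs: "set vs \<subseteq> cspan P ts" "cindep P vs"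
    and one: "\<one> \<notin> P"
  shows "length vs \<le> length ts"
proof -
  have "length vs \<le> rk P ts (cspan P vs)"
    using vs
  proof (induction vs)
    case (Cons v vs)
    have carr: "set (v # vs) \<subseteq> carrier R" using Cons.prems(1) cspan_closed(1)[OF P ts] by blast
    then have carr': "set vs \<subseteq> carrier R" by simp
    have v: "v \<in> cspan P (v # vs)" using cspan_generator[OF P carr _ C_one, of v] carr by simp
    have "\<one> \<otimes> v \<notin> cspan P vs" using Cons.prems(2) C_one one by simp
    then have "v \<notin> cspan P vs" using carr by simp
    moreover have "cspan P vs \<subseteq> cspan P (v # vs)"
    proof (rule cspan_subset[OF P carr])
      show "set vs \<subseteq> cspan P (v # vs)"
        using cspan_generator[OF P carr _ C_one] carr by (force simp: subset_iff simp del: cspan.simps)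
    qed
    ultimately have "cspan P vs \<subset> cspan P (v # vs)" using v by blast
    then have "rk P ts (cspan P vs) < rk P ts (cspan P (v # vs))"
      using rk_strict_mono[OF P sat[OF carr'] sat[OF carr] _ ts] cspan_subset[OF P ts Cons.prems(1)] by blast
    then show ?case using Cons by auto
  qed simp
  then show ?thesis using rk_le_length[of P ts] by (rule order_trans)
qed

text \<open>The list consists of the monomials in \<open>c 0\<close>, ..., \<open>c (n - 1)\<close>
  with all exponents at most b. The monomials in \<open>c j\<close>, ..., \<open>c (n - 1)\<close>
  are independent already modulo \<open>P j\<close>, and \<open>V\<close> records their
  degrees.\<close>

lemma independent_prime_chain:
  assumes P: "\<And>i. i \<le> n \<Longrightarrow> ideal (P i) R" "\<And>i. i < n \<Longrightarrow> P i \<subseteq> P (Suc i)" "\<one> \<notin> P n"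
    and F: "\<And>i. i \<le> n \<Longrightarrow> C \<inter> P i \<subseteq> {\<zero>}"
    and c: "\<And>i. i < n \<Longrightarrow> c i \<in> P (Suc i)" "\<And>i x. i < n \<Longrightarrow> x \<in> carrier R \<Longrightarrow> c i \<otimes> x = x \<otimes> c i"
    and reg: "\<And>i x. i < n \<Longrightarrow> x \<in> carrier R \<Longrightarrow> c i \<otimes> x \<in> P i \<Longrightarrow> x \<in> P i"
    and V: "\<And>a. V a \<subseteq> carrier R" "\<And>a b x y. x \<in> V a \<Longrightarrow> y \<in> V b \<Longrightarrow> x \<otimes> y \<in> V (a + b)"
      "\<one> \<in> V 0" "\<And>a b. a \<le> b \<Longrightarrow> V a \<subseteq> V b" and cV: "\<And>i. i < n \<Longrightarrow> c i \<in> V l"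
  shows "\<exists>vs. set vs \<subseteq> V (l * b * n) \<and> length vs = (b + 1) ^ n \<and> cindep (P 0) vs"
proof -
  have "\<exists>vs. set vs \<subseteq> V (l * b * (n - j)) \<and> length vs = (b + 1) ^ (n - j) \<and> cindep (P j) vs"
    if "j \<le> n" for j
    using that
  \<comment> \<open>Downward induction starting at n, where 1 is the only monomial.\<close>
  proof (induction j rule: inc_induct)
    case base
    have "k = \<zero>" if "k \<in> C" "k \<otimes> \<one> \<in> P n" for k using F[of n] that C_carr by auto
    moreover have "\<zero> \<in> P n" using idealD(2)[OF P(1)[of n]] by simp
    ultimately have "cindep (P n) [\<one>]" by auto
    then show ?case using V(3) by (intro exI[of _ "[\<one>]"]) auto
  next
    case (step j)
    obtain us where us: "set us \<subseteq> V (l * b * (n - Suc j))" "length us = (b + 1) ^ (n - Suc j)"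
      "cindep (P (Suc j)) us" using step by blast
    have j: "j < n" using step by simp
    have ideals: "ideal (P j) R" "ideal (P (Suc j)) R" using P(1) j by auto
    have CP: "C \<inter> P (Suc j) \<subseteq> P j" using F[of "Suc j"] j idealD(2)[OF ideals(1)] by auto
    \<comment> \<open>The inner induction raises the largest exponent e of \<open>c j\<close>:
      multiplying the list by \<open>c j\<close> shifts the exponents to 1, ..., e + 1, and
      \<open>us\<close> supplies exponent 0 again.\<close>
    have "\<exists>vs. set vs \<subseteq> V (l * e + l * b * (n - Suc j)) \<and> length vs = (e + 1) * (b + 1) ^ (n - Suc j) \<and>
        cindep (P j) vs" for e
    proof (induction e)
      case 0
      have "cindep (P j) (us @ map ((\<otimes>) (c j)) [])"
        by (rule independent_append_mult[OF ideals P(2)[OF j] CP c(1)[OF j] c(2)[OF j] reg[OF j]])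
          (use us V(1) in auto)
      then show ?case using us by (intro exI[of _ us]) auto
    next
      case (Suc e)
      then obtain vs where vs: "set vs \<subseteq> V (l * e + l * b * (n - Suc j))"
        "length vs = (e + 1) * (b + 1) ^ (n - Suc j)" "cindep (P j) vs" by blast
      have "cindep (P j) (us @ map ((\<otimes>) (c j)) vs)"
        by (rule independent_append_mult[OF ideals P(2)[OF j] CP c(1)[OF j] c(2)[OF j] reg[OF j]])
          (use us vs V(1) in auto)
      moreover have "c j \<otimes> v \<in> V (l * Suc e + l * b * (n - Suc j))" if "v \<in> set vs" for v
        using V(2)[OF cV[OF j], of v "l * e + l * b * (n - Suc j)"] vs(1) that by (auto simp: algebra_simps)
      moreover have "V (l * b * (n - Suc j)) \<subseteq> V (l * Suc e + l * b * (n - Suc j))"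
        by (rule V(4)) simp
      ultimately show ?case using us vs
        by (intro exI[of _ "us @ map ((\<otimes>) (c j)) vs"]) (auto simp: algebra_simps)
    qed
    from this[of b] obtain vs where vs: "set vs \<subseteq> V (l * b + l * b * (n - Suc j))"
      "length vs = (b + 1) * (b + 1) ^ (n - Suc j)" "cindep (P j) vs" by blast
    have "n - j = Suc (n - Suc j)" using j by simp
    then show ?case using vs by (intro exI[of _ vs]) (auto simp: algebra_simps)
  qed
  from this[of 0] show ?thesis by simp
qed

end

text \<open>Finiteness over the centre supplies central elements between consecutive primes; the
  field \<open>F\<close> measures dimensions. Monomials with exponents at most b give (b + 1)^n
  independent vectors in a filtration step linear in b, whose dimension modulo \<open>P 0\<close>
  grows at most with degree s.\<close>

theorem (in ring) prime_chain_length_le: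
  assumes F: "central_subring R F" "\<And>k. k \<in> F \<Longrightarrow> k \<noteq> \<zero> \<Longrightarrow> \<exists>h\<in>F. h \<otimes> k = \<one>"
    and P: "\<And>i. i \<le> n \<Longrightarrow> nc_prime_ideal (P i) R" "\<And>i. i < n \<Longrightarrow> P i \<subset> P (Suc i)"
    and ws: "set ws \<subseteq> carrier R" "carrier R \<subseteq> central_subring.cspan R centre (P 0) ws"
    and V: "\<And>a. V a \<subseteq> carrier R" "\<And>a b x y. x \<in> V a \<Longrightarrow> y \<in> V b \<Longrightarrow> x \<otimes> y \<in> V (a + b)"
      "\<one> \<in> V 0" "\<And>a b. a \<le> b \<Longrightarrow> V a \<subseteq> V b" "carrier R \<subseteq> (\<Union>a. V a)"
    and ts: "\<And>a. set (ts a) \<subseteq> carrier R" "\<And>a. V a \<subseteq> central_subring.cspan R F (P 0) (ts a)"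
      "\<And>a. length (ts a) \<le> N * (a + 1) ^ s"
  shows "n \<le> s"
proof -
  interpret F: central_subring R F by fact
  interpret Z: central_subring R centre by (rule central_subring_centre)
  have ideals: "ideal (P i) R" "\<one> \<notin> P i" if "i \<le> n" for i using nc_prime_idealD[OF P(1)[OF that]] by auto
  have P0: "P 0 \<subseteq> P i" if "i \<le> n" for i
    using that
  proof (induction i)
    case (Suc i)
    then show ?case using P(2)[of i] by auto
  qed simp
  have FP: "F \<inter> P i \<subseteq> {\<zero>}" if "i \<le> n" for i
  proof (rule ccontr)
    assume "\<not> F \<inter> P i \<subseteq> {\<zero>}"
    then obtain k where k: "k \<in> F" "k \<in> P i" "k \<noteq> \<zero>" by blast
    then obtain h where "h \<in> F" "h \<otimes> k = \<one>" using F(2) by blast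
    then show False using idealD(6)[OF ideals(1)[OF that]] ideals(2)[OF that] k F.C_carr by metis
  qed
  have "\<exists>c. c \<in> centre \<and> c \<in> P (Suc i) \<and> c \<notin> P i" if i: "i < n" for i
  proof -
    interpret Q: prime_over_central R centre "P i" using P(1) i by unfold_locales auto
    \<comment> \<open>A list that spans modulo \<open>P 0\<close> also spans modulo the larger ideal
      \<open>P i\<close>.\<close>
    have "Z.cspan (P 0) ws \<subseteq> Z.cspan (P i) ws"
      using i P0[of i] Z.cspan_generator[OF ideals(1) ws(1) _ Z.C_one, of i] ws(1)
      by (intro Z.cspan_mono[OF ideals(1) ws(1)]) (force simp: subset_iff)+
    then have "carrier R \<subseteq> Z.cspan (P i) ws" using ws(2) by (rule order_trans[rotated])
    then show ?thesis
      using Q.ex_central_in_larger_ideal[OF ws(1) _ ideals(1)[of "Suc i"] P(2)[OF i]] i by auto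
  qed
  then obtain c where c: "\<And>i. i < n \<Longrightarrow> c i \<in> centre" "\<And>i. i < n \<Longrightarrow> c i \<in> P (Suc i)" "\<And>i. i < n \<Longrightarrow> c i \<notin> P i"
    by metis
  have reg: "x \<in> P i" if i: "i < n" and x: "x \<in> carrier R" "c i \<otimes> x \<in> P i" for i x
  proof -
    interpret Q: prime_over_central R centre "P i" using P(1) i by unfold_locales auto
    show ?thesis using Q.regular[OF c(1)[OF i] c(3)[OF i] x] .
  qed
  have "\<exists>a. c i \<in> V a" if "i < n" for i using c(1)[OF that] V(5) Z.C_carr by blast
  then obtain a where a: "\<And>i. i < n \<Longrightarrow> c i \<in> V (a i)" by metis
  \<comment> \<open>One filtration degree that contains all the chosen central elements.\<close>
  define l where "l = (\<Sum>i<n. a i)"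
  have l: "c i \<in> V l" if "i < n" for i
    using a[OF that] V(4)[of "a i" l] that member_le_sum[of i "{..<n}" a] by (auto simp: l_def)
  \<comment> \<open>Over a field every span is saturated: the coefficient is cancelled by its
    inverse.\<close>
  have saturated: "F.saturated (P 0) (F.cspan (P 0) vs)" if vs: "set vs \<subseteq> carrier R" for vs
  proof -
    note cl = F.cspan_closed[OF ideals(1)[OF le0] vs]
    have "x \<in> F.cspan (P 0) vs" if k: "k \<in> F" "k \<notin> P 0" "x \<in> carrier R" "k \<otimes> x \<in> F.cspan (P 0) vs" for k x
    proof -
      have "k \<noteq> \<zero>" using k(2) idealD(2)[OF ideals(1)[OF le0]] by auto
      then obtain h where h: "h \<in> F" "h \<otimes> k = \<one>" using F(2)[OF k(1)] by blast
      have "h \<otimes> (k \<otimes> x) \<in> F.cspan (P 0) vs" using cl(4) h k by blast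
      moreover have "h \<otimes> (k \<otimes> x) = (h \<otimes> k) \<otimes> x" using h k F.C_carr by (simp flip: m_assoc)
      ultimately show ?thesis using h k by simp
    qed
    then show ?thesis unfolding F.saturated_def using cl by auto
  qed
  have "(b + 1) ^ n \<le> N * (l * n * b + 1) ^ s" for b
  proof -
    obtain vs where vs: "set vs \<subseteq> V (l * b * n)" "length vs = (b + 1) ^ n" "F.cindep (P 0) vs"
      using F.independent_prime_chain[of n P c V l b, OF ideals(1) _ ideals(2)[OF order_refl] FP c(2)
          Z.central[OF c(1)] reg V(1-4) l] P(2) by blast
    have "length vs \<le> length (ts (l * b * n))"
      using F.length_le_of_independent[OF ideals(1)[OF le0] saturated ts(1) _ vs(3) ideals(2)[OF le0]]
        vs(1) ts(2) by blast
    also have "\<dots> \<le> N * (l * b * n + 1) ^ s" by (rule ts(3))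
    finally show ?thesis using vs(2) by (simp add: ac_simps)
  qed
  then show ?thesis by (rule nat_degree_le_of_powers_le)
qed


section \<open>Monoid algebras over a field\<close>

locale field_monoid_algebra = field R + M: monoid M
  for R :: "('k, 'c) ring_scheme" (structure) and M :: "('m, 'd) monoid_scheme"
begin

abbreviation A where "A \<equiv> monoid_algebra R M"

lemma ring_A: "ring A" by (rule ring_monoid_algebra) (rule M.monoid_axioms)

sublocale A: ring A by (rule ring_A)

lemma A_add: "(f \<oplus>\<^bsub>A\<^esub> g) a = f a \<oplus> g a" and A_zero: "\<zero>\<^bsub>A\<^esub> a = \<zero>"
  and A_one: "\<one>\<^bsub>A\<^esub> a = (if a = \<one>\<^bsub>M\<^esub> then \<one> else \<zero>)"
  by (simp_all add: monoid_algebra_def)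

lemma A_closed [simp]: "f \<in> carrier A \<Longrightarrow> f a \<in> carrier R"
  by (rule monoid_algebra_closed[of f M])

lemma A_finite [simp]: "f \<in> carrier A \<Longrightarrow> finite {a. f a \<noteq> \<zero>}"
  by (rule monoid_algebra_carrierD(3))

lemma A_support: "f \<in> carrier A \<Longrightarrow> f a \<noteq> \<zero> \<Longrightarrow> a \<in> carrier M"
  by (rule monoid_algebra_carrierD(1))

lemma A_carrierI:
  assumes "\<And>a. f a \<in> carrier R" "\<And>a. f a \<noteq> \<zero> \<Longrightarrow> a \<in> carrier M" "finite {a. f a \<noteq> \<zero>}"
  shows "f \<in> carrier A"
proof -
  have "\<forall>a. a \<notin> carrier M \<longrightarrow> f a = \<zero>" using assms(2) by blast
  then show ?thesis using assms(1,3) by (simp add: monoid_algebra_def del: A_closed A_finite)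
qed

text \<open>Short for monomial; unrelated to monotone functions.\<close>

definition mono :: "'k \<Rightarrow> 'm \<Rightarrow> 'm \<Rightarrow> 'k" where
  "mono k a = (\<lambda>b. if b = a then k else \<zero>)"

lemma mono_closed: "k \<in> carrier R \<Longrightarrow> a \<in> carrier M \<Longrightarrow> mono k a \<in> carrier A"
proof (rule A_carrierI)
  assume ka: "k \<in> carrier R" "a \<in> carrier M"
  show "mono k a b \<in> carrier R" for b by (cases "b = a") (simp_all add: mono_def ka del: A_closed)
  show "mono k a b \<noteq> \<zero> \<Longrightarrow> b \<in> carrier M" for b
    by (cases "b = a") (simp_all add: mono_def ka del: A_closed)
  show "finite {b. mono k a b \<noteq> \<zero>}" by (rule finite_subset[of _ "{a}"]) (auto simp: mono_def)
qed

text \<open>The value at f of the linear functional that extends \<phi> from the monoid to its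
  algebra. Coefficients and gradings are computed through such functionals.\<close>

definition ev :: "('m \<Rightarrow> 'k) \<Rightarrow> ('m \<Rightarrow> 'k) \<Rightarrow> 'k" where
  "ev f \<phi> = (\<Oplus>a\<in>{a. f a \<noteq> \<zero>}. f a \<otimes> \<phi> a)"

lemma ev_eq:
  assumes "f \<in> carrier A" "\<And>a. \<phi> a \<in> carrier R" "finite D" "{a. f a \<noteq> \<zero>} \<subseteq> D"
  shows "ev f \<phi> = (\<Oplus>a\<in>D. f a \<otimes> \<phi> a)"
  unfolding ev_def using assms by (intro add.finprod_mono_neutral_cong_left) auto

lemma ev_closed [simp]: "f \<in> carrier A \<Longrightarrow> (\<And>a. \<phi> a \<in> carrier R) \<Longrightarrow> ev f \<phi> \<in> carrier R"
  unfolding ev_def by (auto intro!: finsum_closed)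

lemma ev_cong:
  assumes "f \<in> carrier A" "\<And>a. f a \<noteq> \<zero> \<Longrightarrow> \<phi> a = \<psi> a" "\<And>a. \<psi> a \<in> carrier R"
  shows "ev f \<phi> = ev f \<psi>"
  unfolding ev_def using assms by (intro finsum_cong') auto

lemma ev_add:
  assumes f: "f \<in> carrier A" and g: "g \<in> carrier A" and \<phi>: "\<And>a. \<phi> a \<in> carrier R"
  shows "ev (f \<oplus>\<^bsub>A\<^esub> g) \<phi> = ev f \<phi> \<oplus> ev g \<phi>"
proof -
  let ?D = "{a. f a \<noteq> \<zero>} \<union> {a. g a \<noteq> \<zero>}"
  have "finite ?D" using f g by simp
  moreover have "{a. (f \<oplus>\<^bsub>A\<^esub> g) a \<noteq> \<zero>} \<subseteq> ?D" by (auto simp: A_add)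
  ultimately have "ev (f \<oplus>\<^bsub>A\<^esub> g) \<phi> = (\<Oplus>a\<in>?D. f a \<otimes> \<phi> a \<oplus> g a \<otimes> \<phi> a)"
    using ev_eq[OF A.a_closed[OF f g] \<phi>, of ?D] f g \<phi> by (simp add: A_add l_distr)
  also have "\<dots> = (\<Oplus>a\<in>?D. f a \<otimes> \<phi> a) \<oplus> (\<Oplus>a\<in>?D. g a \<otimes> \<phi> a)"
    by (rule finsum_addf) (use f g \<phi> in \<open>auto simp del: Un_iff\<close>)
  also have "\<dots> = ev f \<phi> \<oplus> ev g \<phi>"
    using f g \<phi> by (simp add: ev_eq[where D = ?D])
  finally show ?thesis .
qed

lemma ev_mono:
  assumes "k \<in> carrier R" "a \<in> carrier M" "\<And>a. \<phi> a \<in> carrier R"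
  shows "ev (mono k a) \<phi> = k \<otimes> \<phi> a"
proof -
  have "ev (mono k a) \<phi> = (\<Oplus>b\<in>{a}. mono k a b \<otimes> \<phi> b)"
    using assms by (intro ev_eq mono_closed) (auto simp: mono_def)
  then show ?thesis using assms by (simp add: mono_def)
qed

lemma ev_zero: "ev \<zero>\<^bsub>A\<^esub> \<phi> = \<zero>"
  unfolding ev_def by (simp add: A_zero)

lemma ev_null: "f \<in> carrier A \<Longrightarrow> ev f (\<lambda>a. \<zero>) = \<zero>"
  unfolding ev_def by (auto intro!: add.finprod_one_eqI)

lemma ev_scale:
  assumes "f \<in> carrier A" "\<And>a. \<phi> a \<in> carrier R" "c \<in> carrier R"
  shows "ev f (\<lambda>a. \<phi> a \<otimes> c) = ev f \<phi> \<otimes> c"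
  unfolding ev_def using assms by (subst finsum_ldistr) (auto simp: m_assoc intro!: finsum_cong')

lemma ev_swap:
  assumes "f \<in> carrier A" "g \<in> carrier A" "\<And>a b. h a b \<in> carrier R"
  shows "ev f (\<lambda>a. ev g (h a)) = ev g (\<lambda>b. ev f (\<lambda>a. h a b))"
proof -
  have "ev f (\<lambda>a. ev g (h a)) = (\<Oplus>a\<in>{a. f a \<noteq> \<zero>}. \<Oplus>b\<in>{b. g b \<noteq> \<zero>}. f a \<otimes> (g b \<otimes> h a b))"
    unfolding ev_def using assms by (intro finsum_cong') (auto simp: finsum_rdistr intro!: finsum_closed)
  also have "\<dots> = (\<Oplus>b\<in>{b. g b \<noteq> \<zero>}. \<Oplus>a\<in>{a. f a \<noteq> \<zero>}. f a \<otimes> (g b \<otimes> h a b))"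
    using assms by (intro finsum_swap) auto
  also have "\<dots> = ev g (\<lambda>b. ev f (\<lambda>a. h a b))"
    unfolding ev_def using assms
    by (intro finsum_cong') (auto simp: finsum_rdistr m_lcomm intro!: finsum_closed finsum_cong')
  finally show ?thesis .
qed

text \<open>A product thus turns into two nested evaluations, and convolution sums can be avoided
  from here on.\<close>

lemma ev_mult:
  assumes f: "f \<in> carrier A" and g: "g \<in> carrier A" and \<phi>: "\<And>a. \<phi> a \<in> carrier R"
  shows "ev (f \<otimes>\<^bsub>A\<^esub> g) \<phi> = ev f (\<lambda>a. ev g (\<lambda>b. \<phi> (a \<otimes>\<^bsub>M\<^esub> b)))"
proof -
  let ?D = "(\<lambda>(a, b). a \<otimes>\<^bsub>M\<^esub> b) ` ({a. f a \<noteq> \<zero>} \<times> {b. g b \<noteq> \<zero>})"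
  have "ev (f \<otimes>\<^bsub>A\<^esub> g) \<phi> = (\<Oplus>d\<in>?D. (f \<otimes>\<^bsub>A\<^esub> g) d \<otimes> \<phi> d)"
    using f g monoid_algebra_mult_closed(2)[OF M.monoid_axioms f g]
    by (intro ev_eq A.m_closed \<phi>) auto
  also have "\<dots> = ev f (\<lambda>a. ev g (\<lambda>b. \<phi> (a \<otimes>\<^bsub>M\<^esub> b)))"
    unfolding ev_def using f g by (intro monoid_algebra_mult_weighted \<phi>) auto
  finally show ?thesis .
qed

lemma mult_eq_ev:
  assumes f: "f \<in> carrier A" and g: "g \<in> carrier A"
  shows "(f \<otimes>\<^bsub>A\<^esub> g) c = ev f (\<lambda>a. ev g (\<lambda>b. if a \<otimes>\<^bsub>M\<^esub> b = c then \<one> else \<zero>))"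
  unfolding ev_def using f g by (intro monoid_algebra_mult) auto

lemma mono_mult:
  assumes "k \<in> carrier R" "l \<in> carrier R" "a \<in> carrier M" "b \<in> carrier M"
  shows "mono k a \<otimes>\<^bsub>A\<^esub> mono l b = mono (k \<otimes> l) (a \<otimes>\<^bsub>M\<^esub> b)"
proof
  fix c
  have "(mono k a \<otimes>\<^bsub>A\<^esub> mono l b) c =
      ev (mono k a) (\<lambda>a. ev (mono l b) (\<lambda>b. if a \<otimes>\<^bsub>M\<^esub> b = c then \<one> else \<zero>))"
    using assms by (intro mult_eq_ev mono_closed)
  also have "\<dots> = k \<otimes> (l \<otimes> (if a \<otimes>\<^bsub>M\<^esub> b = c then \<one> else \<zero>))"
    using assms by (simp add: ev_mono mono_closed)
  also have "\<dots> = mono (k \<otimes> l) (a \<otimes>\<^bsub>M\<^esub> b) c"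
    using assms by (auto simp: mono_def)
  finally show "(mono k a \<otimes>\<^bsub>A\<^esub> mono l b) c = mono (k \<otimes> l) (a \<otimes>\<^bsub>M\<^esub> b) c" .
qed

lemma one_eq_mono: "\<one>\<^bsub>A\<^esub> = mono \<one> \<one>\<^bsub>M\<^esub>"
  by (auto simp: A_one mono_def)

text \<open>Peel off one coefficient at a time. Only monomials from the support of f occur, so a
  bound on the words in the support survives the induction.\<close>

lemma A_induct:
  assumes f: "f \<in> carrier A" and zero: "\<zero>\<^bsub>A\<^esub> \<in> H"
    and add: "\<And>g h. g \<in> H \<Longrightarrow> h \<in> H \<Longrightarrow> g \<oplus>\<^bsub>A\<^esub> h \<in> H"
    and mono: "\<And>a k. a \<in> carrier M \<Longrightarrow> f a \<noteq> \<zero> \<Longrightarrow> k \<in> carrier R \<Longrightarrow> mono k a \<in> H"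
  shows "f \<in> H"
proof -
  have *: "finite D \<Longrightarrow> g \<in> carrier A \<Longrightarrow> {a. g a \<noteq> \<zero>} \<subseteq> D \<Longrightarrow> D \<subseteq> {a. f a \<noteq> \<zero>} \<Longrightarrow> g \<in> H" for D g
  proof (induction D arbitrary: g rule: finite_induct)
    case empty
    then have "g = \<zero>\<^bsub>A\<^esub>" by (auto simp: A_zero)
    then show ?case using zero by simp
  next
    case (insert d D)
    let ?g = "g(d := \<zero>)"
    have supp: "{a. ?g a \<noteq> \<zero>} \<subseteq> D" using insert.prems by (auto split: if_splits)
    have "?g \<in> carrier A"
    proof (rule A_carrierI)
      show "?g a \<noteq> \<zero> \<Longrightarrow> a \<in> carrier M" for a using A_support[OF insert.prems(1), of a] by (auto split: if_splits)
    qed (use insert finite_subset[OF supp] in auto)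
    then have "?g \<in> H" using insert.IH supp insert.prems(3) by blast
    moreover have "mono (g d) d \<in> H" using insert.prems A_support[OF f] mono by auto
    ultimately have "mono (g d) d \<oplus>\<^bsub>A\<^esub> ?g \<in> H" by (rule add[rotated])
    moreover have "mono (g d) d \<oplus>\<^bsub>A\<^esub> ?g = g"
      using insert.prems by (auto simp: A_add mono_def fun_eq_iff)
    ultimately show ?case by simp
  qed
  show ?thesis by (rule *[OF A_finite[OF f] f]) auto
qed

lemma mono_one_central:
  assumes k: "k \<in> carrier R" and a: "a \<in> carrier M"
    and comm: "\<And>b. b \<in> carrier M \<Longrightarrow> a \<otimes>\<^bsub>M\<^esub> b = b \<otimes>\<^bsub>M\<^esub> a"
  shows "mono k a \<in> A.centre"
proof -
  have "f \<in> {f \<in> carrier A. mono k a \<otimes>\<^bsub>A\<^esub> f = f \<otimes>\<^bsub>A\<^esub> mono k a}" if f: "f \<in> carrier A" for f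
    by (rule A_induct[OF f]) (use k a comm mono_closed[OF k a] in
      \<open>auto simp: A.l_distr A.r_distr mono_closed mono_mult m_comm\<close>)
  then show ?thesis using mono_closed[OF k a] by (auto simp: A.centre_def)
qed

section \<open>The scalars as a central field\<close>

definition scalars :: "('m \<Rightarrow> 'k) set" where
  "scalars = (\<lambda>k. mono k \<one>\<^bsub>M\<^esub>) ` carrier R"

lemma central_subring_scalars: "central_subring A scalars"
proof (intro central_subring.intro central_subring_axioms.intro ring_A)
  have neg: "\<ominus>\<^bsub>A\<^esub> mono k \<one>\<^bsub>M\<^esub> = mono (\<ominus> k) \<one>\<^bsub>M\<^esub>" if "k \<in> carrier R" for k
    
    using that mono_closed[of _ "\<one>\<^bsub>M\<^esub>"]
    by (intro A.minus_equality) (auto simp: A_add A_zero mono_def l_neg fun_eq_iff)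
  have add: "mono k \<one>\<^bsub>M\<^esub> \<oplus>\<^bsub>A\<^esub> mono l \<one>\<^bsub>M\<^esub> = mono (k \<oplus> l) \<one>\<^bsub>M\<^esub>" if "k \<in> carrier R" "l \<in> carrier R" for k l
    using that by (auto simp: A_add mono_def)
  show "subring scalars A"
    by (rule A.subringI) (auto simp: scalars_def mono_closed one_eq_mono neg add mono_mult)
  show "c \<otimes>\<^bsub>A\<^esub> x = x \<otimes>\<^bsub>A\<^esub> c" if "c \<in> scalars" "x \<in> carrier A" for c x
    using that mono_one_central[of _ "\<one>\<^bsub>M\<^esub>"] by (auto simp: scalars_def A.centre_def)
qed

lemma scalars_inverse:
  assumes "c \<in> scalars" "c \<noteq> \<zero>\<^bsub>A\<^esub>"
  shows "\<exists>h\<in>scalars. h \<otimes>\<^bsub>A\<^esub> c = \<one>\<^bsub>A\<^esub>"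
proof -
  obtain k where k: "k \<in> carrier R" "c = mono k \<one>\<^bsub>M\<^esub>" using assms(1) by (auto simp: scalars_def)
  have "k \<noteq> \<zero>" using assms(2) k by (auto simp: mono_def A_zero fun_eq_iff)
  then have k': "inv k \<in> carrier R" "inv k \<otimes> k = \<one>" using k field_Units by auto
  then have "mono (inv k) \<one>\<^bsub>M\<^esub> \<otimes>\<^bsub>A\<^esub> c = \<one>\<^bsub>A\<^esub>" using k by (simp add: mono_mult one_eq_mono)
  then show ?thesis using k' by (auto simp: scalars_def)
qed

lemma mono_scale:
  assumes "k \<in> carrier R" "a \<in> carrier M"
  shows "mono k a = mono k \<one>\<^bsub>M\<^esub> \<otimes>\<^bsub>A\<^esub> mono \<one> a"
  using assms by (simp add: mono_mult)

text \<open>Monoid elements span the algebra over the central scalars, so they suffice as middle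
  factors in the elementwise criterion.\<close>

lemma nc_prime_ideal_mono:
  assumes P: "nc_prime_ideal P A" and fg: "f \<in> carrier A" "g \<in> carrier A"
    and sandwich: "\<And>a. a \<in> carrier M \<Longrightarrow> f \<otimes>\<^bsub>A\<^esub> (mono \<one> a \<otimes>\<^bsub>A\<^esub> g) \<in> P"
  shows "f \<in> P \<or> g \<in> P"
proof (rule A.nc_prime_ideal_elementwise[OF P fg])
  note D = A.idealD[OF A.nc_prime_idealD(1)[OF P]]
  interpret F: central_subring A scalars by (rule central_subring_scalars)
  fix r assume r: "r \<in> carrier A"
  have "r \<in> {r \<in> carrier A. f \<otimes>\<^bsub>A\<^esub> (r \<otimes>\<^bsub>A\<^esub> g) \<in> P}"
  proof (rule A_induct[OF r])
    fix a k assume ak: "a \<in> carrier M" "k \<in> carrier R"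
    have k: "mono k \<one>\<^bsub>M\<^esub> \<in> scalars" using ak by (simp add: scalars_def)
    note c = mono_closed[OF one_closed ak(1)] F.C_carr[OF k] fg
    have "f \<otimes>\<^bsub>A\<^esub> (mono k a \<otimes>\<^bsub>A\<^esub> g) = mono k \<one>\<^bsub>M\<^esub> \<otimes>\<^bsub>A\<^esub> (f \<otimes>\<^bsub>A\<^esub> (mono \<one> a \<otimes>\<^bsub>A\<^esub> g))"
      using F.C_left[OF k fg(1), of "mono \<one> a \<otimes>\<^bsub>A\<^esub> g"] c unfolding mono_scale[OF ak(2,1)]
      by (simp add: A.m_assoc)
    then show "mono k a \<in> {r \<in> carrier A. f \<otimes>\<^bsub>A\<^esub> (r \<otimes>\<^bsub>A\<^esub> g) \<in> P}"
      using D(6)[OF c(2) sandwich[OF ak(1)]] ak by (simp add: mono_closed)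
  qed (use fg D in \<open>auto simp: A.l_distr A.r_distr\<close>)
  then show "f \<otimes>\<^bsub>A\<^esub> (r \<otimes>\<^bsub>A\<^esub> g) \<in> P" by simp
qed

end


section \<open>Primes from gradings by an ordered semigroup with zero\<close>

text \<open>\<open>None\<close> acts as a zero adjoined to the grading semigroup. The order and
  cancellation make leading degrees add. Later the degrees are multisets of orbit indices, that is,
  monomials in commuting variables.\<close>

locale graded_monoid_algebra = field_monoid_algebra +
  fixes \<psi> :: "'c \<Rightarrow> 'v :: linordered_cancel_ab_semigroup_add option"
  assumes \<psi>_mult: "\<And>a b. a \<in> carrier M \<Longrightarrow> b \<in> carrier M \<Longrightarrow>
      \<psi> (a \<otimes>\<^bsub>M\<^esub> b) = (case \<psi> a of None \<Rightarrow> None | Some u \<Rightarrow> map_option ((+) u) (\<psi> b))"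
    and \<psi>_one: "\<psi> \<one>\<^bsub>M\<^esub> \<noteq> None"
begin

text \<open>The coefficient at v of the image of f in the semigroup algebra.\<close>

definition cf where "cf f v = ev f (\<lambda>a. if \<psi> a = Some v then \<one> else \<zero>)"

text \<open>The kernel of the map to the algebra of the grading semigroup.\<close>

definition kernel where "kernel = {f \<in> carrier A. \<forall>v. cf f v = \<zero>}"

lemma kernelI: "f \<in> carrier A \<Longrightarrow> (\<And>v. cf f v = \<zero>) \<Longrightarrow> f \<in> kernel"
  by (simp add: kernel_def)

lemma kernelD: "f \<in> kernel \<Longrightarrow> f \<in> carrier A" "f \<in> kernel \<Longrightarrow> cf f v = \<zero>"
  by (simp_all add: kernel_def)

lemma cf_closed: "f \<in> carrier A \<Longrightarrow> cf f v \<in> carrier R"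
  unfolding cf_def by (intro ev_closed) auto

lemma cf_mult:
  assumes "f \<in> carrier A" "g \<in> carrier A"
  shows "cf (f \<otimes>\<^bsub>A\<^esub> g) v =
    ev f (\<lambda>a. ev g (\<lambda>b. if \<psi> (a \<otimes>\<^bsub>M\<^esub> b) = Some v then \<one> else \<zero>))"
  unfolding cf_def using assms by (intro ev_mult) auto

lemma ideal_kernel: "ideal kernel A"
proof (rule A.ideal_of_closed)
  show "kernel \<subseteq> carrier A" by (auto simp: kernel_def)
  show "\<zero>\<^bsub>A\<^esub> \<in> kernel" by (rule kernelI) (simp_all add: cf_def ev_zero)
  fix f g assume f: "f \<in> kernel" and g: "g \<in> kernel"
  note fg = kernelD(1)[OF f] kernelD(1)[OF g]
  have "cf (f \<oplus>\<^bsub>A\<^esub> g) v = cf f v \<oplus> cf g v" for v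
    unfolding cf_def by (intro ev_add fg) auto
  then show "f \<oplus>\<^bsub>A\<^esub> g \<in> kernel" using fg kernelD(2)[OF f] kernelD(2)[OF g] by (intro kernelI) simp_all
next
  fix g f assume g: "g \<in> carrier A" and f: "f \<in> kernel"
  note fc = kernelD(1)[OF f]
  \<comment> \<open>Multiplication by a shifts degrees by \<psi> a = u: the coefficient at v is the
    one of f at w with v = u + w, where w is unique by cancellation, or zero if there is no such
    w.\<close>
  have 0: "ev f (\<lambda>b. if \<psi> (a \<otimes>\<^bsub>M\<^esub> b) = Some v then \<one> else \<zero>) = \<zero>" if a: "a \<in> carrier M" for a v
  proof (cases "\<exists>u w. \<psi> a = Some u \<and> v = u + w")
    case True
    then obtain u w where "\<psi> a = Some u" "v = u + w" by blast
    then have "\<psi> (a \<otimes>\<^bsub>M\<^esub> b) = Some v \<longleftrightarrow> \<psi> b = Some w" if "f b \<noteq> \<zero>" for b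
      using \<psi>_mult[OF a A_support[OF fc that]] by (cases "\<psi> b") auto
    then have "ev f (\<lambda>b. if \<psi> (a \<otimes>\<^bsub>M\<^esub> b) = Some v then \<one> else \<zero>) = cf f w"
      unfolding cf_def by (intro ev_cong fc) auto
    then show ?thesis using kernelD(2)[OF f] by simp
  next
    case False
    then have "\<psi> (a \<otimes>\<^bsub>M\<^esub> b) \<noteq> Some v" if "f b \<noteq> \<zero>" for b
      using \<psi>_mult[OF a A_support[OF fc that]] by (cases "\<psi> b") (auto split: option.splits)
    then have "ev f (\<lambda>b. if \<psi> (a \<otimes>\<^bsub>M\<^esub> b) = Some v then \<one> else \<zero>) = ev f (\<lambda>b. \<zero>)"
      by (intro ev_cong fc) auto
    then show ?thesis using ev_null[OF fc] by simp
  qed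
  \<comment> \<open>The grading is commutative, so right factors behave like left ones.\<close>
  have 1: "ev f (\<lambda>b. if \<psi> (b \<otimes>\<^bsub>M\<^esub> a) = Some v then \<one> else \<zero>) = \<zero>" if a: "a \<in> carrier M" for a v
  proof -
    have "\<psi> (b \<otimes>\<^bsub>M\<^esub> a) = \<psi> (a \<otimes>\<^bsub>M\<^esub> b)" if "f b \<noteq> \<zero>" for b
      using \<psi>_mult[OF a A_support[OF fc that]] \<psi>_mult[OF A_support[OF fc that] a]
      by (cases "\<psi> a"; cases "\<psi> b") (auto simp: add.commute)
    then have "ev f (\<lambda>b. if \<psi> (b \<otimes>\<^bsub>M\<^esub> a) = Some v then \<one> else \<zero>) =
        ev f (\<lambda>b. if \<psi> (a \<otimes>\<^bsub>M\<^esub> b) = Some v then \<one> else \<zero>)"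
      by (intro ev_cong fc) auto
    then show ?thesis using 0[OF a] by simp
  qed
  have "cf (g \<otimes>\<^bsub>A\<^esub> f) v = ev g (\<lambda>a. \<zero>)" for v
    unfolding cf_mult[OF g fc] by (intro ev_cong g 0 A_support[OF g]) auto
  then show "g \<otimes>\<^bsub>A\<^esub> f \<in> kernel" using g fc ev_null[OF g] by (intro kernelI) simp_all
  have "cf (f \<otimes>\<^bsub>A\<^esub> g) v = ev g (\<lambda>a. ev f (\<lambda>b. if \<psi> (b \<otimes>\<^bsub>M\<^esub> a) = Some v then \<one> else \<zero>))" for v
    unfolding cf_mult[OF fc g] by (intro ev_swap g fc) auto
  then have "cf (f \<otimes>\<^bsub>A\<^esub> g) v = ev g (\<lambda>a. \<zero>)" for v
    using ev_cong[OF g 1[OF A_support[OF g]]] by simp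
  then show "f \<otimes>\<^bsub>A\<^esub> g \<in> kernel" using g fc ev_null[OF g] by (intro kernelI) simp_all
qed

text \<open>Terms of f may have degree \<open>None\<close>, or a large degree at which their
  coefficients cancel. Both kinds lie in the kernel together; dropping them leaves a representative
  with a genuine leading degree m.\<close>

lemma ex_truncation:
  assumes f: "f \<in> carrier A" "f \<notin> kernel"
  shows "\<exists>f' m. f' \<in> carrier A \<and> f \<ominus>\<^bsub>A\<^esub> f' \<in> kernel \<and> cf f' m \<noteq> \<zero> \<and>
    (\<forall>a. f' a \<noteq> \<zero> \<longrightarrow> (\<exists>u\<le>m. \<psi> a = Some u))"
proof -
  define U where "U = {v. cf f v \<noteq> \<zero>}"
  \<comment> \<open>A degree with nonzero coefficient occurs in the finite support, so a largest one
    exists.\<close>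
  have "v \<in> the ` \<psi> ` {a. f a \<noteq> \<zero>}" if "v \<in> U" for v
  proof (rule ccontr)
    assume v: "v \<notin> the ` \<psi> ` {a. f a \<noteq> \<zero>}"
    have "\<psi> a \<noteq> Some v" if "f a \<noteq> \<zero>" for a
    proof
      assume "\<psi> a = Some v"
      then have "v = the (\<psi> a)" by simp
      then show False using v that by blast
    qed
    then have "cf f v = ev f (\<lambda>a. \<zero>)" unfolding cf_def by (intro ev_cong f) auto
    then show False using \<open>v \<in> U\<close> ev_null[OF f(1)] by (simp add: U_def)
  qed
  then have "U \<subseteq> the ` \<psi> ` {a. f a \<noteq> \<zero>}" by blast
  then have "finite U" by (rule finite_subset) (simp add: f(1))
  moreover have "U \<noteq> {}" using f by (auto simp: U_def kernel_def)
  ultimately have m: "Max U \<in> U" "\<And>u. u \<in> U \<Longrightarrow> u \<le> Max U" by auto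
  define m where "m = Max U"
  define f' where "f' = (\<lambda>a. if \<exists>u\<le>m. \<psi> a = Some u then f a else \<zero>)"
  define f'' where "f'' = (\<lambda>a. if \<exists>u\<le>m. \<psi> a = Some u then \<zero> else f a)"
  have f': "f' \<in> carrier A" "f'' \<in> carrier A"
    using f(1) A_support[OF f(1)]
    by (auto intro!: A_carrierI finite_subset[OF _ A_finite[OF f(1)]] simp: f'_def f''_def split: if_splits)
  have sum: "f = f'' \<oplus>\<^bsub>A\<^esub> f'" using f(1) by (intro ext) (auto simp: f'_def f''_def A_add)
  then have minus: "f \<ominus>\<^bsub>A\<^esub> f' = f''" using f' by (simp add: A.minus_eq A.a_assoc A.r_neg)
  have cf_f'': "cf f'' v = (if v \<le> m then \<zero> else cf f v)" for v
  proof (cases "v \<le> m")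
    case True
    then have "cf f'' v = ev f'' (\<lambda>a. \<zero>)"
      unfolding cf_def by (intro ev_cong f') (auto simp: f''_def split: if_splits)
    then show ?thesis using ev_null[OF f'(2)] True by simp
  next
    case False
    then have "cf f' v = ev f' (\<lambda>a. \<zero>)"
      unfolding cf_def by (intro ev_cong f') (auto simp: f'_def split: if_splits)
    then have "cf f' v = \<zero>" using ev_null[OF f'(1)] by simp
    moreover have "cf f v = cf f'' v \<oplus> cf f' v"
      using ev_add[OF f'(2,1), of "\<lambda>a. if \<psi> a = Some v then \<one> else \<zero>"] by (auto simp: cf_def sum[symmetric])
    ultimately show ?thesis using False cf_closed[OF f'(2)] by simp
  qed
  have "cf f v = \<zero>" if "\<not> v \<le> m" for v using m(2)[of v] that by (auto simp: U_def m_def)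
  then have "f'' \<in> kernel" using f' by (intro kernelI) (auto simp: cf_f'')
  moreover have "cf f' m \<noteq> \<zero>"
  proof
    assume 0: "cf f' m = \<zero>"
    have "cf f m = cf f'' m \<oplus> cf f' m"
      using ev_add[OF f'(2,1), of "\<lambda>a. if \<psi> a = Some m then \<one> else \<zero>"] by (auto simp: cf_def sum[symmetric])
    then show False using m(1) 0 by (simp add: cf_f'' U_def m_def)
  qed
  ultimately show ?thesis using f' minus by (intro exI[of _ f'] exI[of _ m]) (auto simp: f'_def split: if_splits)
qed

text \<open>After truncation, the coefficient of a product at the sum of the leading degrees is the
  product of the leading coefficients, which is nonzero in a field.\<close>

theorem nc_prime_kernel: "nc_prime_ideal kernel A"
  unfolding nc_prime_ideal_def
proof (intro conjI allI impI ideal_kernel)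
  note D = A.idealD[OF ideal_kernel]
  obtain v where v: "\<psi> \<one>\<^bsub>M\<^esub> = Some v" using \<psi>_one by auto
  have "cf (mono \<one> \<one>\<^bsub>M\<^esub>) v = \<one>" unfolding cf_def by (subst ev_mono) (auto simp: v)
  then have "mono \<one> \<one>\<^bsub>M\<^esub> \<notin> kernel" using kernelD(2) by force
  then show "kernel \<noteq> carrier A" using mono_closed[of \<one> "\<one>\<^bsub>M\<^esub>"] by auto
  fix I J assume I: "ideal I A" and J: "ideal J A" and IJ: "I \<cdot>\<^bsub>A\<^esub> J \<subseteq> kernel"
  show "I \<subseteq> kernel \<or> J \<subseteq> kernel"
  proof (rule ccontr)
    assume "\<not> (I \<subseteq> kernel \<or> J \<subseteq> kernel)"
    then obtain f g where f: "f \<in> I" "f \<notin> kernel" and g: "g \<in> J" "g \<notin> kernel" by blast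
    have fg: "f \<in> carrier A" "g \<in> carrier A" using A.idealD(1)[OF I] A.idealD(1)[OF J] f g by auto
    have prod: "f \<otimes>\<^bsub>A\<^esub> g \<in> kernel" using IJ f g by (auto intro: ideal_prod.prod)
    obtain f' m where f': "f' \<in> carrier A" "f \<ominus>\<^bsub>A\<^esub> f' \<in> kernel" "cf f' m \<noteq> \<zero>"
      "\<And>a. f' a \<noteq> \<zero> \<Longrightarrow> \<exists>u\<le>m. \<psi> a = Some u" using ex_truncation[OF fg(1) f(2)] by blast
    obtain g' n where g': "g' \<in> carrier A" "g \<ominus>\<^bsub>A\<^esub> g' \<in> kernel" "cf g' n \<noteq> \<zero>"
      "\<And>a. g' a \<noteq> \<zero> \<Longrightarrow> \<exists>u\<le>n. \<psi> a = Some u" using ex_truncation[OF fg(2) g(2)] by blast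
    \<comment> \<open>Replacing both factors by their truncations changes the product only by
      elements of the kernel.\<close>
    have "f \<otimes>\<^bsub>A\<^esub> g \<ominus>\<^bsub>A\<^esub> ((f \<ominus>\<^bsub>A\<^esub> f') \<otimes>\<^bsub>A\<^esub> g \<oplus>\<^bsub>A\<^esub> f' \<otimes>\<^bsub>A\<^esub> (g \<ominus>\<^bsub>A\<^esub> g')) \<in> kernel"
      using D fg f' g' prod by simp
    moreover have "f \<otimes>\<^bsub>A\<^esub> g \<ominus>\<^bsub>A\<^esub> ((f \<ominus>\<^bsub>A\<^esub> f') \<otimes>\<^bsub>A\<^esub> g \<oplus>\<^bsub>A\<^esub> f' \<otimes>\<^bsub>A\<^esub> (g \<ominus>\<^bsub>A\<^esub> g')) = f' \<otimes>\<^bsub>A\<^esub> g'"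
      using fg f'(1) g'(1) by (algebra)
    ultimately have 0: "cf (f' \<otimes>\<^bsub>A\<^esub> g') (m + n) = \<zero>" using kernelD(2) by simp
    \<comment> \<open>Degrees bounded by m and n add up to m + n only if both bounds are
      attained.\<close>
    have split: "\<psi> (a \<otimes>\<^bsub>M\<^esub> b) = Some (m + n) \<longleftrightarrow> \<psi> a = Some m \<and> \<psi> b = Some n"
      if ab: "f' a \<noteq> \<zero>" "g' b \<noteq> \<zero>" for a b
    proof -
      obtain u w where uw: "\<psi> a = Some u" "u \<le> m" "\<psi> b = Some w" "w \<le> n" using f'(4) g'(4) ab by blast
      have "u + w = m + n \<longleftrightarrow> u = m \<and> w = n"
        using uw(2,4) add_less_le_mono[of u m w n] add_le_less_mono[of u m w n] by (auto simp: le_less)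
      then show ?thesis using \<psi>_mult[OF A_support[OF f'(1) ab(1)] A_support[OF g'(1) ab(2)]] uw by simp
    qed
    let ?i = "\<lambda>v a. if \<psi> a = Some v then \<one> else \<zero>"
    have "ev g' (\<lambda>b. if \<psi> (a \<otimes>\<^bsub>M\<^esub> b) = Some (m + n) then \<one> else \<zero>) = ?i m a \<otimes> cf g' n"
      if a: "f' a \<noteq> \<zero>" for a
    proof (cases "\<psi> a = Some m")
      case True
      then have "ev g' (\<lambda>b. if \<psi> (a \<otimes>\<^bsub>M\<^esub> b) = Some (m + n) then \<one> else \<zero>) = cf g' n"
        unfolding cf_def using split[OF a] by (intro ev_cong g') auto
      then show ?thesis using True cf_closed[OF g'(1)] by simp
    next
      case False
      then have "ev g' (\<lambda>b. if \<psi> (a \<otimes>\<^bsub>M\<^esub> b) = Some (m + n) then \<one> else \<zero>) = ev g' (\<lambda>b. \<zero>)"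
        using split[OF a] by (intro ev_cong g') auto
      then show ?thesis using False ev_null[OF g'(1)] cf_closed[OF g'(1)] by simp
    qed
    then have "cf (f' \<otimes>\<^bsub>A\<^esub> g') (m + n) = ev f' (\<lambda>a. ?i m a \<otimes> cf g' n)"
      unfolding cf_mult[OF f'(1) g'(1)] using cf_closed[OF g'(1)] by (intro ev_cong f') auto
    also have "\<dots> = cf f' m \<otimes> cf g' n"
      unfolding cf_def[of f'] using cf_closed[OF g'(1)] by (intro ev_scale f') auto
    finally show False using 0 integral[of "cf f' m" "cf g' n"] f' g' cf_closed by auto
  qed
qed

lemma mono_in_kernel_iff:
  assumes "a \<in> carrier M"
  shows "mono \<one> a \<in> kernel \<longleftrightarrow> \<psi> a = None"
proof -
  have "cf (mono \<one> a) v = (if \<psi> a = Some v then \<one> else \<zero>)" for v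
    unfolding cf_def using assms by (subst ev_mono) auto
  then show ?thesis using mono_closed[OF one_closed assms] by (cases "\<psi> a") (auto simp: kernel_def)
qed

end


section \<open>Words in a monoid with normal generators\<close>

text \<open>Here \<open>s z\<close> stands for the permutation \<sigma>_z of the finite set
  underlying the solution.\<close>

locale normal_presentation =
  fixes S :: "'x set" and s :: "'x \<Rightarrow> 'x \<Rightarrow> 'x"
  assumes finite_S: "finite S" and bij: "\<And>z. z \<in> S \<Longrightarrow> bij_betw (s z) S S"
begin

abbreviation rels where "rels \<equiv> {([x, z], [z, s z x]) | x z. x \<in> S \<and> z \<in> S}"
abbreviation E where "E \<equiv> pres_cong S rels"
abbreviation M where "M \<equiv> presented_monoid S rels"

definition cl where "cl u = E `` {u}"

lemma s_closed: "z \<in> S \<Longrightarrow> x \<in> S \<Longrightarrow> s z x \<in> S"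
  using bij_betw_apply[OF bij] .

lemma s_funpow_closed: "z \<in> S \<Longrightarrow> x \<in> S \<Longrightarrow> (s z ^^ k) x \<in> S"
  by (induction k) (auto intro: s_closed)

lemma monoid_M: "monoid M" by (rule monoid_presented_monoid)

lemma carrier_M: "carrier M = cl ` lists S"
  by (auto simp: presented_monoid_def quotient_def cl_def)

lemma cl_carrier: "u \<in> lists S \<Longrightarrow> cl u \<in> carrier M"
  by (auto simp: carrier_M)

lemma one_M: "\<one>\<^bsub>M\<^esub> = cl []" by (simp add: presented_monoid_def cl_def)

lemma cl_mult: "u \<in> lists S \<Longrightarrow> v \<in> lists S \<Longrightarrow> cl u \<otimes>\<^bsub>M\<^esub> cl v = cl (u @ v)"
  unfolding cl_def by (rule pres_class_mult)

lemma cl_eq: "(u, v) \<in> E \<Longrightarrow> cl u = cl v"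
  unfolding cl_def by (rule equiv_class_eq[OF equiv_pres_cong])

lemma cl_eq_iff: "u \<in> lists S \<Longrightarrow> v \<in> lists S \<Longrightarrow> cl u = cl v \<longleftrightarrow> (u, v) \<in> E"
  unfolding cl_def by (rule eq_equiv_class_iff[OF equiv_pres_cong])

lemma E_rel: "x \<in> S \<Longrightarrow> z \<in> S \<Longrightarrow> ([x, z], [z, s z x]) \<in> E"
  by (rule pres_cong.rel) (auto intro: s_closed)

lemmas E_refl = pres_cong.refl[where S = S and R = rels]
lemmas E_trans = pres_cong.trans[where S = S and R = rels]
lemmas E_append = pres_cong.append[where S = S and R = rels]

lemma E_left: "u \<in> lists S \<Longrightarrow> (v, w) \<in> E \<Longrightarrow> (u @ v, u @ w) \<in> E"
  by (rule E_append[OF E_refl])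

lemma E_right: "u \<in> lists S \<Longrightarrow> (v, w) \<in> E \<Longrightarrow> (v @ u, w @ u) \<in> E"
  by (rule E_append[OF _ E_refl])

lemma replicate_lists: "x \<in> S \<Longrightarrow> replicate k x \<in> lists S"
  by auto

lemma E_length: "(u, v) \<in> E \<Longrightarrow> length u = length v"
  by (induction rule: pres_cong.induct) auto

lemma move_past_power:
  assumes "x \<in> S" "y \<in> S"
  shows "(y # replicate k x, replicate k x @ [(s x ^^ k) y]) \<in> E"
proof (induction k)
  case 0
  then show ?case using assms by (simp add: E_refl)
next
  case (Suc k)
  have "((y # replicate k x) @ [x], (replicate k x @ [(s x ^^ k) y]) @ [x]) \<in> E"
    using Suc assms by (intro E_right) auto
  moreover have "(replicate k x @ [(s x ^^ k) y, x], replicate k x @ [x, s x ((s x ^^ k) y)]) \<in> E"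
    using assms by (intro E_left E_rel s_funpow_closed replicate_lists)
  ultimately have "((y # replicate k x) @ [x], replicate k x @ [x, s x ((s x ^^ k) y)]) \<in> E"
    by (auto intro: E_trans)
  then show ?case by (simp add: replicate_append_same[symmetric] del: replicate_append_same)
qed

lemma power_past_letter:
  assumes "x \<in> S" "y \<in> S"
  shows "(replicate k y @ [x], x # replicate k (s x y)) \<in> E"
proof (induction k)
  case 0
  then show ?case using assms by (simp add: E_refl)
next
  case (Suc k)
  have "([y] @ replicate k y @ [x], [y] @ x # replicate k (s x y)) \<in> E"
    using Suc assms by (intro E_left) auto
  moreover have "([y, x] @ replicate k (s x y), [x, s x y] @ replicate k (s x y)) \<in> E"
    using assms by (intro E_right E_rel replicate_lists s_closed)
  ultimately show ?case by (auto intro: E_trans)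
qed

text \<open>Letters are normal: surjectivity of \<open>s x\<close> provides b with b x = x a for
  each letter a, so x can be pushed to the right end.\<close>

lemma letter_past_word:
  assumes x: "x \<in> S" and u: "u \<in> lists S"
  shows "\<exists>v\<in>lists S. (x # u, v @ [x]) \<in> E"
  using u
proof (induction u)
  case Nil
  then show ?case using x by (auto intro!: bexI[of _ "[]"] E_refl)
next
  case (Cons a u)
  then obtain v where v: "v \<in> lists S" "(x # u, v @ [x]) \<in> E" by auto
  have "a \<in> s x ` S" using Cons.hyps bij_betw_imp_surj_on[OF bij[OF x]] by simp
  then obtain b where b: "b \<in> S" "s x b = a" by auto
  have 1: "([b, x] @ u, [x, a] @ u) \<in> E" using E_rel[OF b(1) x] b Cons.hyps by (intro E_right) auto
  have 2: "([b] @ (x # u), [b] @ (v @ [x])) \<in> E" using b v by (intro E_left) auto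
  have "(x # a # u, (b # v) @ [x]) \<in> E"
    using E_trans[OF pres_cong.sym[OF 1], of "b # v @ [x]"] 2 by simp
  then show ?case using b v by (intro bexI[of _ "b # v"]) auto
qed

text \<open>Each occurrence of x moves to the front; the letters it passes are changed by
  \<open>s x\<close> but remain in \<open>Y\<close>.\<close>

lemma collect_letter:
  assumes Y: "Y \<subseteq> S" "\<And>x y. x \<in> Y \<Longrightarrow> y \<in> Y \<Longrightarrow> s x y \<in> Y" and x: "x \<in> Y" and u: "u \<in> lists Y"
  shows "\<exists>v\<in>lists Y. (u, replicate (count_list u x) x @ v) \<in> E"
  using u
proof (induction u)
  case Nil
  then show ?case by (auto intro!: bexI[of _ "[]"] E_refl)
next
  case (Cons y u)
  let ?k = "count_list u x"
  obtain v where v: "v \<in> lists Y" "(u, replicate ?k x @ v) \<in> E" using Cons by auto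
  have y: "y \<in> Y" "y \<in> S" and xS: "x \<in> S" using Cons.hyps Y(1) x by auto
  have vS: "v \<in> lists S" using v(1) Y(1) by auto
  have 1: "([y] @ u, [y] @ replicate ?k x @ v) \<in> E" using v y by (intro E_left) auto
  show ?case
  proof (cases "y = x")
    case True
    then show ?thesis using 1 v by (intro bexI[of _ v]) auto
  next
    case False
    have "((y # replicate ?k x) @ v, (replicate ?k x @ [(s x ^^ ?k) y]) @ v) \<in> E"
      by (rule E_right[OF vS move_past_power[OF xS y(2)]])
    with 1 have "(y # u, replicate ?k x @ (s x ^^ ?k) y # v) \<in> E" by (auto intro: E_trans)
    moreover have "(s x ^^ j) y \<in> Y" for j using y x Y(2) by (induction j) auto
    ultimately show ?thesis using False v by (intro bexI[of _ "(s x ^^ ?k) y # v"]) auto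
  qed
qed

text \<open>By the pigeonhole principle some letter occurs at least d times, and its occurrences can
  be collected in front.\<close>

lemma long_word_power:
  assumes Y: "Y \<subseteq> S" "\<And>x y. x \<in> Y \<Longrightarrow> y \<in> Y \<Longrightarrow> s x y \<in> Y" and u: "u \<in> lists Y"
    and len: "card S * d < length u"
  shows "\<exists>x\<in>Y. \<exists>v\<in>lists Y. (u, replicate d x @ v) \<in> E"
proof -
  have "\<exists>x\<in>Y. d \<le> count_list u x"
  proof (rule ccontr)
    assume *: "\<not> ?thesis"
    have fY: "finite Y" using Y(1) finite_S by (rule finite_subset)
    have "length u = (\<Sum>x\<in>Y. count_list u x)" using u fY by (intro sum_count_set[symmetric]) auto
    also have "\<dots> \<le> (\<Sum>x\<in>Y. d)" using * by (intro sum_mono) force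
    also have "\<dots> \<le> card S * d" using card_mono[OF finite_S Y(1)] by simp
    finally show False using len by simp
  qed
  then obtain x where x: "x \<in> Y" "d \<le> count_list u x" by blast
  obtain v where v: "v \<in> lists Y" "(u, replicate (count_list u x) x @ v) \<in> E"
    using collect_letter[OF Y x(1) u] by blast
  have "replicate (count_list u x) x = replicate d x @ replicate (count_list u x - d) x"
    using x(2) by (simp flip: replicate_add)
  then show ?thesis using v x by (intro bexI[of _ x] bexI[of _ "replicate (count_list u x - d) x @ v"]) auto
qed

section \<open>A common exponent and central powers of letters\<close>

definition is_exponent where
  "is_exponent d \<longleftrightarrow> d > 0 \<and> (\<forall>x\<in>S. \<forall>y\<in>S. (s x ^^ d) y = y)"

lemma ex_exponent: "\<exists>d. is_exponent d"
proof -
  have "\<exists>k>0. \<forall>y\<in>S. (s x ^^ k) y = y" if x: "x \<in> S" for x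
  proof -
    \<comment> \<open>Extension by the identity turns \<open>s x\<close> into a permutation of the
      whole type, which has finite order.\<close>
    define p where "p = (\<lambda>y. if y \<in> S then s x y else y)"
    have "bij_betw p S S" using bij[OF x] by (rule bij_betw_cong[THEN iffD1, rotated]) (simp add: p_def)
    then have "p permutes S" by (rule bij_imp_permutes) (simp add: p_def)
    then have "permutation p" using finite_S by (auto simp: permutation_permutes)
    then obtain k where k: "p ^^ k = id" "k > 0" using permutation_is_nilpotent by blast
    have "(s x ^^ j) y = (p ^^ j) y \<and> (p ^^ j) y \<in> S" if "y \<in> S" for y j
      using that x by (induction j) (auto simp: p_def s_closed)
    then show ?thesis using k by (intro exI[of _ k]) auto
  qed
  then obtain k where k: "\<And>x. x \<in> S \<Longrightarrow> k x > (0::nat)" "\<And>x y. x \<in> S \<Longrightarrow> y \<in> S \<Longrightarrow> (s x ^^ k x) y = y"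
    by metis
  \<comment> \<open>The exponent of every single permutation divides the product of all of
    them.\<close>
  have "is_exponent (\<Prod>x\<in>S. k x)"
    unfolding is_exponent_def
  proof (intro conjI ballI)
    show "0 < (\<Prod>x\<in>S. k x)" using k(1) by (intro prod_pos) auto
    fix x y assume xy: "x \<in> S" "y \<in> S"
    obtain q where q: "(\<Prod>x\<in>S. k x) = k x * q" using dvd_prodI[OF finite_S xy(1), of k] by (auto elim: dvdE)
    have "((s x ^^ k x) ^^ q) y = y" using k(2)[OF xy] by (induction q) auto
    then show "(s x ^^ (\<Prod>x\<in>S. k x)) y = y" unfolding q by (simp add: funpow_mult mult.commute)
  qed
  then show ?thesis by blast
qed

text \<open>Moving a letter past x^(d k) applies \<open>s x\<close> d k times, which is the identity
  on \<open>S\<close>.\<close>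

lemma power_central:
  assumes d: "is_exponent d" and x: "x \<in> S" and u: "u \<in> lists S"
  shows "(u @ replicate (d * k) x, replicate (d * k) x @ u) \<in> E"
  using u
proof (induction u)
  case Nil
  then show ?case using x by (simp add: E_refl replicate_lists)
next
  case (Cons y u)
  have y: "y \<in> S" using Cons by auto
  have "(s x ^^ (d * k)) y = y"
  proof (induction k)
    case (Suc k)
    then show ?case using d x y by (simp add: funpow_add is_exponent_def)
  qed simp
  then have "(y # replicate (d * k) x, replicate (d * k) x @ [y]) \<in> E"
    using move_past_power[OF x y, of "d * k"] by simp
  then have "((y # replicate (d * k) x) @ u, (replicate (d * k) x @ [y]) @ u) \<in> E"
    using Cons by (intro E_right) auto
  moreover have "([y] @ u @ replicate (d * k) x, [y] @ replicate (d * k) x @ u) \<in> E"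
    using Cons y by (intro E_left) auto
  ultimately show ?case by (auto intro: E_trans)
qed

text \<open>A monomial in the central elements \<open>rep i\<close> to the power d, written as a
  word in the fixed order of \<open>is\<close>.\<close>

definition power_word :: "nat \<Rightarrow> (nat \<Rightarrow> 'x) \<Rightarrow> nat list \<Rightarrow> (nat \<Rightarrow> nat) \<Rightarrow> 'x list" where
  "power_word d rep is e = concat (map (\<lambda>i. replicate (d * e i) (rep i)) is)"

lemma power_word_lists: "(\<And>i. i \<in> set is \<Longrightarrow> rep i \<in> S) \<Longrightarrow> power_word d rep is e \<in> lists S"
  by (induction "is") (auto simp: power_word_def)

lemma power_word_central:
  assumes d: "is_exponent d" and rep: "\<And>i. i \<in> set is \<Longrightarrow> rep i \<in> S" and u: "u \<in> lists S"
  shows "(u @ power_word d rep is e, power_word d rep is e @ u) \<in> E"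
  using rep
proof (induction "is")
  case Nil
  then show ?case using u by (simp add: power_word_def E_refl)
next
  case (Cons i "is")
  let ?w = "power_word d rep is e" and ?r = "replicate (d * e i) (rep i)"
  have r: "rep i \<in> S" "?w \<in> lists S" "?r \<in> lists S" using Cons.prems by (auto intro!: power_word_lists)
  have "((u @ ?r) @ ?w, (?r @ u) @ ?w) \<in> E"
    using power_central[OF d r(1) u] r by (intro E_right) auto
  moreover have "(?r @ u @ ?w, ?r @ ?w @ u) \<in> E" using Cons r by (intro E_left) auto
  ultimately show ?case by (auto intro: E_trans simp: power_word_def)
qed

lemma power_word_Suc:
  assumes d: "is_exponent d" and rep: "\<And>i. i \<in> set is \<Longrightarrow> rep i \<in> S" and i: "i \<in> set is" "distinct is"
  shows "(replicate d (rep i) @ power_word d rep is e, power_word d rep is (e(i := Suc (e i)))) \<in> E"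
  using rep i
proof (induction "is")
  case (Cons j "is")
  let ?w = "power_word d rep is" and ?r = "replicate (d * e j) (rep j)"
  have r: "rep j \<in> S" "?w e \<in> lists S" "?r \<in> lists S" "rep i \<in> S"
    using Cons.prems by (auto intro!: power_word_lists)
  show ?case
  proof (cases "i = j")
    case True
    then have "?w (e(i := Suc (e i))) = ?w e"
      using Cons.prems unfolding power_word_def by (intro arg_cong[of _ _ concat] map_cong) auto
    then have eq: "power_word d rep (j # is) (e(i := Suc (e i))) = replicate d (rep i) @ power_word d rep (j # is) e"
      using True by (simp add: power_word_def replicate_add)
    have "replicate d (rep i) @ power_word d rep (j # is) e \<in> lists S"
      using power_word_lists[of "j # is" rep d e] Cons.prems(1) r(4) by auto
    then show ?thesis unfolding eq by (rule E_refl)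
  next
    case False
    have "(replicate d (rep i) @ ?w e, ?w (e(i := Suc (e i)))) \<in> E"
      by (rule Cons.IH) (use Cons.prems False in auto)
    then have "(?r @ replicate d (rep i) @ ?w e, ?r @ ?w (e(i := Suc (e i)))) \<in> E"
      using r by (intro E_left)
    moreover have "((replicate d (rep i) @ ?r) @ ?w e, (?r @ replicate d (rep i)) @ ?w e) \<in> E"
      by (intro E_right power_central d r replicate_lists)
    ultimately show ?thesis using False by (auto intro: E_trans simp: power_word_def)
  qed
qed simp

end


section \<open>The upper bound\<close>

lemma (in ring) diff_identities:
  assumes "a \<in> carrier R" "b \<in> carrier R" "c \<in> carrier R"
  shows "\<ominus> (a \<ominus> b) = b \<ominus> a" "(a \<ominus> b) \<oplus> (b \<ominus> c) = a \<ominus> c"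
    "c \<otimes> a \<ominus> c \<otimes> b = c \<otimes> (a \<ominus> b)" "a \<otimes> c \<ominus> b \<otimes> c = (a \<ominus> b) \<otimes> c"
proof -
  show "\<ominus> (a \<ominus> b) = b \<ominus> a" using assms(1,2) by algebra
  show "(a \<ominus> b) \<oplus> (b \<ominus> c) = a \<ominus> c" using assms by algebra
  show "c \<otimes> a \<ominus> c \<otimes> b = c \<otimes> (a \<ominus> b)" using assms by algebra
  show "a \<otimes> c \<ominus> b \<otimes> c = (a \<ominus> b) \<otimes> c" using assms by algebra
qed

locale normal_presentation_algebra = normal_presentation S s + K: field K
  for S :: "'x set" and s and K :: "('k, 'c) ring_scheme"
begin

sublocale field_monoid_algebra K "presented_monoid S rels"
  by (intro field_monoid_algebra.intro monoid_M K.field_axioms)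

definition \<mu> where "\<mu> u = mono \<one>\<^bsub>K\<^esub> (cl u)"

lemma \<mu>_closed [simp]: "u \<in> lists S \<Longrightarrow> \<mu> u \<in> carrier A"
  unfolding \<mu>_def by (intro mono_closed cl_carrier) auto

lemma \<mu>_append: "u \<in> lists S \<Longrightarrow> v \<in> lists S \<Longrightarrow> \<mu> (u @ v) = \<mu> u \<otimes>\<^bsub>A\<^esub> \<mu> v"
  unfolding \<mu>_def by (simp add: mono_mult cl_carrier cl_mult del: in_lists_conv_set)

lemma \<mu>_eq: "(u, v) \<in> E \<Longrightarrow> \<mu> u = \<mu> v"
  unfolding \<mu>_def by (simp add: cl_eq)

text \<open>The length filtration of the algebra, which takes the place of \<open>V\<close> in
  \<open>prime_chain_length_le\<close>.\<close>

definition words_upto :: "nat \<Rightarrow> ('x list set \<Rightarrow> 'k) set" where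
  "words_upto L = {f \<in> carrier A. \<forall>a. f a \<noteq> \<zero>\<^bsub>K\<^esub> \<longrightarrow> (\<exists>u\<in>lists S. length u \<le> L \<and> a = cl u)}"

lemma words_upto_mult:
  assumes f: "f \<in> words_upto m" and g: "g \<in> words_upto n"
  shows "f \<otimes>\<^bsub>A\<^esub> g \<in> words_upto (m + n)"
proof -
  have fg: "f \<in> carrier A" "g \<in> carrier A" using f g by (auto simp: words_upto_def)
  have "\<exists>u\<in>lists S. length u \<le> m + n \<and> c = cl u" if c: "(f \<otimes>\<^bsub>A\<^esub> g) c \<noteq> \<zero>\<^bsub>K\<^esub>" for c
  proof -
    have "c \<in> {c. (f \<otimes>\<^bsub>A\<^esub> g) c \<noteq> \<zero>\<^bsub>K\<^esub>}" using c by (rule CollectI)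
    then have "c \<in> (\<lambda>(a, b). a \<otimes>\<^bsub>M\<^esub> b) ` ({a. f a \<noteq> \<zero>\<^bsub>K\<^esub>} \<times> {b. g b \<noteq> \<zero>\<^bsub>K\<^esub>})"
      by (rule subsetD[OF K.monoid_algebra_mult_closed(2)[OF monoid_M fg]])
    then obtain a b where ab: "f a \<noteq> \<zero>\<^bsub>K\<^esub>" "g b \<noteq> \<zero>\<^bsub>K\<^esub>" "c = a \<otimes>\<^bsub>M\<^esub> b" by auto
    obtain u v where "u \<in> lists S" "length u \<le> m" "a = cl u" "v \<in> lists S" "length v \<le> n" "b = cl v"
      using f g ab unfolding words_upto_def by blast
    then show ?thesis using ab(3) by (intro bexI[of _ "u @ v"]) (auto simp: cl_mult)
  qed
  then show ?thesis using fg by (auto simp: words_upto_def)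
qed

lemma UN_words_upto: "carrier A \<subseteq> (\<Union>L. words_upto L)"
proof
  fix f assume f: "f \<in> carrier A"
  have "\<exists>u\<in>lists S. a = cl u" if "f a \<noteq> \<zero>\<^bsub>K\<^esub>" for a
    using A_support[OF f that] by (auto simp: carrier_M)
  then obtain u where u: "\<And>a. f a \<noteq> \<zero>\<^bsub>K\<^esub> \<Longrightarrow> u a \<in> lists S \<and> a = cl (u a)" by metis
  have "length (u a) \<le> Max ((length \<circ> u) ` {a. f a \<noteq> \<zero>\<^bsub>K\<^esub>})" if "f a \<noteq> \<zero>\<^bsub>K\<^esub>" for a
    using that f by (intro Max_ge) auto
  then have "f \<in> words_upto (Max ((length \<circ> u) ` {a. f a \<noteq> \<zero>\<^bsub>K\<^esub>}))"
    unfolding words_upto_def using f u by blast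
  then show "f \<in> (\<Union>L. words_upto L)" by blast
qed

end

locale normal_presentation_prime = normal_presentation_algebra S s K
  for S :: "'x set" and s and K :: "('k, 'c) ring_scheme" +
  fixes P
  assumes prime: "nc_prime_ideal P A"
begin

lemma P: "ideal P A" using A.nc_prime_idealD[OF prime] by blast

lemmas PD = A.idealD[OF P]

definition Z where "Z = {x \<in> S. \<mu> [x] \<in> P}"

text \<open>Normality rewrites x u f as v x f, so x f in \<open>P\<close> forces x K[A] f into
  \<open>P\<close>, and primeness applies.\<close>

lemma letter_regular:
  assumes x: "x \<in> S - Z" and f: "f \<in> carrier A" "\<mu> [x] \<otimes>\<^bsub>A\<^esub> f \<in> P"
  shows "f \<in> P"
proof -
  have "\<mu> [x] \<otimes>\<^bsub>A\<^esub> (mono \<one>\<^bsub>K\<^esub> a \<otimes>\<^bsub>A\<^esub> f) \<in> P" if a: "a \<in> carrier M" for a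
  proof -
    obtain u where u: "u \<in> lists S" "a = cl u" using a unfolding carrier_M by blast
    obtain v where v: "v \<in> lists S" "(x # u, v @ [x]) \<in> E" using letter_past_word[of x u] x u by auto
    have "\<mu> [x] \<otimes>\<^bsub>A\<^esub> (\<mu> u \<otimes>\<^bsub>A\<^esub> f) = \<mu> ([x] @ u) \<otimes>\<^bsub>A\<^esub> f"
      using x u f by (subst \<mu>_append) (auto simp: A.m_assoc)
    also have "\<dots> = \<mu> (v @ [x]) \<otimes>\<^bsub>A\<^esub> f" using \<mu>_eq[OF v(2)] by simp
    also have "\<dots> = \<mu> v \<otimes>\<^bsub>A\<^esub> (\<mu> [x] \<otimes>\<^bsub>A\<^esub> f)"
      using x v f by (subst \<mu>_append) (auto simp: A.m_assoc)
    finally have "\<mu> [x] \<otimes>\<^bsub>A\<^esub> (\<mu> u \<otimes>\<^bsub>A\<^esub> f) \<in> P" using PD(6)[OF \<mu>_closed[OF v(1)] f(2)] by simp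
    then show ?thesis unfolding \<mu>_def u(2) .
  qed
  then have "\<mu> [x] \<in> P \<or> f \<in> P" using x f by (intro nc_prime_ideal_mono[OF prime]) auto
  then show ?thesis using x by (auto simp: Z_def)
qed

text \<open>For y in \<open>Z\<close> the product x \<sigma>_x(y) = y x lies in \<open>P\<close>;
  regularity of x puts \<sigma>_x(y) into \<open>Z\<close>. Injectivity on a finite set turns the
  inclusion into equality.\<close>

lemma s_Z:
  assumes x: "x \<in> S - Z"
  shows "s x ` Z = Z"
proof (rule endo_inj_surj)
  show "finite Z" using finite_S by (rule finite_subset[rotated]) (auto simp: Z_def)
  show "inj_on (s x) Z"
    by (rule inj_on_subset[OF bij_betw_imp_inj_on[OF bij[of x]]]) (use x in \<open>auto simp: Z_def\<close>)
  show "s x ` Z \<subseteq> Z"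
  proof
    fix z assume "z \<in> s x ` Z"
    then obtain y where y: "y \<in> S" "\<mu> [y] \<in> P" "z = s x y" by (auto simp: Z_def)
    have z: "z \<in> S" using y x s_closed by auto
    have "\<mu> [x] \<otimes>\<^bsub>A\<^esub> \<mu> [z] = \<mu> [y, x]"
      using x y z E_rel[of y x] by (subst \<mu>_append[symmetric]) (auto intro: \<mu>_eq pres_cong.sym)
    also have "\<dots> = \<mu> [y] \<otimes>\<^bsub>A\<^esub> \<mu> [x]" using x y \<mu>_append[of "[y]" "[x]"] by simp
    finally have "\<mu> [x] \<otimes>\<^bsub>A\<^esub> \<mu> [z] \<in> P" using PD(7) y x by simp
    then show "z \<in> Z" using letter_regular[OF x] z by (simp add: Z_def)
  qed
qed

lemma s_compl_Z:
  assumes x: "x \<in> S - Z" and y: "y \<in> S - Z"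
  shows "s x y \<in> S - Z"
proof -
  have "s x y \<notin> s x ` Z"
    using y x bij[of x] by (auto simp: bij_betw_def Z_def dest: inj_onD)
  then show ?thesis using s_Z[OF x] s_closed x y by auto
qed

section \<open>Congruence of words modulo the prime\<close>

definition cong where
  "cong u v \<longleftrightarrow> u \<in> lists S \<and> v \<in> lists S \<and> \<mu> u \<ominus>\<^bsub>A\<^esub> \<mu> v \<in> P"

lemma cong_E: "(u, v) \<in> E \<Longrightarrow> cong u v"
  using pres_cong_lists[of u v S rels] \<mu>_eq[of u v] PD(2) by (auto simp: cong_def A.r_neg A.minus_eq)

lemma cong_sym: "cong u v \<Longrightarrow> cong v u"
proof -
  assume uv: "cong u v"
  then have "\<ominus>\<^bsub>A\<^esub> (\<mu> u \<ominus>\<^bsub>A\<^esub> \<mu> v) \<in> P" using PD(4) by (simp add: cong_def)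
  moreover have "\<mu> u \<in> carrier A" "\<mu> v \<in> carrier A" using uv by (simp_all add: cong_def)
  then have "\<ominus>\<^bsub>A\<^esub> (\<mu> u \<ominus>\<^bsub>A\<^esub> \<mu> v) = \<mu> v \<ominus>\<^bsub>A\<^esub> \<mu> u"
    by (rule A.diff_identities(1)[OF _ _ A.zero_closed])
  ultimately show ?thesis using uv by (simp add: cong_def)
qed

lemma cong_trans:
  assumes "cong u v" "cong v w"
  shows "cong u w"
proof -
  have "(\<mu> u \<ominus>\<^bsub>A\<^esub> \<mu> v) \<oplus>\<^bsub>A\<^esub> (\<mu> v \<ominus>\<^bsub>A\<^esub> \<mu> w) \<in> P" using PD(3) assms by (simp add: cong_def)
  moreover have "\<mu> u \<in> carrier A" "\<mu> v \<in> carrier A" "\<mu> w \<in> carrier A" using assms by (simp_all add: cong_def)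
  then have "(\<mu> u \<ominus>\<^bsub>A\<^esub> \<mu> v) \<oplus>\<^bsub>A\<^esub> (\<mu> v \<ominus>\<^bsub>A\<^esub> \<mu> w) = \<mu> u \<ominus>\<^bsub>A\<^esub> \<mu> w"
    by (rule A.diff_identities(2))
  ultimately show ?thesis using assms by (simp add: cong_def)
qed

lemma cong_append_left:
  assumes uv: "cong u v" and w: "w \<in> lists S"
  shows "cong (w @ u) (w @ v)"
proof -
  have l: "u \<in> lists S" "v \<in> lists S" using uv by (auto simp: cong_def)
  have c: "\<mu> u \<in> carrier A" "\<mu> v \<in> carrier A" "\<mu> w \<in> carrier A" using l w by simp_all
  have "\<mu> (w @ u) \<ominus>\<^bsub>A\<^esub> \<mu> (w @ v) = \<mu> w \<otimes>\<^bsub>A\<^esub> (\<mu> u \<ominus>\<^bsub>A\<^esub> \<mu> v)"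
    unfolding \<mu>_append[OF w l(1)] \<mu>_append[OF w l(2)] by (rule A.diff_identities(3)[OF c])
  then show ?thesis using PD(6) uv w c l by (simp add: cong_def)
qed

lemma cong_append_right:
  assumes uv: "cong u v" and w: "w \<in> lists S"
  shows "cong (u @ w) (v @ w)"
proof -
  have l: "u \<in> lists S" "v \<in> lists S" using uv by (auto simp: cong_def)
  have c: "\<mu> u \<in> carrier A" "\<mu> v \<in> carrier A" "\<mu> w \<in> carrier A" using l w by simp_all
  have "\<mu> (u @ w) \<ominus>\<^bsub>A\<^esub> \<mu> (v @ w) = (\<mu> u \<ominus>\<^bsub>A\<^esub> \<mu> v) \<otimes>\<^bsub>A\<^esub> \<mu> w"
    unfolding \<mu>_append[OF l(1) w] \<mu>_append[OF l(2) w] by (rule A.diff_identities(4)[OF c])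
  then show ?thesis using PD(7) uv w c l by (simp add: cong_def)
qed

lemma cong_cancel:
  assumes x: "x \<in> S - Z" and uv: "u \<in> lists S" "v \<in> lists S" "cong (x # u) (x # v)"
  shows "cong u v"
proof -
  have c: "\<mu> u \<in> carrier A" "\<mu> v \<in> carrier A" "\<mu> [x] \<in> carrier A" using uv x by simp_all
  have "\<mu> (x # u) \<ominus>\<^bsub>A\<^esub> \<mu> (x # v) = \<mu> [x] \<otimes>\<^bsub>A\<^esub> \<mu> u \<ominus>\<^bsub>A\<^esub> \<mu> [x] \<otimes>\<^bsub>A\<^esub> \<mu> v"
    using \<mu>_append[of "[x]" u] \<mu>_append[of "[x]" v] x uv by simp
  also have "\<dots> = \<mu> [x] \<otimes>\<^bsub>A\<^esub> (\<mu> u \<ominus>\<^bsub>A\<^esub> \<mu> v)" by (rule A.diff_identities(3)[OF c])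
  finally have "\<mu> u \<ominus>\<^bsub>A\<^esub> \<mu> v \<in> P" using letter_regular[OF x] uv c by (simp add: cong_def)
  then show ?thesis using uv by (simp add: cong_def)
qed

text \<open>Since \<open>y\<^sup>d x = x (\<sigma>\<^sub>x y)\<^sup>d\<close> and \<open>y\<^sup>d\<close> is central, regularity of \<open>x\<close> modulo \<open>P\<close> identifies
  \<open>y\<^sup>d\<close> with \<open>(\<sigma>\<^sub>x y)\<^sup>d\<close>.\<close>

lemma power_cong:
  assumes d: "is_exponent d" and x: "x \<in> S - Z" and y: "y \<in> S"
  shows "cong (replicate d y) (replicate d (s x y))"
proof (rule cong_cancel[OF x])
  have xS: "x \<in> S" using x by simp
  have "(x # replicate d y, replicate d y @ [x]) \<in> E"
    using power_central[OF d y, of "[x]" 1] xS by simp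
  then have "(x # replicate d y, x # replicate d (s x y)) \<in> E"
    by (rule E_trans[OF _ power_past_letter[OF xS y]])
  then show "cong (x # replicate d y) (x # replicate d (s x y))" by (rule cong_E)
  show "replicate d y \<in> lists S" "replicate d (s x y) \<in> lists S"
    using replicate_lists[OF y] replicate_lists[OF s_closed[OF xS y]] by blast+
qed

lemma word_mem_P:
  assumes "u \<in> lists S" "u \<notin> lists (S - Z)"
  shows "\<mu> u \<in> P"
proof -
  obtain x where x: "x \<in> set u" "x \<in> Z" using assms by (auto simp: Z_def)
  then obtain a b where u: "u = a @ [x] @ b" by (auto dest: split_list)
  have "\<mu> u = \<mu> a \<otimes>\<^bsub>A\<^esub> (\<mu> [x] \<otimes>\<^bsub>A\<^esub> \<mu> b)" 
    using \<mu>_append[of a "[x] @ b"] \<mu>_append[of "[x]" b] assms(1) by (simp add: u)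
  then show ?thesis using x assms u PD by (auto simp: Z_def)
qed

end


section \<open>Normal forms modulo the prime and growth of the quotient\<close>

context normal_presentation_prime
begin

text \<open>A word longer than \<open>card S * d\<close> contains a collectable power x^d. Modulo
  \<open>P\<close> it equals the d-th power of a representative, is central, and joins the power
  word, while a shorter word remains for the induction.\<close>

lemma reduce_word:
  assumes d: "is_exponent d" and rep: "\<And>i. i < c \<Longrightarrow> rep i \<in> S - Z"
    and cover: "\<And>x. x \<in> S - Z \<Longrightarrow> \<exists>i<c. cong (replicate d x) (replicate d (rep i))"
    and u: "u \<in> lists (S - Z)"
  shows "\<exists>e\<in>{..<c} \<rightarrow>\<^sub>E {..length u}. \<exists>w\<in>lists S. length w \<le> card S * d \<and>
    cong u (power_word d rep [0..<c] e @ w)"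
  using u
proof (induction "length u" arbitrary: u rule: less_induct)
  case less
  have uS: "u \<in> lists S" using less.prems by auto
  show ?case
  proof (cases "length u \<le> card S * d")
    case True
    \<comment> \<open>Exponents zero, made extensional so that exponent functions form a finite set
      that can be counted.\<close>
    have "power_word d rep [0..<c] (restrict (\<lambda>i. 0) {..<c}) = []" by (simp add: power_word_def)
    then show ?thesis using True uS cong_E[OF E_refl[OF uS]]
      by (intro bexI[of _ "restrict (\<lambda>i. 0) {..<c}"] bexI[of _ u]) auto
  next
    case False
    then obtain x v where x: "x \<in> S - Z" and v: "v \<in> lists (S - Z)" and uv: "(u, replicate d x @ v) \<in> E"
      using long_word_power[of "S - Z" u d] s_compl_Z less.prems by auto
    have vS: "v \<in> lists S" and d0: "0 < d" using v d by (auto simp: is_exponent_def)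
    have len: "length u = d + length v" using E_length[OF uv] by simp
    obtain e w where e: "e \<in> {..<c} \<rightarrow>\<^sub>E {..length v}" and w: "w \<in> lists S" "length w \<le> card S * d"
      and cv: "cong v (power_word d rep [0..<c] e @ w)"
      using less.hyps[of v] v len d0 by auto
    obtain i where i: "i < c" "cong (replicate d x) (replicate d (rep i))" using cover[OF x] by blast
    let ?e = "e(i := Suc (e i))"
    have reps: "rep j \<in> S" if "j \<in> set [0..<c]" for j using rep that by auto
    have "cong u (replicate d x @ v)" by (rule cong_E[OF uv])
    moreover have "cong (replicate d x @ v) (replicate d (rep i) @ v)"
      by (rule cong_append_right[OF i(2) vS])
    moreover have "cong (replicate d (rep i) @ v) (replicate d (rep i) @ power_word d rep [0..<c] e @ w)"
      by (rule cong_append_left[OF cv]) (use reps[of i] i(1) in auto)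
    moreover have "cong ((replicate d (rep i) @ power_word d rep [0..<c] e) @ w) (power_word d rep [0..<c] ?e @ w)"
      by (rule cong_append_right[OF cong_E[OF power_word_Suc[OF d reps]] w(1)]) (use i(1) in auto)
    ultimately have "cong u (power_word d rep [0..<c] ?e @ w)" using cong_trans by (metis append_assoc)
    \<comment> \<open>One more unit in an exponent is paid for by d > 0 letters of u, so exponents
      never exceed the length.\<close>
    moreover have "?e \<in> {..<c} \<rightarrow>\<^sub>E {..length u}"
    proof (rule PiE_I)
      fix j assume "j \<in> {..<c}"
      then have "e j \<le> length v" using PiE_mem[OF e] by auto
      then show "?e j \<in> {..length u}" using len d0 by auto
    qed (use e i(1) in \<open>auto simp: PiE_def extensional_def\<close>)
    ultimately show ?thesis using w by blast
  qed
qed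

text \<open>The normal form is used twice: with power words as central coefficients, the short
  remainders span modulo \<open>P\<close> over the centre; with power words kept in the spanning
  set, it bounds dimensions over the scalars.\<close>

theorem chain_length_le:
  assumes d: "is_exponent d" and rep: "\<And>i. i < c \<Longrightarrow> rep i \<in> S - Z"
    and cover: "\<And>x. x \<in> S - Z \<Longrightarrow> \<exists>i<c. cong (replicate d x) (replicate d (rep i))"
    and chain: "\<And>i. i \<le> n \<Longrightarrow> nc_prime_ideal (Q i) A" "\<And>i. i < n \<Longrightarrow> Q i \<subset> Q (Suc i)" "Q 0 = P"
  shows "n \<le> c"
proof -
  interpret F: central_subring A scalars by (rule central_subring_scalars)
  interpret C: central_subring A A.centre by (rule A.central_subring_centre)
  define B where "B = card S * d"
  define W where "W = {w. set w \<subseteq> S \<and> length w \<le> B}"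
  define pw where "pw = power_word d rep [0..<c]"
  \<comment> \<open>Spanning set for words of length at most L: each of the c exponents takes L + 1
    values, whence the bound \<open>card W * (L + 1) ^ c\<close>.\<close>
  define T where "T = (\<lambda>L. (\<lambda>(e, w). \<mu> (pw e @ w)) ` (({..<c} \<rightarrow>\<^sub>E {..L}) \<times> W))"
  have finW: "finite W" unfolding W_def using finite_S by (rule finite_lists_length_le)
  have WS: "w \<in> lists S" if "w \<in> W" for w using that by (auto simp: W_def)
  have reps: "rep j \<in> S" if "j \<in> set [0..<c]" for j using rep that by auto
  have pwS: "pw e \<in> lists S" for e unfolding pw_def using reps by (rule power_word_lists)
  have finT: "finite (T L)" for L unfolding T_def using finW by (intro finite_imageI finite_cartesian_product finite_PiE) auto
  have cardT: "card (T L) \<le> card W * (L + 1) ^ c" for L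
  proof -
    have "card (T L) \<le> card (({..<c} \<rightarrow>\<^sub>E {..L}) \<times> W)"
      unfolding T_def using finW by (intro card_image_le finite_cartesian_product finite_PiE) auto
    then show ?thesis by (simp add: card_cartesian_product card_PiE mult.commute)
  qed
  obtain ws where ws: "set ws = \<mu> ` W" using finite_list[of "\<mu> ` W"] finW by auto
  have "\<exists>ts. set ts = T L \<and> length ts = card (T L)" for L
    using finite_distinct_list[OF finT[of L]] distinct_card by metis
  then obtain ts where ts: "\<And>L. set (ts L) = T L" "\<And>L. length (ts L) = card (T L)" by metis
  have wsA: "set ws \<subseteq> carrier A" unfolding ws using WS by auto
  have tsA: "set (ts L) \<subseteq> carrier A" for L unfolding ts T_def using WS pwS by (auto simp del: in_lists_conv_set)
  note cC = C.cspan_closed[OF P wsA] and cF = F.cspan_closed[OF P tsA]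
  have scale: "mono k (cl u) = mono k \<one>\<^bsub>M\<^esub> \<otimes>\<^bsub>A\<^esub> \<mu> u" if "k \<in> carrier K" "u \<in> lists S" for k u
    unfolding \<mu>_def by (rule mono_scale[OF that(1) cl_carrier[OF that(2)]])
  have in_scalars: "mono k \<one>\<^bsub>M\<^esub> \<in> scalars" if "k \<in> carrier K" for k using that by (simp add: scalars_def)
  have reduce: "\<exists>e\<in>{..<c} \<rightarrow>\<^sub>E {..length u}. \<exists>w\<in>W. \<exists>p\<in>P. \<mu> u = \<mu> (pw e @ w) \<oplus>\<^bsub>A\<^esub> p"
    if u: "u \<in> lists S" "\<mu> u \<notin> P" for u
  proof -
    have "u \<in> lists (S - Z)" using word_mem_P u by blast
    then obtain e w where e: "e \<in> {..<c} \<rightarrow>\<^sub>E {..length u}" and w: "w \<in> lists S" "length w \<le> B"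
      and cong: "cong u (pw e @ w)"
      using reduce_word[OF d rep cover, of u] unfolding B_def pw_def by blast
    have W: "w \<in> W" using w by (auto simp: W_def)
    have c: "\<mu> u \<in> carrier A" "\<mu> (pw e @ w) \<in> carrier A" using cong by (simp_all add: cong_def)
    have "\<mu> u = \<mu> (pw e @ w) \<oplus>\<^bsub>A\<^esub> (\<mu> u \<ominus>\<^bsub>A\<^esub> \<mu> (pw e @ w))"
      using c by (simp add: A.minus_eq A.a_lcomm A.r_neg)
    then show ?thesis using e W cong unfolding cong_def by blast
  qed
  show ?thesis
  proof (rule A.prime_chain_length_le[where F = scalars and P = Q and ws = ws and V = words_upto and ts = ts])
    show "central_subring A scalars" by (rule central_subring_scalars)
    show "\<exists>h\<in>scalars. h \<otimes>\<^bsub>A\<^esub> k = \<one>\<^bsub>A\<^esub>" if "k \<in> scalars" "k \<noteq> \<zero>\<^bsub>A\<^esub>" for k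
      by (rule scalars_inverse[OF that])
    show "carrier A \<subseteq> C.cspan (Q 0) ws"
    proof
      fix f assume f: "f \<in> carrier A"
      show "f \<in> C.cspan (Q 0) ws"
        unfolding chain(3)
      proof (rule A_induct[OF f])
        show "\<zero>\<^bsub>A\<^esub> \<in> C.cspan P ws" using cC(2) PD(2) by blast
        fix a k assume a: "a \<in> carrier M" and k: "k \<in> carrier K"
        obtain u where u: "u \<in> lists S" "a = cl u" using a unfolding carrier_M by blast
        have kc: "mono k \<one>\<^bsub>M\<^esub> \<in> A.centre" "mono k \<one>\<^bsub>M\<^esub> \<in> carrier A"
          using F.central[OF in_scalars[OF k]] F.C_carr[OF in_scalars[OF k]] by (auto simp: A.centre_def)
        have "\<mu> u \<in> C.cspan P ws"
        proof (cases "\<mu> u \<in> P")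
          case True
          then show ?thesis using cC(2) by blast
        next
          case False
          then obtain e w p where ewp: "w \<in> W" "p \<in> P" "\<mu> u = \<mu> (pw e @ w) \<oplus>\<^bsub>A\<^esub> p"
            using reduce[OF u(1)] by blast
          \<comment> \<open>The power word may serve as a coefficient because it is central.\<close>
          have "\<mu> (pw e) \<in> A.centre" unfolding \<mu>_def
          proof (rule mono_one_central)
            fix b assume "b \<in> carrier M"
            then obtain v where v: "v \<in> lists S" "b = cl v" unfolding carrier_M by blast
            have "(v @ pw e, pw e @ v) \<in> E" unfolding pw_def by (rule power_word_central[OF d reps v(1)])
            then show "cl (pw e) \<otimes>\<^bsub>M\<^esub> b = b \<otimes>\<^bsub>M\<^esub> cl (pw e)"
              unfolding v(2) cl_mult[OF pwS v(1)] cl_mult[OF v(1) pwS] by (rule cl_eq[symmetric])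
          qed (simp_all add: cl_carrier[OF pwS])
          then have "\<mu> (pw e) \<otimes>\<^bsub>A\<^esub> \<mu> w \<in> C.cspan P ws"
            using ws ewp(1) by (intro C.cspan_generator[OF P wsA]) auto
          then show ?thesis unfolding ewp(3) \<mu>_append[OF pwS WS[OF ewp(1)]] using cC(2,3) ewp(2) by blast
        qed
        then show "mono k a \<in> C.cspan P ws" unfolding u(2) scale[OF k u(1)] by (rule cC(4)[OF kc(1)])
      qed (rule cC(3))
    qed
    show "words_upto L \<subseteq> F.cspan (Q 0) (ts L)" for L
    proof
      fix f assume f: "f \<in> words_upto L"
      then have fA: "f \<in> carrier A" by (simp add: words_upto_def)
      show "f \<in> F.cspan (Q 0) (ts L)"
        unfolding chain(3)
      proof (rule A_induct[OF fA])
        show "\<zero>\<^bsub>A\<^esub> \<in> F.cspan P (ts L)" using cF(2) PD(2) by blast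
        fix a k assume a: "f a \<noteq> \<zero>\<^bsub>K\<^esub>" and k: "k \<in> carrier K"
        obtain u where u: "u \<in> lists S" "a = cl u" "length u \<le> L" using f a unfolding words_upto_def by blast
        have "\<mu> u \<in> F.cspan P (ts L)"
        proof (cases "\<mu> u \<in> P")
          case True
          then show ?thesis using cF(2) by blast
        next
          case False
          then obtain e w p where ewp: "e \<in> {..<c} \<rightarrow>\<^sub>E {..length u}" "w \<in> W" "p \<in> P"
            "\<mu> u = \<mu> (pw e @ w) \<oplus>\<^bsub>A\<^esub> p"
            using reduce[OF u(1)] by blast
          have "e \<in> {..<c} \<rightarrow>\<^sub>E {..L}" using ewp(1) u(3) by (auto simp: PiE_def Pi_def)
          then have T: "\<mu> (pw e @ w) \<in> set (ts L)" unfolding ts(1) T_def using ewp(2) by force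
          have "\<one>\<^bsub>A\<^esub> \<otimes>\<^bsub>A\<^esub> \<mu> (pw e @ w) \<in> F.cspan P (ts L)"
            by (rule F.cspan_generator[OF P tsA T F.C_one])
          then have "\<mu> (pw e @ w) \<in> F.cspan P (ts L)" using T tsA[of L] by auto
          then show ?thesis unfolding ewp(4) using cF(2,3) ewp(3) by blast
        qed
        then show "mono k a \<in> F.cspan P (ts L)" unfolding u(2) scale[OF k u(1)] by (rule cF(4)[OF in_scalars[OF k]])
      qed (rule cF(3))
    qed
    show "length (ts L) \<le> card W * (L + 1) ^ c" for L unfolding ts(2) by (rule cardT)
    show "\<one>\<^bsub>A\<^esub> \<in> words_upto 0"
      unfolding words_upto_def by (auto simp: A_one one_M intro!: bexI[of _ "[]"])
    show "words_upto a \<subseteq> words_upto b" if "a \<le> b" for a b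
      unfolding words_upto_def using that by (blast intro: order_trans)
    show "words_upto a \<subseteq> carrier A" for a unfolding words_upto_def by blast
    show "set ws \<subseteq> carrier A" by (rule wsA)
    show "set (ts L) \<subseteq> carrier A" for L by (rule tsA)
    show "carrier A \<subseteq> (\<Union>L. words_upto L)" by (rule UN_words_upto)
    show "nc_prime_ideal (Q i) A" if "i \<le> n" for i by (rule chain(1)[OF that])
    show "Q i \<subset> Q (Suc i)" if "i < n" for i by (rule chain(2)[OF that])
    show "f \<otimes>\<^bsub>A\<^esub> g \<in> words_upto (a + b)" if "f \<in> words_upto a" "g \<in> words_upto b" for a b f g
      by (rule words_upto_mult[OF that])
  qed
qed

end


section \<open>The lower bound\<close>

context normal_presentation_algebra
begin

text \<open>\<open>\<psi> k\<close> describes the map to a polynomial ring that kills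
  \<open>Z\<close> and all variables of index below k. Its kernels for k = 0, ..., c form the
  chain.\<close>

theorem ex_chain:
  assumes Z: "\<And>x. x \<in> S - Z \<Longrightarrow> s x ` Z = Z" "Z \<subseteq> S"
    and \<iota>: "\<And>x z. x \<in> S - Z \<Longrightarrow> z \<in> S - Z \<Longrightarrow> \<iota> (s z x) = \<iota> x"
    and surj: "\<And>i. i < c \<Longrightarrow> \<exists>x\<in>S - Z. \<iota> x = i"
  shows "\<exists>Q. (\<forall>i\<le>c. nc_prime_ideal (Q i) A) \<and> (\<forall>i<c. Q i \<subset> Q (Suc i))"
proof -
  define ok where "ok = (\<lambda>k x. x \<notin> Z \<and> k \<le> \<iota> x)"
  define wt where "wt = (\<lambda>k u. if \<forall>x\<in>set u. ok k x then Some (mset (map \<iota> u)) else None)"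
  \<comment> \<open>The weight is read off a chosen representing word; \<open>wt_E\<close> makes the
    choice immaterial.\<close>
  define \<psi> where "\<psi> = (\<lambda>(k::nat) a. wt k (SOME u. u \<in> lists S \<and> a = cl u))"
  have s_mem: "s z x \<in> Z \<longleftrightarrow> x \<in> Z" if z: "z \<in> S - Z" and x: "x \<in> S" for x z
    using inj_on_image_mem_iff[OF bij_betw_imp_inj_on[OF bij] x Z(2)] Z(1)[OF z] z by blast
  have wt_append: "wt k (u @ v) = (case wt k u of None \<Rightarrow> None | Some m \<Rightarrow> map_option ((+) m) (wt k v))" for k u v
    by (auto simp: wt_def)
  have wt_E: "wt k u = wt k v" if "(u, v) \<in> E" for k u v
    using that
  proof induction
    \<comment> \<open>If z survives, \<open>s z\<close> preserves both \<open>Z\<close> and the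
      orbit index of letters outside \<open>Z\<close>; if z is killed, both sides have weight
      \<open>None\<close>.\<close>
    case (rel u v)
    then obtain x z where uv: "u = [x, z]" "v = [z, s z x]" and xz: "x \<in> S" "z \<in> S" by auto
    show ?case
    proof (cases "ok k z")
      case True
      then have z: "z \<in> S - Z" using xz by (simp add: ok_def)
      then have "ok k (s z x) \<longleftrightarrow> ok k x" "ok k x \<Longrightarrow> \<iota> (s z x) = \<iota> x"
        using s_mem[OF z xz(1)] \<iota>[OF _ z, of x] xz by (auto simp: ok_def)
      then show ?thesis using True by (auto simp: wt_def uv)
    qed (auto simp: wt_def uv)
  qed (simp_all add: wt_append split: option.split)
  have \<psi>: "\<psi> k (cl u) = wt k u" if u: "u \<in> lists S" for k u
  proof -
    have "(SOME v. v \<in> lists S \<and> cl u = cl v) \<in> lists S \<and> cl u = cl (SOME v. v \<in> lists S \<and> cl u = cl v)"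
      by (rule someI[of _ u]) (use u in blast)
    then have "(u, SOME v. v \<in> lists S \<and> cl u = cl v) \<in> E" using cl_eq_iff[OF u] by blast
    then show ?thesis unfolding \<psi>_def by (rule wt_E[symmetric])
  qed
  have graded: "graded_monoid_algebra K M (\<psi> k)" for k
  proof (intro graded_monoid_algebra.intro graded_monoid_algebra_axioms.intro field_monoid_algebra_axioms)
    fix a b assume ab: "a \<in> carrier M" "b \<in> carrier M"
    obtain u v where uv: "u \<in> lists S" "a = cl u" "v \<in> lists S" "b = cl v"
      using ab unfolding carrier_M by blast
    have "u @ v \<in> lists S" using uv by auto
    then show "\<psi> k (a \<otimes>\<^bsub>M\<^esub> b) = (case \<psi> k a of None \<Rightarrow> None | Some m \<Rightarrow> map_option ((+) m) (\<psi> k b))"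
      unfolding uv(2,4) cl_mult[OF uv(1,3)] \<psi>[OF uv(1)] \<psi>[OF uv(3)] by (simp only: \<psi> wt_append)
  next
    show "\<psi> k \<one>\<^bsub>M\<^esub> \<noteq> None" using \<psi>[of "[]" k] by (simp add: one_M wt_def)
  qed
  interpret G: graded_monoid_algebra K M "\<psi> k" for k by (rule graded)
  have sub: "G.kernel k \<subseteq> G.kernel (Suc k)" for k
  proof
    fix f assume f: "f \<in> G.kernel k"
    note fA = G.kernelD(1)[OF f]
    have "G.cf (Suc k) f v = \<zero>\<^bsub>K\<^esub>" for v
    \<comment> \<open>A monomial whose indices all exceed k has the same coefficient at stages k and
      k + 1; any other monomial has coefficient zero at stage k + 1.\<close>
    proof (cases "\<forall>i\<in>#v. Suc k \<le> i")
      case True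
      have "\<psi> (Suc k) a = Some v \<longleftrightarrow> \<psi> k a = Some v" if a: "f a \<noteq> \<zero>\<^bsub>K\<^esub>" for a
      proof -
        obtain u where u: "u \<in> lists S" "a = cl u" using A_support[OF fA a] unfolding carrier_M by blast
        have "wt (Suc k) u = Some v \<longleftrightarrow> wt k u = Some v" using True by (auto simp: wt_def ok_def dest: Suc_leD)
        then show ?thesis by (simp only: u(2) \<psi>[OF u(1)])
      qed
      then have "G.cf (Suc k) f v = G.cf k f v" unfolding G.cf_def by (intro ev_cong fA) auto
      then show ?thesis using G.kernelD(2)[OF f] by simp
    next
      case False
      have "\<psi> (Suc k) a \<noteq> Some v" if a: "f a \<noteq> \<zero>\<^bsub>K\<^esub>" for a
      proof -
        obtain u where u: "u \<in> lists S" "a = cl u" using A_support[OF fA a] unfolding carrier_M by blast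
        have "wt (Suc k) u \<noteq> Some v" using False by (auto simp: wt_def ok_def)
        then show ?thesis unfolding u(2) \<psi>[OF u(1)] .
      qed
      then have "G.cf (Suc k) f v = ev f (\<lambda>a. \<zero>\<^bsub>K\<^esub>)" unfolding G.cf_def by (intro ev_cong fA) auto
      then show ?thesis using ev_null[OF fA] by simp
    qed
    then show "f \<in> G.kernel (Suc k)" using fA by (intro G.kernelI)
  qed
  have neq: "G.kernel k \<noteq> G.kernel (Suc k)" if k: "k < c" for k
  proof -
    \<comment> \<open>A letter of index k survives at stage k and is killed at stage k + 1, so it
      separates the two kernels.\<close>
    obtain x where x: "x \<in> S" "x \<notin> Z" "\<iota> x = k" using surj[OF k] by blast
    have l: "[x] \<in> lists S" using x by simp
    have "mono \<one>\<^bsub>K\<^esub> (cl [x]) \<in> G.kernel (Suc k)" "mono \<one>\<^bsub>K\<^esub> (cl [x]) \<notin> G.kernel k"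
      unfolding G.mono_in_kernel_iff[OF cl_carrier[OF l]] \<psi>[OF l] using x by (auto simp: wt_def ok_def)
    then show ?thesis by blast
  qed
  show ?thesis using G.nc_prime_kernel sub neq by (intro exI[of _ G.kernel]) blast
qed

end

section \<open>Orbits of the generated permutation group\<close>

context normal_presentation
begin

definition perm_group where
  "perm_group Y = (BijGroup S)\<lparr>carrier := generate (BijGroup S) ((\<lambda>x. restrict (s x) S) ` Y)\<rparr>"

abbreviation orb where "orb Y \<equiv> orbit (perm_group Y) (\<lambda>g. g)"

lemma orb_eq: "orb Y y = {g y | g. g \<in> generate (BijGroup S) ((\<lambda>x. restrict (s x) S) ` Y)}"
  by (simp add: orbit_def perm_group_def)

lemma restrict_Bij: "x \<in> S \<Longrightarrow> restrict (s x) S \<in> Bij S"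
  using bij[of x] by (auto simp: Bij_def bij_betw_restrict_eq)

lemma generate_Bij:
  assumes "Y \<subseteq> S" "g \<in> generate (BijGroup S) ((\<lambda>x. restrict (s x) S) ` Y)"
  shows "g \<in> Bij S"
  using group.generate_in_carrier[OF group_BijGroup, of "(\<lambda>x. restrict (s x) S) ` Y" S g] assms restrict_Bij
  by (auto simp: BijGroup_def)

text \<open>Induction over the generated group: a relation that is an equivalence on the complement
  of \<open>Z\<close> and holds along every generator step joins each point to its whole orbit. It
  is later applied to congruence of d-th powers.\<close>

lemma generate_related:
  assumes Z: "\<And>x. x \<in> S - Z \<Longrightarrow> s x ` Z = Z" "Z \<subseteq> S"
    and Rel: "\<And>x y. x \<in> S - Z \<Longrightarrow> y \<in> S - Z \<Longrightarrow> Rel y (s x y)" "\<And>y. y \<in> S - Z \<Longrightarrow> Rel y y"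
      "\<And>x y. Rel x y \<Longrightarrow> Rel y x" "\<And>x y z. Rel x y \<Longrightarrow> Rel y z \<Longrightarrow> Rel x z"
    and g: "g \<in> generate (BijGroup S) ((\<lambda>x. restrict (s x) S) ` (S - Z))" and y: "y \<in> S - Z"
  shows "g y \<in> S - Z \<and> Rel y (g y)"
  using g y
proof (induction arbitrary: y)
  case one
  then show ?case using Rel(2) by (simp add: BijGroup_def)
next
  case (incl h)
  then obtain x where x: "x \<in> S - Z" "h = restrict (s x) S" by blast
  have "s x y \<notin> Z"
  proof
    assume "s x y \<in> Z"
    then obtain z where "z \<in> Z" "s x y = s x z" using Z(1)[OF x(1)] by (metis imageE)
    then show False using incl x(1) Z(2) bij[of x] by (auto simp: bij_betw_def dest!: inj_onD)
  qed
  then show ?case using x incl Rel(1) s_closed by auto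
next
  case (inv h)
  then obtain x where x: "x \<in> S - Z" "h = restrict (s x) S" by blast
  have h: "h \<in> Bij S" using restrict_Bij x by auto
  \<comment> \<open>An inverse generator is read backwards: y is the image of y', which lies outside
    \<open>Z\<close> because generators preserve \<open>Z\<close>, and symmetry reverses the
    relation.\<close>
  define y' where "y' = inv_into S h y"
  have "h ` S = S" using h by (auto simp: Bij_def bij_betw_def)
  then have y': "y' \<in> S" "h y' = y" using inv.prems unfolding y'_def by (auto simp: inv_into_into f_inv_into_f)
  then have "s x y' = y" using x by simp
  moreover have "y' \<notin> Z" using Z(1)[OF x(1)] inv.prems calculation by blast
  moreover have "(inv\<^bsub>BijGroup S\<^esub> h) y = y'" using inv.prems by (simp add: inv_BijGroup[OF h] y'_def)
  ultimately show ?case using Rel(1)[OF x(1), of y'] Rel(3) y' by auto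
next
  case (eng g h)
  have "g \<in> Bij S" "h \<in> Bij S" using generate_Bij eng.hyps by blast+
  then have "(g \<otimes>\<^bsub>BijGroup S\<^esub> h) y = g (h y)" using eng.prems by (simp add: BijGroup_def compose_def)
  then show ?case using eng.IH eng.prems Rel(4) by metis
qed

lemma orb_self: "y \<in> S \<Longrightarrow> y \<in> orb Y y"
proof -
  assume "y \<in> S"
  then have "y = \<one>\<^bsub>BijGroup S\<^esub> y" by (simp add: BijGroup_def)
  then show ?thesis unfolding orb_eq using generate.one by blast
qed

text \<open>Right multiplication by the generator and by its inverse translates group elements
  applied to one point into group elements applied to the other.\<close>

lemma orb_step:
  assumes Y: "Y \<subseteq> S" and x: "x \<in> Y" and y: "y \<in> S"
  shows "orb Y (s x y) = orb Y y"
proof -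
  interpret group "BijGroup S" by (rule group_BijGroup)
  let ?H = "(\<lambda>x. restrict (s x) S) ` Y"
  define h where "h = restrict (s x) S"
  have h: "h \<in> ?H" "h \<in> Bij S" using x Y restrict_Bij by (auto simp: h_def)
  have car: "carrier (BijGroup S) = Bij S" by (simp add: BijGroup_def)
  have hc: "h \<in> carrier (BijGroup S)" using h(2) by (simp only: car)
  have sxy: "s x y = h y" "h y \<in> S" using x y Y s_closed by (auto simp: h_def)
  have app: "(g \<otimes>\<^bsub>BijGroup S\<^esub> k) z = g (k z)" if "g \<in> Bij S" "k \<in> Bij S" "z \<in> S" for g k z
    using that by (simp add: BijGroup_def compose_def)
  have invB: "inv\<^bsub>BijGroup S\<^esub> h \<in> Bij S" using inv_closed[OF hc] by (simp only: car)
  have inv_h: "(inv\<^bsub>BijGroup S\<^esub> h) (h y) = y"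
    using app[OF invB h(2) y] l_inv[OF hc] y by (simp add: BijGroup_def)
  show ?thesis
  proof
    show "orb Y (s x y) \<subseteq> orb Y y"
    proof
      fix t assume "t \<in> orb Y (s x y)"
      then obtain g where g: "g \<in> generate (BijGroup S) ?H" "t = g (h y)" unfolding orb_eq sxy by blast
      have "t = (g \<otimes>\<^bsub>BijGroup S\<^esub> h) y" using g app[OF generate_Bij[OF Y g(1)] h(2) y] by simp
      then show "t \<in> orb Y y" unfolding orb_eq using generate.eng[OF g(1) generate.incl[OF h(1)]] by blast
    qed
    show "orb Y y \<subseteq> orb Y (s x y)"
    proof
      fix t assume "t \<in> orb Y y"
      then obtain g where g: "g \<in> generate (BijGroup S) ?H" "t = g y" unfolding orb_eq by blast
      have "t = (g \<otimes>\<^bsub>BijGroup S\<^esub> inv\<^bsub>BijGroup S\<^esub> h) (h y)"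
        using g inv_h app[OF generate_Bij[OF Y g(1)] invB sxy(2)] by simp
      then show "t \<in> orb Y (s x y)" unfolding orb_eq sxy
        using generate.eng[OF g(1) generate.inv[OF h(1)]] by blast
    qed
  qed
qed

text \<open>The numbering selects orbit representatives for the upper bound and names the polynomial
  variables for the lower bound.\<close>

lemma orbit_index:
  assumes Y: "Y \<subseteq> S"
  obtains \<iota> :: "'x \<Rightarrow> nat" where "\<And>x. x \<in> Y \<Longrightarrow> \<iota> x < card (orb Y ` Y)"
    "\<And>i. i < card (orb Y ` Y) \<Longrightarrow> \<exists>x\<in>Y. \<iota> x = i"
    "\<And>x y. x \<in> Y \<Longrightarrow> y \<in> Y \<Longrightarrow> \<iota> x = \<iota> y \<Longrightarrow> orb Y x = orb Y y"
    "\<And>x z. x \<in> Y \<Longrightarrow> z \<in> Y \<Longrightarrow> \<iota> (s z x) = \<iota> x"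
proof -
  have "finite (orb Y ` Y)" using Y finite_S finite_subset by blast
  then obtain f where f: "bij_betw f (orb Y ` Y) {0..<card (orb Y ` Y)}"
    using ex_bij_betw_finite_nat by blast
  have "f (orb Y x) < card (orb Y ` Y)" if "x \<in> Y" for x
    using bij_betw_apply[OF f, of "orb Y x"] that by auto
  moreover have "\<exists>x\<in>Y. f (orb Y x) = i" if "i < card (orb Y ` Y)" for i
  proof -
    have "i \<in> f ` orb Y ` Y" using bij_betw_imp_surj_on[OF f] that by simp
    then show ?thesis by auto
  qed
  moreover have "orb Y x = orb Y y" if "x \<in> Y" "y \<in> Y" "f (orb Y x) = f (orb Y y)" for x y
    using inj_onD[OF bij_betw_imp_inj_on[OF f] that(3)] that by blast
  moreover have "f (orb Y (s z x)) = f (orb Y x)" if "x \<in> Y" "z \<in> Y" for x z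
    using orb_step[OF Y that(2), of x] that(1) Y by auto
  ultimately show thesis by (rule that)
qed

end

section \<open>Both bounds in terms of orbits\<close>

context normal_presentation_algebra
begin

text \<open>\<open>Z\<close> is the set of letters in the smallest prime of the chain. Within an
  orbit all d-th powers are congruent modulo that prime, so one representative per orbit covers the
  remaining letters.\<close>

theorem prime_chain_length_le_orbits:
  assumes chain: "\<And>i. i \<le> n \<Longrightarrow> nc_prime_ideal (Q i) A" "\<And>i. i < n \<Longrightarrow> Q i \<subset> Q (Suc i)"
  shows "\<exists>Z\<subseteq>S. (\<forall>x\<in>S - Z. s x ` Z = Z) \<and> n \<le> card (orb (S - Z) ` (S - Z))"
proof -
  interpret P: normal_presentation_prime S s K "Q 0"
    using chain(1)[of 0] by unfold_locales simp
  let ?Y = "S - P.Z"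
  have ZS: "P.Z \<subseteq> S" by (auto simp: P.Z_def)
  obtain d where d: "is_exponent d" using ex_exponent by blast
  obtain \<iota> where \<iota>: "\<And>x. x \<in> ?Y \<Longrightarrow> \<iota> x < card (orb ?Y ` ?Y)"
    "\<And>i. i < card (orb ?Y ` ?Y) \<Longrightarrow> \<exists>x\<in>?Y. \<iota> x = i"
    "\<And>x y. x \<in> ?Y \<Longrightarrow> y \<in> ?Y \<Longrightarrow> \<iota> x = \<iota> y \<Longrightarrow> orb ?Y x = orb ?Y y"
    by (rule orbit_index[OF Diff_subset[of S P.Z]]) (rule that)
  obtain rep where rep: "\<And>i. i < card (orb ?Y ` ?Y) \<Longrightarrow> rep i \<in> ?Y \<and> \<iota> (rep i) = i"
    using \<iota>(2) by metis
  define Rel where "Rel = (\<lambda>x y. P.cong (replicate d x) (replicate d y))"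
  have rel: "Rel y x" if xy: "x \<in> ?Y" "y \<in> ?Y" "orb ?Y x = orb ?Y y" for x y
  proof -
    have "x \<in> orb ?Y y" using orb_self[of x ?Y] xy by auto
    then obtain g where g: "g \<in> generate (BijGroup S) ((\<lambda>x. restrict (s x) S) ` ?Y)" "x = g y"
      unfolding orb_eq by blast
    have "g y \<in> ?Y \<and> Rel y (g y)"
    proof (rule generate_related[OF P.s_Z ZS _ _ _ _ g(1) xy(2)])
      show "Rel y (s x y)" if "x \<in> ?Y" "y \<in> ?Y" for x y
        unfolding Rel_def using P.power_cong[OF d that(1)] that(2) by blast
      show "Rel y y" if "y \<in> ?Y" for y
        unfolding Rel_def using that by (intro P.cong_E E_refl replicate_lists) simp
      show "Rel x y \<Longrightarrow> Rel y x" for x y unfolding Rel_def by (rule P.cong_sym)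
      show "Rel x y \<Longrightarrow> Rel y z \<Longrightarrow> Rel x z" for x y z unfolding Rel_def by (rule P.cong_trans)
    qed
    then show ?thesis using g by simp
  qed
  have "n \<le> card (orb ?Y ` ?Y)"
  proof (rule P.chain_length_le[OF d _ _ chain HOL.refl])
    show "rep i \<in> ?Y" if "i < card (orb ?Y ` ?Y)" for i using rep[OF that] by blast
    show "\<exists>i<card (orb ?Y ` ?Y). P.cong (replicate d x) (replicate d (rep i))" if x: "x \<in> ?Y" for x
    proof (intro exI conjI)
      show lt: "\<iota> x < card (orb ?Y ` ?Y)" by (rule \<iota>(1)[OF x])
      note r = conjunct1[OF rep[OF lt]] conjunct2[OF rep[OF lt]]
      have "Rel x (rep (\<iota> x))" by (rule rel[OF r(1) x \<iota>(3)[OF r(1) x r(2)]])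
      then show "P.cong (replicate d x) (replicate d (rep (\<iota> x)))" by (simp add: Rel_def)
    qed
  qed
  moreover have "\<forall>x\<in>?Y. s x ` P.Z = P.Z" using P.s_Z by (rule ballI)
  ultimately show ?thesis using ZS by (intro exI[of _ P.Z] conjI)
qed

theorem ex_prime_chain_orbits:
  assumes Z: "\<And>x. x \<in> S - Z \<Longrightarrow> s x ` Z = Z" "Z \<subseteq> S" and c: "c = card (orb (S - Z) ` (S - Z))"
  shows "\<exists>Q. (\<forall>i\<le>c. nc_prime_ideal (Q i) A) \<and> (\<forall>i<c. Q i \<subset> Q (Suc i))"
proof -
  obtain \<iota> where \<iota>: "\<And>i. i < card (orb (S - Z) ` (S - Z)) \<Longrightarrow> \<exists>x\<in>S - Z. \<iota> x = i"
    "\<And>x z. x \<in> S - Z \<Longrightarrow> z \<in> S - Z \<Longrightarrow> \<iota> (s z x) = \<iota> x"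
    by (rule orbit_index[OF Diff_subset[of S Z]]) (rule that)
  show ?thesis unfolding c by (rule ex_chain[OF Z \<iota>(2,1)])
qed

end

section \<open>Krull dimension as the largest orbit count\<close>

theorem theorem3p8:
  fixes S :: "'x set"
    and r :: "'x \<times> 'x \<Rightarrow> 'x \<times> 'x"
    and K :: "('k, 'c) ring_scheme"
  assumes "finite S"
    and "bijective_solution S r"
    and "left_nondegenerate S r"
    and "field K"
  shows "clKdim (monoid_algebra K (derived_monoid S r)) =
    enat (Max {orbit_count S r Z | Z. Z \<in> insert {} (inv_subsets S r)})"
proof -
  interpret N: normal_presentation_algebra S "sigma S r" K
    using assms sigma_bij[OF assms(1-3)]
    by (simp add: normal_presentation_algebra_def normal_presentation_def)
  have A: "monoid_algebra K (derived_monoid S r) = N.A" by (simp add: derived_monoid_def)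
  have count: "orbit_count S r Z = card (N.orb (S - Z) ` (S - Z))" for Z
    by (simp only: orbit_count_def Sigma_group_def N.perm_group_def orbits_def Setcompr_eq_image)
  let ?C = "{orbit_count S r Z | Z. Z \<in> insert {} (inv_subsets S r)}"
  have sub: "insert {} (inv_subsets S r) \<subseteq> Pow S" by (auto simp: inv_subsets_def)
  have fin: "finite (insert {} (inv_subsets S r))" by (rule finite_subset[OF sub]) (simp add: assms(1))
  then have finC: "finite ?C" by (simp only: Setcompr_eq_image) (rule finite_imageI)
  have neC: "?C \<noteq> {}" by blast
  have upper: "n \<le> Max ?C"
    if chain: "\<And>i. i \<le> n \<Longrightarrow> nc_prime_ideal (Q i) N.A" "\<And>i. i < n \<Longrightarrow> Q i \<subset> Q (Suc i)" for n Q
  proof -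
    obtain Z where Z: "Z \<subseteq> S" "\<forall>x\<in>S - Z. sigma S r x ` Z = Z" "n \<le> orbit_count S r Z"
      using N.prime_chain_length_le_orbits[of n Q, OF chain] unfolding count by blast
    show ?thesis
    proof (cases "Z = S")
      \<comment> \<open>The smallest prime may contain all letters. This \<open>Z\<close> is not
        admissible, but its orbit count is zero and forces a chain of length zero.\<close>
      case True
      then have "n = 0" using Z(3) by (simp add: count)
      then show ?thesis by simp
    next
      case False
      then have "orbit_count S r Z \<in> ?C" using Z by (auto simp: inv_subsets_def)
      then show ?thesis using Z(3) Max_ge[OF finC] order_trans by blast
    qed
  qed
  obtain Z where Z: "Z \<in> insert {} (inv_subsets S r)" "Max ?C = orbit_count S r Z"
    using Max_in[OF finC neC] by blast
  have ZS: "Z \<subseteq> S" and inv: "\<And>x. x \<in> S - Z \<Longrightarrow> sigma S r x ` Z = Z"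
    using Z(1) by (auto simp: inv_subsets_def)
  \<comment> \<open>An admissible \<open>Z\<close> attaining the maximum provides a chain of exactly
    that length.\<close>
  have lower: "\<exists>Q. (\<forall>i\<le>Max ?C. nc_prime_ideal (Q i) N.A) \<and> (\<forall>i<Max ?C. Q i \<subset> Q (Suc i))"
    by (rule N.ex_prime_chain_orbits[OF inv ZS]) (assumption, rule Z(2)[unfolded count[of Z]])
  show ?thesis
    unfolding clKdim_def A
  proof (rule antisym)
    show "Sup {enat n | n. \<exists>Q. (\<forall>i\<le>n. nc_prime_ideal (Q i) N.A) \<and> (\<forall>i<n. Q i \<subset> Q (Suc i))}
        \<le> enat (Max ?C)"
    proof (rule Sup_least, elim CollectE exE conjE)
      fix y n Q
      assume y: "y = enat n" and Q: "\<forall>i\<le>n. nc_prime_ideal (Q i) N.A" "\<forall>i<n. Q i \<subset> Q (Suc i)"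
      have "n \<le> Max ?C" by (rule upper[of n Q]) (use Q in blast)+
      then show "y \<le> enat (Max ?C)" by (simp only: y enat_ord_simps)
    qed
    show "enat (Max ?C) \<le>
        Sup {enat n | n. \<exists>Q. (\<forall>i\<le>n. nc_prime_ideal (Q i) N.A) \<and> (\<forall>i<n. Q i \<subset> Q (Suc i))}"
      by (rule Sup_upper) (use lower in blast)
  qed
qed

end
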